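(* Let $\mathcal O_1$ and $\mathcal O_2$ be binary symmetric operads over a field $\mathbb K$, and let $\mathcal T=\mathcal T(\mathcal O_1,\mathcal O_2)$ be the operad of alternating labelled trees built from $\mathcal O_1$ and $\mathcal O_2$ as described in the context. Then $\mathcal T(\mathcal O_1,\mathcal O_2)$ is isomorphic, as a symmetric operad, to the free product $\mathcal O_1\ast\mathcal O_2$.
   Context: A symmetric operad $\mathcal P$ over $\mathbb K$ is a collection of $S_n$-modules $\mathcal P(n)$, $n\ge 1$, with linear composition maps $\gamma^m_{n_1,\dots,n_m}:\mathcal P(m)\otimes\mathcal P(n_1)\otimes\cdots\otimes\mathcal P(n_m)\to\mathcal P(n_1+\dots+n_m)$ which are associative, equivariant, and have an identity $\mathrm{id}\in\mathcal P(1)$. A morphism of operads is a collection of $S_n$-linear maps preserving compositions and identity. An operad is binary if it is generated by its component of arity $2$ (so its component of arity $1$ is $\mathbb K\,\mathrm{id}$). Free product: $\mathcal O_1\ast\mathcal O_2$ is an operad $\mathcal O$ with morphisms $\pi_i:\mathcal O_i\to\mathcal O$, $i=1,2$, such that for every operad $\mathcal P$ and every pair of morphisms $\psi_i:\mathcal O_i\to\mathcal P$ there is a unique morphism $\psi:\mathcal O\to\mathcal P$ with $\psi_i=\psi\pi_i$ for $i=1,2$. Construction of $\mathcal T=\mathcal T(\mathcal O_1,\mathcal O_2)$. Put $\mathcal T(1)=\mathbb K\,\mathrm{id}$, with the convention $\mathcal T(1)^\bullet=\mathcal T(1)^\circ=\mathcal T(1)$. Put $\mathcal T(2)=\mathcal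 T(2)^\bullet\oplus\mathcal T(2)^\circ$ with $\mathcal T(2)^\bullet=\mathcal O_1(2)$, $\mathcal T(2)^\circ=\mathcal O_2(2)$. For $n>2$, let $P(n)$ be the set of partitions $\lambda=(n_1,\dots,n_m)$ of $n$, $n_1\ge\dots\ge n_m\ge1$, $n_1+\dots+n_m=n$, with $m\ge2$ parts, and set $$\mathcal T_\lambda(n)^\bullet=\mathcal O_1(m)\otimes\mathcal T(n_1)^\circ\otimes\cdots\otimes\mathcal T(n_m)^\circ,\qquad \mathcal T_\lambda(n)^\circ=\mathcal O_2(m)\otimes\mathcal T(n_1)^\bullet\otimes\cdots\otimes\mathcal T(n_m)^\bullet .$$ Let $S(m,\lambda)=\{\sigma\in S_m: n_{\sigma(i)}=n_i \text{ for all } i\}$, and let $S(\lambda)\subseteq S_n$ be the subgroup generated by $S_{n_1}\times\dots\times S_{n_m}$ (acting inside consecutive blocks of sizes $n_1,\dots,n_m$) and by $S(m,\lambda)$ (permuting blocks of equal size); it has order $|S(m,\lambda)|\,n_1!\cdots n_m!$ and acts in the obvious way on $\mathcal T_\lambda(n)^\bullet$ and $\mathcal T_\lambda(n)^\circ$ (the block permutations act on $\mathcal O_i(m)$ and permute the tensor factors). Define $$\mathcal T(n)^\bullet=\bigoplus_{\lambda\in P(n)}\mathrm{Ind}_{S(\lambda)}^{S_n}\mathcal T_\lambda(n)^\bullet,\quad \mathcal T(n)^\circ=\bigoplus_{\lambda\in P(n)}\mathrm{Ind}_{S(\lambda)}^{S_n}\mathcal T_\lambda(n)^\circ,\quad \mathcal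 T(n)=\mathcal T(n)^\bullet\oplus\mathcal T(n)^\circ .$$ Composition on $\mathcal T$. Elements of $\mathcal T(n)$ are identified with formal linear combinations of rooted trees with $n$ leaves enumerated by $1,\dots,n$, in which every internal vertex has at least two inputs and is coloured $\bullet$ or $\circ$, no edge joins two internal vertices of the same colour, and each $\bullet$-vertex (resp. $\circ$-vertex) with $m$ inputs is additionally labelled by an element of $\mathcal O_1(m)$ (resp. $\mathcal O_2(m)$); the trees are multilinear in the labels and are taken modulo simultaneous reordering of the inputs of a vertex and the corresponding action of $S_m$ on its label. The summand $\mathcal T(n)^\bullet$ (resp. $\mathcal T(n)^\circ$) corresponds to a root coloured $\bullet$ (resp. $\circ$). The composition $\gamma^n_{m_1,\dots,m_n}(t,t_1,\dots,t_n)$ is obtained by grafting the root of $t_i$ to the $i$-th leaf of $t$ with the usual re-enumeration of leaves, and then contracting every edge that joins two vertices of the same colour, the labels of the glued vertices being composed in $\mathcal O_1$ or $\mathcal O_2$ accordingly. *)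

theory Defs
  imports
    "HOL-Algebra.Algebraic_Closure_Type"
    "HOL-Library.Poly_Mapping"
    "HOL-Combinatorics.Permutations"
begin

section \<open>Symmetric operads\<close>

text \<open>
  Inputs are numbered from \<open>0\<close>, so \<open>S\<^sub>n\<close> is the group of all \<open>\<sigma>\<close> with \<open>\<sigma> permutes {..<n}\<close>.
  The scalar field is the type \<open>'k\<close>; vector spaces over it are modules in the sense of
  HOL-Algebra (whose records have unused multiplicative fields). The composition
  map \<open>P(m) \<otimes> P(n\<^sub>1) \<otimes> \<dots> \<otimes> P(n\<^sub>m) \<rightarrow> P(n\<^sub>1 + \<dots> + n\<^sub>m)\<close> is \<open>op_comp P [n\<^sub>1, \<dots>, n\<^sub>m]\<close>, as a
  multilinear map. Components start in arity 1: nothing is required of \<open>op_space P 0\<close>.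
\<close>

record ('k, 'a) operad =
  op_space :: "nat \<Rightarrow> ('k, 'a) module"
  op_act :: "nat \<Rightarrow> (nat \<Rightarrow> nat) \<Rightarrow> 'a \<Rightarrow> 'a"
  op_comp :: "nat list \<Rightarrow> 'a \<Rightarrow> 'a list \<Rightarrow> 'a"
  op_id :: 'a

abbreviation op_carrier :: "('k, 'a) operad \<Rightarrow> nat \<Rightarrow> 'a set" where
  "op_carrier P n \<equiv> carrier (op_space P n)"

abbreviation is_vector_space :: "('k::field, 'a) module \<Rightarrow> bool" where
  "is_vector_space V \<equiv> Module.module (ring_of_type_algebra :: 'k ring) V"

definition arity_list :: "nat list \<Rightarrow> bool" where
  "arity_list ns \<longleftrightarrow> ns \<noteq> [] \<and> (\<forall>n\<in>set ns. 1 \<le> n)"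

definition op_args :: "('k, 'a) operad \<Rightarrow> nat list \<Rightarrow> 'a list \<Rightarrow> bool" where
  "op_args P ns ys \<longleftrightarrow> list_all2 (\<lambda>n y. y \<in> op_carrier P n) ns ys"

text \<open>
  The set \<open>{..<sum_list ns}\<close> is cut into consecutive blocks of sizes \<open>ns\<close>; \<open>block_start ns i\<close> is
  the first element of block \<open>i\<close>, and \<open>block_of ns j\<close> is the number of the block containing \<open>j\<close>.
  The permutation \<open>block_perm \<sigma> ns\<close> maps the \<open>i\<close>-th block of the layout \<open>permute_list \<sigma> ns\<close>
  increasingly onto the \<open>\<sigma> i\<close>-th block of the layout \<open>ns\<close>, and \<open>block_sum ns [\<tau>\<^sub>1, \<dots>, \<tau>\<^sub>m]\<close> is
  \<open>\<tau>\<^sub>1 \<oplus> \<dots> \<oplus> \<tau>\<^sub>m\<close>.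
\<close>

definition block_start :: "nat list \<Rightarrow> nat \<Rightarrow> nat" where
  "block_start ns i = sum_list (take i ns)"

definition block_of :: "nat list \<Rightarrow> nat \<Rightarrow> nat" where
  "block_of ns j = (LEAST i. j < block_start ns (Suc i))"

definition block_perm :: "(nat \<Rightarrow> nat) \<Rightarrow> nat list \<Rightarrow> nat \<Rightarrow> nat" where
  "block_perm \<sigma> ns j =
    (if j < sum_list ns then
       let ns' = permute_list \<sigma> ns; i = block_of ns' j
       in block_start ns (\<sigma> i) + (j - block_start ns' i)
     else j)"

definition block_sum :: "nat list \<Rightarrow> (nat \<Rightarrow> nat) list \<Rightarrow> nat \<Rightarrow> nat" where
  "block_sum ns \<tau>s j =
    (if j < sum_list ns then
       let i = block_of ns j in block_start ns i + (\<tau>s ! i) (j - block_start ns i)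
     else j)"

text \<open>
  The symmetric groups act on the left: thinking of \<open>x \<in> P(n)\<close> as an operation
  \<open>x(v\<^sub>0, \<dots>, v\<^bsub>n-1\<^esub>)\<close>, the element \<open>\<sigma> x\<close> is \<open>x(v\<^bsub>\<sigma>(0)\<^esub>, \<dots>, v\<^bsub>\<sigma>(n-1)\<^esub>)\<close>.
\<close>

locale symmetric_operad =
  fixes P :: "('k::field, 'a) operad"
  assumes space: "1 \<le> n \<Longrightarrow> is_vector_space (op_space P n)"
    and id_closed: "op_id P \<in> op_carrier P 1"
    and act_closed:
      "\<lbrakk>1 \<le> n; \<sigma> permutes {..<n}; x \<in> op_carrier P n\<rbrakk> \<Longrightarrow> op_act P n \<sigma> x \<in> op_carrier P n"
    and act_add:
      "\<lbrakk>1 \<le> n; \<sigma> permutes {..<n}; x \<in> op_carrier P n; y \<in> op_carrier P n\<rbrakk> \<Longrightarrow>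
        op_act P n \<sigma> (x \<oplus>\<^bsub>op_space P n\<^esub> y) = op_act P n \<sigma> x \<oplus>\<^bsub>op_space P n\<^esub> op_act P n \<sigma> y"
    and act_smult:
      "\<lbrakk>1 \<le> n; \<sigma> permutes {..<n}; x \<in> op_carrier P n\<rbrakk> \<Longrightarrow>
        op_act P n \<sigma> (c \<odot>\<^bsub>op_space P n\<^esub> x) = c \<odot>\<^bsub>op_space P n\<^esub> op_act P n \<sigma> x"
    and act_id: "\<lbrakk>1 \<le> n; x \<in> op_carrier P n\<rbrakk> \<Longrightarrow> op_act P n id x = x"
    and act_compose:
      "\<lbrakk>1 \<le> n; \<sigma> permutes {..<n}; \<tau> permutes {..<n}; x \<in> op_carrier P n\<rbrakk> \<Longrightarrow>
        op_act P n (\<tau> \<circ> \<sigma>) x = op_act P n \<tau> (op_act P n \<sigma> x)"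
    and comp_closed:
      "\<lbrakk>arity_list ns; x \<in> op_carrier P (length ns); op_args P ns ys\<rbrakk> \<Longrightarrow>
        op_comp P ns x ys \<in> op_carrier P (sum_list ns)"
    and comp_add_left:
      "\<lbrakk>arity_list ns; x \<in> op_carrier P (length ns); x' \<in> op_carrier P (length ns); op_args P ns ys\<rbrakk> \<Longrightarrow>
        op_comp P ns (x \<oplus>\<^bsub>op_space P (length ns)\<^esub> x') ys
          = op_comp P ns x ys \<oplus>\<^bsub>op_space P (sum_list ns)\<^esub> op_comp P ns x' ys"
    and comp_smult_left:
      "\<lbrakk>arity_list ns; x \<in> op_carrier P (length ns); op_args P ns ys\<rbrakk> \<Longrightarrow>
        op_comp P ns (c \<odot>\<^bsub>op_space P (length ns)\<^esub> x) ys
          = c \<odot>\<^bsub>op_space P (sum_list ns)\<^esub> op_comp P ns x ys"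
    and comp_add_right:
      "\<lbrakk>arity_list ns; x \<in> op_carrier P (length ns); op_args P ns ys; i < length ns;
        y \<in> op_carrier P (ns ! i); y' \<in> op_carrier P (ns ! i)\<rbrakk> \<Longrightarrow>
        op_comp P ns x (ys[i := y \<oplus>\<^bsub>op_space P (ns ! i)\<^esub> y'])
          = op_comp P ns x (ys[i := y]) \<oplus>\<^bsub>op_space P (sum_list ns)\<^esub> op_comp P ns x (ys[i := y'])"
    and comp_smult_right:
      "\<lbrakk>arity_list ns; x \<in> op_carrier P (length ns); op_args P ns ys; i < length ns;
        y \<in> op_carrier P (ns ! i)\<rbrakk> \<Longrightarrow>
        op_comp P ns x (ys[i := c \<odot>\<^bsub>op_space P (ns ! i)\<^esub> y])
          = c \<odot>\<^bsub>op_space P (sum_list ns)\<^esub> op_comp P ns x (ys[i := y])"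
    and comp_id_left:
      "\<lbrakk>1 \<le> n; x \<in> op_carrier P n\<rbrakk> \<Longrightarrow> op_comp P [n] (op_id P) [x] = x"
    and comp_id_right:
      "\<lbrakk>1 \<le> n; x \<in> op_carrier P n\<rbrakk> \<Longrightarrow> op_comp P (replicate n 1) x (replicate n (op_id P)) = x"
    and comp_assoc:
      "\<lbrakk>arity_list ns; x \<in> op_carrier P (length ns); op_args P ns ys;
        list_all2 (\<lambda>n ps. length ps = n \<and> arity_list ps) ns pss; list_all2 (op_args P) pss zss\<rbrakk> \<Longrightarrow>
        op_comp P (concat pss) (op_comp P ns x ys) (concat zss)
          = op_comp P (map sum_list pss) x
              (map (\<lambda>i. op_comp P (pss ! i) (ys ! i) (zss ! i)) [0..<length ns])"
    and comp_equivariant_left: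
      "\<lbrakk>arity_list ns; x \<in> op_carrier P (length ns); op_args P ns ys; \<sigma> permutes {..<length ns}\<rbrakk> \<Longrightarrow>
        op_comp P ns (op_act P (length ns) \<sigma> x) ys
          = op_act P (sum_list ns) (block_perm \<sigma> ns)
              (op_comp P (permute_list \<sigma> ns) x (permute_list \<sigma> ys))"
    and comp_equivariant_right:
      "\<lbrakk>arity_list ns; x \<in> op_carrier P (length ns); op_args P ns ys;
        list_all2 (\<lambda>n \<tau>. \<tau> permutes {..<n}) ns \<tau>s\<rbrakk> \<Longrightarrow>
        op_comp P ns x (map (\<lambda>i. op_act P (ns ! i) (\<tau>s ! i) (ys ! i)) [0..<length ns])
          = op_act P (sum_list ns) (block_sum ns \<tau>s) (op_comp P ns x ys)"

definition operad_morphism ::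
    "('k::field, 'a) operad \<Rightarrow> ('k, 'b) operad \<Rightarrow> (nat \<Rightarrow> 'a \<Rightarrow> 'b) \<Rightarrow> bool" where
  "operad_morphism P Q f \<longleftrightarrow>
    (\<forall>n\<ge>1. \<forall>x\<in>op_carrier P n. f n x \<in> op_carrier Q n) \<and>
    (\<forall>n\<ge>1. \<forall>x\<in>op_carrier P n. \<forall>y\<in>op_carrier P n.
       f n (x \<oplus>\<^bsub>op_space P n\<^esub> y) = f n x \<oplus>\<^bsub>op_space Q n\<^esub> f n y) \<and>
    (\<forall>n\<ge>1. \<forall>c. \<forall>x\<in>op_carrier P n. f n (c \<odot>\<^bsub>op_space P n\<^esub> x) = c \<odot>\<^bsub>op_space Q n\<^esub> f n x) \<and>
    (\<forall>n\<ge>1. \<forall>\<sigma>. \<forall>x\<in>op_carrier P n. \<sigma> permutes {..<n} \<longrightarrow>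
       f n (op_act P n \<sigma> x) = op_act Q n \<sigma> (f n x)) \<and>
    (\<forall>ns x ys. arity_list ns \<longrightarrow> x \<in> op_carrier P (length ns) \<longrightarrow> op_args P ns ys \<longrightarrow>
       f (sum_list ns) (op_comp P ns x ys) = op_comp Q ns (f (length ns) x) (map2 f ns ys)) \<and>
    f 1 (op_id P) = op_id Q"

definition operad_isomorphic :: "('k::field, 'a) operad \<Rightarrow> ('k, 'b) operad \<Rightarrow> bool" where
  "operad_isomorphic P Q \<longleftrightarrow>
    (\<exists>f. operad_morphism P Q f \<and> (\<forall>n\<ge>1. bij_betw (f n) (op_carrier P n) (op_carrier Q n)))"

inductive in_suboperad ::
    "('k::field, 'a) operad \<Rightarrow> (nat \<Rightarrow> 'a set) \<Rightarrow> nat \<Rightarrow> 'a \<Rightarrow> bool"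
  for P :: "('k::field, 'a) operad" and S :: "nat \<Rightarrow> 'a set" where
  generator: "\<lbrakk>1 \<le> n; x \<in> S n\<rbrakk> \<Longrightarrow> in_suboperad P S n x"
| identity: "in_suboperad P S 1 (op_id P)"
| zero: "1 \<le> n \<Longrightarrow> in_suboperad P S n \<zero>\<^bsub>op_space P n\<^esub>"
| add: "\<lbrakk>in_suboperad P S n x; in_suboperad P S n y\<rbrakk> \<Longrightarrow>
    in_suboperad P S n (x \<oplus>\<^bsub>op_space P n\<^esub> y)"
| smult: "in_suboperad P S n x \<Longrightarrow> in_suboperad P S n (c \<odot>\<^bsub>op_space P n\<^esub> x)"
| act: "\<lbrakk>in_suboperad P S n x; \<sigma> permutes {..<n}\<rbrakk> \<Longrightarrow> in_suboperad P S n (op_act P n \<sigma> x)"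
| comp: "\<lbrakk>arity_list ns; in_suboperad P S (length ns) x; list_all2 (in_suboperad P S) ns ys\<rbrakk> \<Longrightarrow>
    in_suboperad P S (sum_list ns) (op_comp P ns x ys)"

text \<open>
  An operad is binary if it is generated by its component of arity 2. The component of arity 1
  is then spanned by the identity; that it is a copy of the ground field amounts to
  \<open>op_id P \<noteq> 0\<close>, which excludes only the operad all of whose components vanish.
\<close>

definition binary_operad :: "('k::field, 'a) operad \<Rightarrow> bool" where
  "binary_operad P \<longleftrightarrow>
    symmetric_operad P \<and>
    (\<forall>n\<ge>1. \<forall>x\<in>op_carrier P n. in_suboperad P (\<lambda>m. if m = 2 then op_carrier P 2 else {}) n x) \<and>
    op_id P \<noteq> \<zero>\<^bsub>op_space P 1\<^esub>"

text \<open>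
  \<open>(Q, \<pi>\<^sub>1, \<pi>\<^sub>2)\<close> is a free product of \<open>O\<^sub>1\<close> and \<open>O\<^sub>2\<close>. HOL cannot quantify over types, so the
  universal property is relative to test operads whose elements have type \<open>'p\<close>.
\<close>

definition free_product ::
    "'p itself \<Rightarrow> ('k::field, 'a) operad \<Rightarrow> ('k, 'b) operad \<Rightarrow>
     ('k, 'q) operad \<Rightarrow> (nat \<Rightarrow> 'a \<Rightarrow> 'q) \<Rightarrow> (nat \<Rightarrow> 'b \<Rightarrow> 'q) \<Rightarrow> bool" where
  "free_product TP O1 O2 Q \<pi>1 \<pi>2 \<longleftrightarrow>
    symmetric_operad Q \<and> operad_morphism O1 Q \<pi>1 \<and> operad_morphism O2 Q \<pi>2 \<and>
    (\<forall>(P :: ('k, 'p) operad) \<psi>1 \<psi>2.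
       symmetric_operad P \<and> operad_morphism O1 P \<psi>1 \<and> operad_morphism O2 P \<psi>2 \<longrightarrow>
       (let factors = (\<lambda>\<psi>. operad_morphism Q P \<psi> \<and>
              (\<forall>n\<ge>1. \<forall>x\<in>op_carrier O1 n. \<psi> n (\<pi>1 n x) = \<psi>1 n x) \<and>
              (\<forall>n\<ge>1. \<forall>x\<in>op_carrier O2 n. \<psi> n (\<pi>2 n x) = \<psi>2 n x))
        in (\<exists>\<psi>. factors \<psi>) \<and>
           (\<forall>\<psi> \<psi>'. factors \<psi> \<and> factors \<psi>' \<longrightarrow> (\<forall>n\<ge>1. \<forall>x\<in>op_carrier Q n. \<psi> n x = \<psi>' n x))))"


section \<open>Alternating labelled trees\<close>

text \<open>
  Rooted trees with numbered leaves; a vertex carries its label and the ordered list of its inputs.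
\<close>

datatype ('a, 'b) ltree =
    is_Leaf: Leaf nat
  | is_Black: Black 'a "('a, 'b) ltree list"
  | is_White: White 'b "('a, 'b) ltree list"

fun leaves :: "('a, 'b) ltree \<Rightarrow> nat list" where
  "leaves (Leaf i) = [i]"
| "leaves (Black a ts) = concat (map leaves ts)"
| "leaves (White b ts) = concat (map leaves ts)"

fun alternating :: "('k, 'a) operad \<Rightarrow> ('k, 'b) operad \<Rightarrow> ('a, 'b) ltree \<Rightarrow> bool" where
  "alternating O1 O2 (Leaf i) \<longleftrightarrow> True"
| "alternating O1 O2 (Black a ts) \<longleftrightarrow>
     2 \<le> length ts \<and> a \<in> op_carrier O1 (length ts) \<and>
     (\<forall>t\<in>set ts. \<not> is_Black t \<and> alternating O1 O2 t)"
| "alternating O1 O2 (White b ts) \<longleftrightarrow>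
     2 \<le> length ts \<and> b \<in> op_carrier O2 (length ts) \<and>
     (\<forall>t\<in>set ts. \<not> is_White t \<and> alternating O1 O2 t)"

definition alt_trees :: "('k, 'a) operad \<Rightarrow> ('k, 'b) operad \<Rightarrow> nat \<Rightarrow> ('a, 'b) ltree set" where
  "alt_trees O1 O2 n =
    {t. alternating O1 O2 t \<and> distinct (leaves t) \<and> set (leaves t) = {..<n}}"

fun relabel :: "(nat \<Rightarrow> nat) \<Rightarrow> ('a, 'b) ltree \<Rightarrow> ('a, 'b) ltree" where
  "relabel \<sigma> (Leaf i) = Leaf (\<sigma> i)"
| "relabel \<sigma> (Black a ts) = Black a (map (relabel \<sigma>) ts)"
| "relabel \<sigma> (White b ts) = White b (map (relabel \<sigma>) ts)"


subsection \<open>Grafting\<close>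

text \<open>
  \<open>black_vertex O1 a ts\<close> is a black vertex with label \<open>a\<close> and inputs \<open>ts\<close>, in which the edges to
  black roots among the \<open>ts\<close> have been contracted: such a root is replaced by its own inputs, and
  its label is composed into \<open>a\<close>; the identity is composed into the other inputs.
\<close>

fun black_label :: "('k, 'a) operad \<Rightarrow> ('a, 'b) ltree \<Rightarrow> 'a" where
  "black_label O1 (Black a ts) = a"
| "black_label O1 t = op_id O1"

fun black_inputs :: "('a, 'b) ltree \<Rightarrow> ('a, 'b) ltree list" where
  "black_inputs (Black a ts) = ts"
| "black_inputs t = [t]"

fun white_label :: "('k, 'b) operad \<Rightarrow> ('a, 'b) ltree \<Rightarrow> 'b" where
  "white_label O2 (White b ts) = b"
| "white_label O2 t = op_id O2"

fun white_inputs :: "('a, 'b) ltree \<Rightarrow> ('a, 'b) ltree list" where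
  "white_inputs (White b ts) = ts"
| "white_inputs t = [t]"

definition black_vertex :: "('k, 'a) operad \<Rightarrow> 'a \<Rightarrow> ('a, 'b) ltree list \<Rightarrow> ('a, 'b) ltree" where
  "black_vertex O1 a ts =
    Black (op_comp O1 (map (length \<circ> black_inputs) ts) a (map (black_label O1) ts))
      (concat (map black_inputs ts))"

definition white_vertex :: "('k, 'b) operad \<Rightarrow> 'b \<Rightarrow> ('a, 'b) ltree list \<Rightarrow> ('a, 'b) ltree" where
  "white_vertex O2 b ts =
    White (op_comp O2 (map (length \<circ> white_inputs) ts) b (map (white_label O2) ts))
      (concat (map white_inputs ts))"

fun graft :: "('k, 'a) operad \<Rightarrow> ('k, 'b) operad \<Rightarrow> (nat \<Rightarrow> ('a, 'b) ltree) \<Rightarrow>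
    ('a, 'b) ltree \<Rightarrow> ('a, 'b) ltree" where
  "graft O1 O2 s (Leaf i) = s i"
| "graft O1 O2 s (Black a ts) = black_vertex O1 a (map (graft O1 O2 s) ts)"
| "graft O1 O2 s (White b ts) = white_vertex O2 b (map (graft O1 O2 s) ts)"

definition tree_comp :: "('k, 'a) operad \<Rightarrow> ('k, 'b) operad \<Rightarrow> nat list \<Rightarrow>
    ('a, 'b) ltree \<Rightarrow> ('a, 'b) ltree list \<Rightarrow> ('a, 'b) ltree" where
  "tree_comp O1 O2 ns t ts =
    graft O1 O2 (\<lambda>i. relabel (\<lambda>j. block_start ns i + j) (ts ! i)) t"


subsection \<open>Formal linear combinations of trees and the relations between them\<close>

definition scale :: "'k::field \<Rightarrow> ('t \<Rightarrow>\<^sub>0 'k) \<Rightarrow> 't \<Rightarrow>\<^sub>0 'k" where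
  "scale c x = Poly_Mapping.map ((*) c) x"

lemma lookup_scale: "Poly_Mapping.lookup (scale c x) t = c * Poly_Mapping.lookup x t"
  by (simp add: scale_def Poly_Mapping.map.rep_eq when_def)

global_interpretation formal: vector_space "scale :: 'k::field \<Rightarrow> ('t \<Rightarrow>\<^sub>0 'k) \<Rightarrow> 't \<Rightarrow>\<^sub>0 'k"
  by unfold_locales (auto intro!: poly_mapping_eqI simp: lookup_scale lookup_add algebra_simps)

text \<open>
  \<open>vertex_linear O1 O2 c d t u v\<close>: the trees agree except for the label of one vertex, which is
  \<open>a\<close> in \<open>t\<close>, \<open>b\<close> in \<open>u\<close> and \<open>c a + d b\<close> in \<open>v\<close>.
\<close>

inductive vertex_linear :: "('k::field, 'a) operad \<Rightarrow> ('k, 'b) operad \<Rightarrow> 'k \<Rightarrow> 'k \<Rightarrow>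
    ('a, 'b) ltree \<Rightarrow> ('a, 'b) ltree \<Rightarrow> ('a, 'b) ltree \<Rightarrow> bool"
  for O1 :: "('k::field, 'a) operad" and O2 :: "('k, 'b) operad" and c d :: 'k where
  black: "V = op_space O1 (length ts) \<Longrightarrow>
    vertex_linear O1 O2 c d (Black a ts) (Black b ts) (Black ((c \<odot>\<^bsub>V\<^esub> a) \<oplus>\<^bsub>V\<^esub> (d \<odot>\<^bsub>V\<^esub> b)) ts)"
| white: "V = op_space O2 (length ts) \<Longrightarrow>
    vertex_linear O1 O2 c d (White a ts) (White b ts) (White ((c \<odot>\<^bsub>V\<^esub> a) \<oplus>\<^bsub>V\<^esub> (d \<odot>\<^bsub>V\<^esub> b)) ts)"
| below_black: "vertex_linear O1 O2 c d t u v \<Longrightarrow>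
    vertex_linear O1 O2 c d
      (Black e (ls @ t # rs)) (Black e (ls @ u # rs)) (Black e (ls @ v # rs))"
| below_white: "vertex_linear O1 O2 c d t u v \<Longrightarrow>
    vertex_linear O1 O2 c d
      (White e (ls @ t # rs)) (White e (ls @ u # rs)) (White e (ls @ v # rs))"

text \<open>
  \<open>vertex_reorder O1 O2 t u\<close>: the inputs of one vertex are reordered, as dictated by
  \<open>(\<sigma> a)(t\<^sub>0, \<dots>, t\<^bsub>m-1\<^esub>) = a(t\<^bsub>\<sigma>(0)\<^esub>, \<dots>, t\<^bsub>\<sigma>(m-1)\<^esub>)\<close>.
\<close>

inductive vertex_reorder :: "('k, 'a) operad \<Rightarrow> ('k, 'b) operad \<Rightarrow>
    ('a, 'b) ltree \<Rightarrow> ('a, 'b) ltree \<Rightarrow> bool"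
  for O1 :: "('k, 'a) operad" and O2 :: "('k, 'b) operad" where
  black: "\<sigma> permutes {..<length ts} \<Longrightarrow>
    vertex_reorder O1 O2 (Black (op_act O1 (length ts) \<sigma> a) ts) (Black a (permute_list \<sigma> ts))"
| white: "\<sigma> permutes {..<length ts} \<Longrightarrow>
    vertex_reorder O1 O2 (White (op_act O2 (length ts) \<sigma> b) ts) (White b (permute_list \<sigma> ts))"
| below_black: "vertex_reorder O1 O2 t u \<Longrightarrow>
    vertex_reorder O1 O2 (Black e (ls @ t # rs)) (Black e (ls @ u # rs))"
| below_white: "vertex_reorder O1 O2 t u \<Longrightarrow>
    vertex_reorder O1 O2 (White e (ls @ t # rs)) (White e (ls @ u # rs))"

definition formal_trees ::
    "('k::field, 'a) operad \<Rightarrow> ('k, 'b) operad \<Rightarrow> nat \<Rightarrow> (('a, 'b) ltree \<Rightarrow>\<^sub>0 'k) set" where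
  "formal_trees O1 O2 n = {x. Poly_Mapping.keys x \<subseteq> alt_trees O1 O2 n}"

abbreviation single_tree :: "('a, 'b) ltree \<Rightarrow> ('a, 'b) ltree \<Rightarrow>\<^sub>0 'k::field" where
  "single_tree t \<equiv> Poly_Mapping.single t 1"

definition tree_relators ::
    "('k::field, 'a) operad \<Rightarrow> ('k, 'b) operad \<Rightarrow> nat \<Rightarrow> (('a, 'b) ltree \<Rightarrow>\<^sub>0 'k) set" where
  "tree_relators O1 O2 n =
    {single_tree v - (scale c (single_tree t) + scale d (single_tree u)) | c d t u v.
       vertex_linear O1 O2 c d t u v \<and> {t, u, v} \<subseteq> alt_trees O1 O2 n} \<union>
    {single_tree t - single_tree u | t u.
       vertex_reorder O1 O2 t u \<and> {t, u} \<subseteq> alt_trees O1 O2 n}"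

definition tree_equiv :: "('k::field, 'a) operad \<Rightarrow> ('k, 'b) operad \<Rightarrow> nat \<Rightarrow>
    ((('a, 'b) ltree \<Rightarrow>\<^sub>0 'k) \<times> (('a, 'b) ltree \<Rightarrow>\<^sub>0 'k)) set" where
  "tree_equiv O1 O2 n =
    {(x, y). x \<in> formal_trees O1 O2 n \<and> y \<in> formal_trees O1 O2 n \<and>
       x - y \<in> formal.span (tree_relators O1 O2 n)}"

abbreviation tree_class :: "('k::field, 'a) operad \<Rightarrow> ('k, 'b) operad \<Rightarrow> nat \<Rightarrow>
    (('a, 'b) ltree \<Rightarrow>\<^sub>0 'k) \<Rightarrow> (('a, 'b) ltree \<Rightarrow>\<^sub>0 'k) set" where
  "tree_class O1 O2 n x \<equiv> tree_equiv O1 O2 n `` {x}"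


subsection \<open>The operad of alternating labelled trees\<close>

definition relabel_ext :: "(nat \<Rightarrow> nat) \<Rightarrow> (('a, 'b) ltree \<Rightarrow>\<^sub>0 'k::field) \<Rightarrow> ('a, 'b) ltree \<Rightarrow>\<^sub>0 'k" where
  "relabel_ext \<sigma> x =
    (\<Sum>t\<in>Poly_Mapping.keys x. Poly_Mapping.single (relabel \<sigma> t) (Poly_Mapping.lookup x t))"

definition tree_comp_ext :: "('k::field, 'a) operad \<Rightarrow> ('k, 'b) operad \<Rightarrow> nat list \<Rightarrow>
    (('a, 'b) ltree \<Rightarrow>\<^sub>0 'k) \<Rightarrow> (('a, 'b) ltree \<Rightarrow>\<^sub>0 'k) list \<Rightarrow> ('a, 'b) ltree \<Rightarrow>\<^sub>0 'k" where
  "tree_comp_ext O1 O2 ns x ys =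
    (\<Sum>t\<in>Poly_Mapping.keys x. \<Sum>ts\<in>listset (map Poly_Mapping.keys ys).
       Poly_Mapping.single (tree_comp O1 O2 ns t ts)
         (Poly_Mapping.lookup x t * (\<Prod>i<length ys. Poly_Mapping.lookup (ys ! i) (ts ! i))))"

text \<open>
  All operations act on representatives; the unions are over sets of pairwise equal classes.
\<close>

definition tree_space :: "('k::field, 'a) operad \<Rightarrow> ('k, 'b) operad \<Rightarrow> nat \<Rightarrow>
    ('k, (('a, 'b) ltree \<Rightarrow>\<^sub>0 'k) set) module" where
  "tree_space O1 O2 n =
    \<lparr>carrier = formal_trees O1 O2 n // tree_equiv O1 O2 n,
     monoid.mult = undefined,
     monoid.one = undefined,
     ring.zero = tree_class O1 O2 n 0,
     ring.add = (\<lambda>A B. \<Union>x\<in>A. \<Union>y\<in>B. tree_class O1 O2 n (x + y)),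
     module.smult = (\<lambda>c A. \<Union>x\<in>A. tree_class O1 O2 n (scale c x))\<rparr>"

definition tree_operad :: "('k::field, 'a) operad \<Rightarrow> ('k, 'b) operad \<Rightarrow>
    ('k, (('a, 'b) ltree \<Rightarrow>\<^sub>0 'k) set) operad" where
  "tree_operad O1 O2 =
    \<lparr>op_space = tree_space O1 O2,
     op_act = (\<lambda>n \<sigma> A. \<Union>x\<in>A. tree_class O1 O2 n (relabel_ext \<sigma> x)),
     op_comp = (\<lambda>ns A Bs. \<Union>x\<in>A. \<Union>ys\<in>listset Bs.
        tree_class O1 O2 (sum_list ns) (tree_comp_ext O1 O2 ns x ys)),
     op_id = tree_class O1 O2 1 (single_tree (Leaf 0))\<rparr>"

text \<open>
  The canonical maps from the factors: \<open>a \<in> O\<^sub>i(n)\<close> goes to the tree with a single internal vertex,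
  labelled by \<open>a\<close>; in arity 1, where there is no such tree, \<open>c id\<close> goes to \<open>c\<close> times the trivial tree.
\<close>

definition incl1 :: "('k::field, 'a) operad \<Rightarrow> ('k, 'b) operad \<Rightarrow> nat \<Rightarrow>
    'a \<Rightarrow> (('a, 'b) ltree \<Rightarrow>\<^sub>0 'k) set" where
  "incl1 O1 O2 n a = tree_class O1 O2 n
    (if n = 1 then scale (THE c. a = c \<odot>\<^bsub>op_space O1 1\<^esub> op_id O1) (single_tree (Leaf 0))
     else single_tree (Black a (map Leaf [0..<n])))"

definition incl2 :: "('k::field, 'a) operad \<Rightarrow> ('k, 'b) operad \<Rightarrow> nat \<Rightarrow>
    'b \<Rightarrow> (('a, 'b) ltree \<Rightarrow>\<^sub>0 'k) set" where
  "incl2 O1 O2 n b = tree_class O1 O2 n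
    (if n = 1 then scale (THE c. b = c \<odot>\<^bsub>op_space O2 1\<^esub> op_id O2) (single_tree (Leaf 0))
     else single_tree (White b (map Leaf [0..<n])))"

end

theory Submission
  imports Defs
begin

text \<open>
  Write \<open>T\<close> for the operad of alternating trees. It is a free product of \<open>O\<^sub>1\<close> and \<open>O\<^sub>2\<close> because an
  alternating tree is nothing but an iterated composition of its vertex labels, and the relations
  imposed on trees are exactly those that hold between such compositions in every operad.

  That \<open>T\<close> is an operad is decided on single trees. Grafting with contraction of monochromatic
  edges is associative and unital on the nose (\<open>graft_graft\<close>, \<open>graft_Leaf\<close>): a contraction composes
  labels inside \<open>O\<^sub>i\<close>, a root that is not contracted contributes the identity of \<open>O\<^sub>i\<close>, and what
  remains is associativity and unitality of \<open>O\<^sub>i\<close>. Equivariance is on the nose too, since leaves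
  carry numbers. The quotient by linearity and reordering at the vertices is compatible with all
  of this because grafting maps an instance of a relation, in the outer tree or in one of the
  grafted trees, to one instance of the same relation (\<open>relation_map_tree_comp_left\<close>,
  \<open>relation_map_tree_comp_right\<close>). Everything then extends multilinearly to formal combinations
  and descends to classes (\<open>symmetric_operad_tree_operad\<close>).

  Binarity enters through \<open>O\<^sub>i(1) = K id\<close> and \<open>id \<noteq> 0\<close>: vertices have at least two inputs, and the
  only operations that are not seen at a vertex are the multiples of the identity, which go to the
  multiples of the trivial tree. This makes the canonical maps \<open>O\<^sub>i \<rightarrow> T\<close> well defined morphisms
  (\<open>incl_morphism\<close>).

  Given morphisms \<open>\<psi>\<^sub>i : O\<^sub>i \<rightarrow> Q\<close>, a tree is evaluated in \<open>Q\<close> by applying \<open>\<psi>\<^sub>i\<close> to the labels, composing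
  along the tree with its leaves in planar order, and acting by the permutation that the numbers
  of the leaves describe. Contraction does not change the value, as \<open>\<psi>\<^sub>i\<close> preserves composition; the
  vertex relations hold for the values, as composition in \<open>Q\<close> is multilinear and equivariant. So
  there is an induced morphism \<open>T \<rightarrow> Q\<close> (\<open>induced_morphism\<close>). It is the only one compatible with
  the \<open>\<psi>\<^sub>i\<close>: evaluating a tree in \<open>T\<close> itself along the canonical maps gives back the class of the tree
  (\<open>tree_value_in_trees\<close>), and morphisms commute with evaluation. The isomorphism with any other free
  product is the usual comparison of two universal objects (\<open>free_products_isomorphic\<close>).
\<close>

section \<open>Block permutations\<close>

lemma block_start_0 [simp]: "block_start ns 0 = 0"
  by (simp add: block_start_def)

lemma block_start_Suc [simp]:
  "i < length ns \<Longrightarrow> block_start ns (Suc i) = block_start ns i + ns ! i"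
  by (simp add: block_start_def take_Suc_conv_app_nth)

lemma block_start_length [simp]: "block_start ns (length ns) = sum_list ns"
  by (simp add: block_start_def)

lemma block_start_Cons_Suc [simp]: "block_start (n # ns) (Suc i) = n + block_start ns i"
  by (simp add: block_start_def)

lemma block_start_mono: "i \<le> j \<Longrightarrow> block_start ns i \<le> block_start ns j"
  by (metis block_start_def le_add1 le_add_diff_inverse sum_list_append take_add)

lemma block_element_less:
  assumes "i < length ns" "k < ns ! i"
  shows "block_start ns i + k < sum_list ns"
  using assms block_start_mono[of "Suc i" "length ns" ns] by simp

lemma block_of_element:
  assumes "i < length ns" "k < ns ! i"
  shows "block_of ns (block_start ns i + k) = i"
  unfolding block_of_def
proof (rule Least_equality)
  show "block_start ns i + k < block_start ns (Suc i)"
    using assms by simp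
  show "i \<le> j" if "block_start ns i + k < block_start ns (Suc j)" for j
    using that block_start_mono[of "Suc j" i ns] by (meson leD le_add1 le_trans not_less_eq_eq)
qed

text \<open>
  Enumerating block by block turns statements about \<open>{..<sum_list ns}\<close> into statements about an
  element \<open>k\<close> of a block \<open>i\<close>, where \<open>block_perm\<close> and \<open>block_sum\<close> have simple formulas.
\<close>

lemma map_upt_blocks:
  "map f [0..<sum_list ns] =
    concat (map (\<lambda>i. map (\<lambda>k. f (block_start ns i + k)) [0..<ns ! i]) [0..<length ns])"
proof -
  have "map f [0..<block_start ns m] =
      concat (map (\<lambda>i. map (\<lambda>k. f (block_start ns i + k)) [0..<ns ! i]) [0..<m])"
    if "m \<le> length ns" for m
    using that
  proof (induction m)
    case (Suc m)
    have "map f [block_start ns m..<block_start ns m + ns ! m] =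
        map (\<lambda>k. f (block_start ns m + k)) [0..<ns ! m]"
      by (rule nth_equalityI) simp_all
    with Suc show ?case
      by (simp add: upt_add_eq_append[of 0 "block_start ns m" "ns ! m"])
  qed simp
  from this[of "length ns"] show ?thesis by simp
qed

lemma nth_concat_block:
  assumes "i < length xss" "k < length (xss ! i)"
  shows "concat xss ! (block_start (map length xss) i + k) = xss ! i ! k"
  using assms
proof (induction xss arbitrary: i)
  case (Cons xs xss)
  then show ?case by (cases i) (simp_all add: nth_append)
qed simp

text \<open>
  Needed for associativity: a leaf that is grafted twice gets the same offset whether the inner
  layouts are concatenated first or their sums are laid out.
\<close>

lemma block_start_concat:
  assumes "i < length pss" "k \<le> length (pss ! i)"
  shows "block_start (concat pss) (block_start (map length pss) i + k) =
    block_start (map sum_list pss) i + block_start (pss ! i) k"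
  using assms
proof (induction pss arbitrary: i)
  case (Cons ps pss)
  show ?case
  proof (cases i)
    case 0
    with Cons.prems show ?thesis by (simp add: block_start_def)
  next
    case (Suc i')
    have "block_start (ps @ concat pss) (length ps + m) = sum_list ps + block_start (concat pss) m" for m
      by (simp add: block_start_def)
    with Suc Cons show ?thesis by (simp add: add.assoc)
  qed
qed simp

lemma permutes_if_mset_map:
  assumes "mset (map f [0..<n]) = mset [0..<n]" "\<And>j. n \<le> j \<Longrightarrow> f j = j"
  shows "f permutes {..<n}"
proof (rule bij_imp_permutes)
  have "distinct (map f [0..<n])"
    using mset_eq_imp_distinct_iff[OF assms(1)] by simp
  moreover have "f ` {..<n} = {..<n}"
    using mset_eq_setD[OF assms(1)] by (simp add: atLeast0LessThan)
  ultimately show "bij_betw f {..<n} {..<n}"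
    by (simp add: bij_betw_def distinct_map atLeast0LessThan)
qed (use assms(2) in auto)

lemma mset_concat_cong:
  assumes "mset xs = mset ys" "\<And>x. x \<in> set xs \<Longrightarrow> mset (f x) = mset (g x)"
  shows "mset (concat (map f xs)) = mset (concat (map g ys))"
proof -
  have "mset (concat (map f xs)) = (\<Sum>x\<in>#mset xs. mset (f x))" for f :: "'a \<Rightarrow> 'b list" and xs
    by (induction xs) simp_all
  moreover have "(\<Sum>x\<in>#mset xs. mset (f x)) = (\<Sum>x\<in>#mset ys. mset (g x))"
    using assms by (metis (mono_tags, lifting) image_mset_cong set_mset_mset)
  ultimately show ?thesis by simp
qed

lemma block_perm_element:
  assumes "\<sigma> permutes {..<length ns}" "i < length ns" "k < ns ! \<sigma> i"
  shows "block_perm \<sigma> ns (block_start (permute_list \<sigma> ns) i + k) = block_start ns (\<sigma> i) + k"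
proof -
  let ?ns = "permute_list \<sigma> ns"
  have sum: "sum_list ?ns = sum_list ns"
    using mset_permute_list[OF assms(1)] by (metis sum_mset_sum_list)
  have nth: "?ns ! i = ns ! \<sigma> i"
    using assms by (simp add: permute_list_nth)
  show ?thesis
    using assms block_of_element[of i ?ns k] block_element_less[of i ?ns k]
    by (simp add: block_perm_def nth sum Let_def)
qed

lemma map_block_perm:
  assumes "\<sigma> permutes {..<length ns}"
  shows "map (\<lambda>j. f (block_perm \<sigma> ns j)) [0..<sum_list ns] =
    concat (map (\<lambda>i. map (\<lambda>k. f (block_start ns (\<sigma> i) + k)) [0..<ns ! \<sigma> i]) [0..<length ns])"
proof -
  let ?ns = "permute_list \<sigma> ns"
  have sum: "sum_list ?ns = sum_list ns"
    using mset_permute_list[OF assms] by (metis sum_mset_sum_list)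
  have "map (\<lambda>j. f (block_perm \<sigma> ns j)) [0..<sum_list ?ns] =
    concat (map (\<lambda>i. map (\<lambda>k. f (block_start ns (\<sigma> i) + k)) [0..<ns ! \<sigma> i]) [0..<length ns])"
    unfolding map_upt_blocks using assms
    by (intro arg_cong[of _ _ concat] map_cong) (auto simp: block_perm_element permute_list_nth)
  then show ?thesis by (simp add: sum)
qed

lemma block_perm_permutes:
  assumes "\<sigma> permutes {..<length ns}"
  shows "block_perm \<sigma> ns permutes {..<sum_list ns}"
proof (rule permutes_if_mset_map)
  have "mset (map \<sigma> [0..<length ns]) = mset [0..<length ns]"
    using permutes_image_mset[OF assms] by (simp add: atLeast0LessThan)
  then have "mset (concat (map (\<lambda>i. map (\<lambda>k. block_start ns i + k) [0..<ns ! i]) (map \<sigma> [0..<length ns])))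
      = mset (concat (map (\<lambda>i. map (\<lambda>k. block_start ns i + k) [0..<ns ! i]) [0..<length ns]))"
    by (rule mset_concat_cong) simp
  also have "\<dots> = mset [0..<sum_list ns]"
    using map_upt_blocks[of "\<lambda>j. j" ns] by (metis list.map_ident)
  finally show "mset (map (block_perm \<sigma> ns) [0..<sum_list ns]) = mset [0..<sum_list ns]"
    unfolding map_block_perm[OF assms, of "\<lambda>j. j"] by (simp only: map_map comp_def)
qed (simp add: block_perm_def)

text \<open>
  The combinatorial content of equivariance in the outer argument: permuting blocks as wholes
  permutes the concatenated list by \<open>block_perm\<close>.
\<close>

lemma permute_list_block_perm:
  assumes "\<sigma> permutes {..<length xss}"
  shows "permute_list (block_perm \<sigma> (map length xss)) (concat xss) = concat (permute_list \<sigma> xss)"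
proof -
  have \<sigma>: "\<sigma> i < length xss" if "i < length xss" for i
    using permutes_in_image[OF assms] that by simp
  have "permute_list (block_perm \<sigma> (map length xss)) (concat xss) =
      map (\<lambda>j. concat xss ! block_perm \<sigma> (map length xss) j) [0..<sum_list (map length xss)]"
    by (simp add: permute_list_def length_concat)
  also have "\<dots> = concat (map (\<lambda>i. map (\<lambda>k. xss ! \<sigma> i ! k) [0..<length (xss ! \<sigma> i)]) [0..<length xss])"
    using assms
    by (subst map_block_perm)
      (auto intro!: arg_cong[of _ _ concat] map_cong simp: nth_concat_block \<sigma>)
  finally show ?thesis
    by (simp add: permute_list_def map_nth)
qed

lemma block_sum_element:
  assumes "i < length ns" "k < ns ! i"
  shows "block_sum ns \<tau>s (block_start ns i + k) = block_start ns i + (\<tau>s ! i) k"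
  using assms block_of_element[of i ns k] block_element_less[of i ns k]
  by (simp add: block_sum_def Let_def)

lemma map_block_sum:
  "map (\<lambda>j. f (block_sum ns \<tau>s j)) [0..<sum_list ns] =
    concat (map (\<lambda>i. map (\<lambda>k. f (block_start ns i + (\<tau>s ! i) k)) [0..<ns ! i]) [0..<length ns])"
  unfolding map_upt_blocks
  by (intro arg_cong[of _ _ concat] map_cong) (auto simp: block_sum_element)

lemma block_sum_permutes:
  assumes "list_all2 (\<lambda>n \<tau>. \<tau> permutes {..<n}) ns \<tau>s"
  shows "block_sum ns \<tau>s permutes {..<sum_list ns}"
proof (rule permutes_if_mset_map)
  have \<tau>: "\<tau>s ! i permutes {..<ns ! i}" if "i < length ns" for i
    using assms that by (simp add: list_all2_conv_all_nth)
  have "mset (map (\<lambda>k. block_start ns i + (\<tau>s ! i) k) [0..<ns ! i]) =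
      mset (map (\<lambda>k. block_start ns i + k) [0..<ns ! i])" if "i < length ns" for i
  proof -
    have "mset (map (\<tau>s ! i) [0..<ns ! i]) = mset [0..<ns ! i]"
      using permutes_image_mset[OF \<tau>[OF that]] by (simp add: atLeast0LessThan)
    then have "mset (map ((+) (block_start ns i)) (map (\<tau>s ! i) [0..<ns ! i])) =
        mset (map ((+) (block_start ns i)) [0..<ns ! i])"
      by (metis mset_map)
    then show ?thesis by (simp add: comp_def)
  qed
  then show "mset (map (block_sum ns \<tau>s) [0..<sum_list ns]) = mset [0..<sum_list ns]"
    using map_block_sum[of "\<lambda>j. j" ns \<tau>s] map_upt_blocks[of "\<lambda>j. j" ns]
    by (auto intro!: mset_concat_cong)
qed (simp add: block_sum_def)

lemma permute_list_block_sum: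
  assumes "list_all2 (\<lambda>xs \<tau>. \<tau> permutes {..<length xs}) xss \<tau>s"
  shows "permute_list (block_sum (map length xss) \<tau>s) (concat xss) =
    concat (map2 permute_list \<tau>s xss)"
proof -
  have \<tau>: "\<tau>s ! i permutes {..<length (xss ! i)}" if "i < length xss" for i
    using assms that by (simp add: list_all2_conv_all_nth)
  have len: "length \<tau>s = length xss"
    using assms by (simp add: list_all2_lengthD)
  have "permute_list (block_sum (map length xss) \<tau>s) (concat xss) =
      map (\<lambda>j. concat xss ! block_sum (map length xss) \<tau>s j) [0..<sum_list (map length xss)]"
    by (simp add: permute_list_def length_concat)
  also have "\<dots> = concat (map (\<lambda>i. map (\<lambda>k. xss ! i ! (\<tau>s ! i) k) [0..<length (xss ! i)]) [0..<length xss])"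
    using permutes_in_image[OF \<tau>] unfolding map_block_sum
    by (auto intro!: arg_cong[of _ _ concat] map_cong simp: nth_concat_block)
  also have "\<dots> = concat (map2 permute_list \<tau>s xss)"
    by (auto intro!: arg_cong[of _ _ concat] nth_equalityI simp: len permute_list_def)
  finally show ?thesis .
qed

lemma list_all2_permutes_id:
  "list_all2 (\<lambda>n \<tau>. \<tau> permutes {..<f n}) ns (replicate (length ns) id)"
  by (simp add: list_all2_conv_all_nth permutes_id)

lemma block_sum_single_permutes:
  assumes "\<sigma> permutes {..<n}"
  shows "block_sum (ms @ n # ns) (replicate (length ms) id @ \<sigma> # replicate (length ns) id)
    permutes {..<sum_list (ms @ n # ns)}"
  using assms list_all2_permutes_id[of "\<lambda>n. n"]
  by (intro block_sum_permutes list_all2_appendI) simp_all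

text \<open>
  What happens to the inputs of a contracted vertex when those of one of the contracted roots are
  reordered.
\<close>

lemma permute_list_block_sum_single:
  assumes "\<sigma> permutes {..<length ys}"
  shows "permute_list (block_sum (map length xss @ length ys # map length zss)
      (replicate (length xss) id @ \<sigma> # replicate (length zss) id)) (concat xss @ ys @ concat zss) =
    concat xss @ permute_list \<sigma> ys @ concat zss"
proof -
  let ?\<tau>s = "replicate (length xss) id @ \<sigma> # replicate (length zss) id"
  have "list_all2 (\<lambda>xs \<tau>. \<tau> permutes {..<length xs}) (xss @ ys # zss) ?\<tau>s"
    using assms list_all2_permutes_id[of length] by (intro list_all2_appendI) simp_all
  moreover have "map2 permute_list (replicate (length yss) id) yss = yss" for yss :: "'a list list"
    by (auto intro: nth_equalityI)
  ultimately show ?thesis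
    using permute_list_block_sum[of "xss @ ys # zss" ?\<tau>s] by simp
qed

section \<open>Multilinear composition in a symmetric operad\<close>

context symmetric_operad
begin

lemma
  assumes "1 \<le> n"
  shows add_closed: "\<lbrakk>x \<in> op_carrier P n; y \<in> op_carrier P n\<rbrakk> \<Longrightarrow> x \<oplus>\<^bsub>op_space P n\<^esub> y \<in> op_carrier P n"
    and smult_closed: "x \<in> op_carrier P n \<Longrightarrow> c \<odot>\<^bsub>op_space P n\<^esub> x \<in> op_carrier P n"
    and zero_closed: "\<zero>\<^bsub>op_space P n\<^esub> \<in> op_carrier P n"
    and smult_one: "x \<in> op_carrier P n \<Longrightarrow> 1 \<odot>\<^bsub>op_space P n\<^esub> x = x"
    and smult_smult: "x \<in> op_carrier P n \<Longrightarrow>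
      c \<odot>\<^bsub>op_space P n\<^esub> (d \<odot>\<^bsub>op_space P n\<^esub> x) = (c * d) \<odot>\<^bsub>op_space P n\<^esub> x"
    and smult_distrib: "x \<in> op_carrier P n \<Longrightarrow>
      (c + d) \<odot>\<^bsub>op_space P n\<^esub> x = (c \<odot>\<^bsub>op_space P n\<^esub> x) \<oplus>\<^bsub>op_space P n\<^esub> (d \<odot>\<^bsub>op_space P n\<^esub> x)"
    and smult_0: "x \<in> op_carrier P n \<Longrightarrow> 0 \<odot>\<^bsub>op_space P n\<^esub> x = \<zero>\<^bsub>op_space P n\<^esub>"
    and add_0: "x \<in> op_carrier P n \<Longrightarrow> x \<oplus>\<^bsub>op_space P n\<^esub> \<zero>\<^bsub>op_space P n\<^esub> = x"
    and smult_zero: "c \<odot>\<^bsub>op_space P n\<^esub> \<zero>\<^bsub>op_space P n\<^esub> = \<zero>\<^bsub>op_space P n\<^esub>"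
proof -
  interpret M: Module.module "ring_of_type_algebra :: 'k ring" "op_space P n"
    using space[OF assms] .
  note ring = ring_of_type_algebra_def[where 'a = 'k]
  show "\<lbrakk>x \<in> op_carrier P n; y \<in> op_carrier P n\<rbrakk> \<Longrightarrow> x \<oplus>\<^bsub>op_space P n\<^esub> y \<in> op_carrier P n"
    and "x \<in> op_carrier P n \<Longrightarrow> c \<odot>\<^bsub>op_space P n\<^esub> x \<in> op_carrier P n"
    and "\<zero>\<^bsub>op_space P n\<^esub> \<in> op_carrier P n"
    and "x \<in> op_carrier P n \<Longrightarrow> 1 \<odot>\<^bsub>op_space P n\<^esub> x = x"
    and "x \<in> op_carrier P n \<Longrightarrow>
      c \<odot>\<^bsub>op_space P n\<^esub> (d \<odot>\<^bsub>op_space P n\<^esub> x) = (c * d) \<odot>\<^bsub>op_space P n\<^esub> x"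
    and "x \<in> op_carrier P n \<Longrightarrow>
      (c + d) \<odot>\<^bsub>op_space P n\<^esub> x = (c \<odot>\<^bsub>op_space P n\<^esub> x) \<oplus>\<^bsub>op_space P n\<^esub> (d \<odot>\<^bsub>op_space P n\<^esub> x)"
    and "x \<in> op_carrier P n \<Longrightarrow> 0 \<odot>\<^bsub>op_space P n\<^esub> x = \<zero>\<^bsub>op_space P n\<^esub>"
    and "x \<in> op_carrier P n \<Longrightarrow> x \<oplus>\<^bsub>op_space P n\<^esub> \<zero>\<^bsub>op_space P n\<^esub> = x"
    and "c \<odot>\<^bsub>op_space P n\<^esub> \<zero>\<^bsub>op_space P n\<^esub> = \<zero>\<^bsub>op_space P n\<^esub>"
    using M.smult_closed[of c x] M.smult_one[of x] M.smult_assoc1[of c d x] M.smult_l_distr[of c d x]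
      M.smult_l_null[of x] M.smult_r_null[of c] M.M.zero_closed
      M.M.add.m_closed[of x y] M.M.r_zero[of x]
    by (simp_all add: ring)
qed

text \<open>
  Associativity for arguments that depend on one common list. A vertex provides such a list, namely
  its inputs, and this form avoids positions.
\<close>

lemma comp_assoc_map:
  assumes "us \<noteq> []" "x \<in> op_carrier P (length us)"
    and "\<And>u. u \<in> set us \<Longrightarrow> y u \<in> op_carrier P (n u) \<and> length (p u) = n u \<and>
      arity_list (p u) \<and> op_args P (p u) (z u)"
  shows "op_comp P (concat (map p us)) (op_comp P (map n us) x (map y us)) (concat (map z us)) =
    op_comp P (map (\<lambda>u. sum_list (p u)) us) x (map (\<lambda>u. op_comp P (p u) (y u) (z u)) us)"
proof -
  have "map (\<lambda>i. op_comp P (map p us ! i) (map y us ! i) (map z us ! i)) [0..<length (map n us)] =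
      map (\<lambda>u. op_comp P (p u) (y u) (z u)) us"
    by (auto intro: nth_equalityI)
  moreover have "1 \<le> n u" if "u \<in> set us" for u
    using assms(3)[OF that] by (auto simp: arity_list_def simp flip: length_greater_0_conv)
  then have "arity_list (map n us)"
    using assms(1) by (auto simp: arity_list_def)
  ultimately show ?thesis
    using comp_assoc[of "map n us" x "map y us" "map p us" "map z us"] assms
    by (simp add: op_args_def list_all2_map1 list_all2_map2 list_all2_same comp_def)
qed

lemma comp_linear_left:
  assumes "arity_list ns" "x \<in> op_carrier P (length ns)" "y \<in> op_carrier P (length ns)" "op_args P ns zs"
  shows "op_comp P ns ((c \<odot>\<^bsub>op_space P (length ns)\<^esub> x) \<oplus>\<^bsub>op_space P (length ns)\<^esub>
        (d \<odot>\<^bsub>op_space P (length ns)\<^esub> y)) zs =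
    (c \<odot>\<^bsub>op_space P (sum_list ns)\<^esub> op_comp P ns x zs) \<oplus>\<^bsub>op_space P (sum_list ns)\<^esub>
      (d \<odot>\<^bsub>op_space P (sum_list ns)\<^esub> op_comp P ns y zs)"
proof -
  have "1 \<le> length ns"
    using assms(1) by (simp add: arity_list_def Suc_le_eq)
  then show ?thesis
    using assms by (simp add: comp_add_left comp_smult_left smult_closed)
qed

text \<open>
  The shape \<open>ys @ _ # ys'\<close> of the arguments is that of the inputs of a vertex in the rules of
  \<open>vertex_linear\<close>.
\<close>

lemma comp_linear_right:
  assumes ns: "arity_list (ns @ m # ns')" and "x \<in> op_carrier P (length (ns @ m # ns'))"
    and "op_args P ns ys" "op_args P ns' ys'" and y: "y \<in> op_carrier P m" "z \<in> op_carrier P m"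
  shows "op_comp P (ns @ m # ns') x
      (ys @ ((c \<odot>\<^bsub>op_space P m\<^esub> y) \<oplus>\<^bsub>op_space P m\<^esub> (d \<odot>\<^bsub>op_space P m\<^esub> z)) # ys') =
    (c \<odot>\<^bsub>op_space P (sum_list (ns @ m # ns'))\<^esub> op_comp P (ns @ m # ns') x (ys @ y # ys'))
      \<oplus>\<^bsub>op_space P (sum_list (ns @ m # ns'))\<^esub>
    (d \<odot>\<^bsub>op_space P (sum_list (ns @ m # ns'))\<^esub> op_comp P (ns @ m # ns') x (ys @ z # ys'))"
proof -
  let ?ns = "ns @ m # ns'"
  have len: "length ys = length ns"
    using assms(3) by (simp add: op_args_def list_all2_lengthD)
  have args: "op_args P ?ns (ys @ y # ys')"
    using assms by (auto simp: op_args_def intro: list_all2_appendI)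
  have upd: "(ys @ y # ys')[length ns := w] = ys @ w # ys'" for w
    by (simp add: len list_update_append flip: len)
  have m: "1 \<le> m"
    using ns by (simp add: arity_list_def)
  have add: "op_comp P ?ns x (ys @ (v \<oplus>\<^bsub>op_space P m\<^esub> w) # ys') =
      op_comp P ?ns x (ys @ v # ys') \<oplus>\<^bsub>op_space P (sum_list ?ns)\<^esub> op_comp P ?ns x (ys @ w # ys')"
    if "v \<in> op_carrier P m" "w \<in> op_carrier P m" for v w
    using comp_add_right[OF ns assms(2) args, of "length ns" v w] that by (simp add: upd nth_append)
  have smult: "op_comp P ?ns x (ys @ (e \<odot>\<^bsub>op_space P m\<^esub> v) # ys') =
      e \<odot>\<^bsub>op_space P (sum_list ?ns)\<^esub> op_comp P ?ns x (ys @ v # ys')"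
    if "v \<in> op_carrier P m" for v e
    using comp_smult_right[OF ns assms(2) args, of "length ns" v e] that by (simp add: upd nth_append)
  show ?thesis
    using y by (simp only: add smult smult_closed[OF m])
qed

lemma comp_act_right:
  assumes ns: "arity_list (ns @ m # ns')" and x: "x \<in> op_carrier P (length (ns @ m # ns'))"
    and ys: "op_args P ns ys" "op_args P ns' ys'" and y: "y \<in> op_carrier P m" and \<sigma>: "\<sigma> permutes {..<m}"
  shows "op_comp P (ns @ m # ns') x (ys @ op_act P m \<sigma> y # ys') =
    op_act P (sum_list (ns @ m # ns'))
      (block_sum (ns @ m # ns') (replicate (length ns) id @ \<sigma> # replicate (length ns') id))
      (op_comp P (ns @ m # ns') x (ys @ y # ys'))"
proof -
  let ?ns = "ns @ m # ns'" and ?\<tau>s = "replicate (length ns) id @ \<sigma> # replicate (length ns') id"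
  have len: "length ys = length ns" "length ys' = length ns'"
    using ys by (simp_all add: op_args_def list_all2_lengthD)
  have args: "op_args P ?ns (ys @ y # ys')"
    using ys y by (auto simp: op_args_def intro: list_all2_appendI)
  have \<tau>s: "list_all2 (\<lambda>n \<tau>. \<tau> permutes {..<n}) ?ns ?\<tau>s"
    using \<sigma> list_all2_permutes_id[of "\<lambda>n. n"] by (intro list_all2_appendI) simp_all
  have "map (\<lambda>i. op_act P (?ns ! i) (?\<tau>s ! i) ((ys @ y # ys') ! i)) [0..<length ?ns] =
      ys @ op_act P m \<sigma> y # ys'"
  proof (rule nth_equalityI)
    fix i assume "i < length (map (\<lambda>i. op_act P (?ns ! i) (?\<tau>s ! i) ((ys @ y # ys') ! i)) [0..<length ?ns])"
    then have i: "i < length ?ns" by simp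
    then have *: "1 \<le> ?ns ! i" "(ys @ y # ys') ! i \<in> op_carrier P (?ns ! i)"
      using ns args unfolding arity_list_def op_args_def by (metis nth_mem, metis list_all2_nthD)
    have "i < length ns \<or> i = length ns \<or> (\<exists>j < length ns'. i = Suc (length ns + j))"
      using i by (auto simp: less_Suc_eq_0_disj) presburger
    then show "map (\<lambda>i. op_act P (?ns ! i) (?\<tau>s ! i) ((ys @ y # ys') ! i)) [0..<length ?ns] ! i =
        (ys @ op_act P m \<sigma> y # ys') ! i"
      using i act_id[OF *] by (auto simp: nth_append len simp del: upt_Suc)
  qed (simp add: len)
  then show ?thesis
    using comp_equivariant_right[OF ns x args \<tau>s] by simp
qed

end

section \<open>Vertices of one colour and contraction\<close>

text \<open>
  Black and white vertices obey the same laws. The locale collects what is common to them, for a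
  constructor \<open>V\<close> of vertices labelled in \<open>P\<close>; here \<open>P\<close> is \<open>O1\<close> or \<open>O2\<close>, and \<open>vertex\<close> is \<open>V\<close> followed by
  the contraction of the edges to inputs with a \<open>V\<close>-root. The laws about relations split them by
  where they take place: at a \<open>V\<close>-root, below a \<open>V\<close>-root, or in trees whose root has the other
  colour, which contraction does not look into.
\<close>

locale vertex_colour = symmetric_operad P
  for P :: "('k::field, 'c) operad" +
  fixes O1 :: "('k, 'a) operad" and O2 :: "('k, 'b) operad"
    and V :: "'c \<Rightarrow> ('a, 'b) ltree list \<Rightarrow> ('a, 'b) ltree"
    and is_V :: "('a, 'b) ltree \<Rightarrow> bool"
    and label :: "('a, 'b) ltree \<Rightarrow> 'c"
    and inputs :: "('a, 'b) ltree \<Rightarrow> ('a, 'b) ltree list"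
    and vertex :: "'c \<Rightarrow> ('a, 'b) ltree list \<Rightarrow> ('a, 'b) ltree"
  assumes is_V_iff: "is_V t \<longleftrightarrow> (\<exists>a ts. t = V a ts)"
    and label_V [simp]: "label (V a ts) = a"
    and inputs_V [simp]: "inputs (V a ts) = ts"
    and label_other: "\<not> is_V t \<Longrightarrow> label t = op_id P"
    and inputs_other: "\<not> is_V t \<Longrightarrow> inputs t = [t]"
    and not_V_Leaf [simp]: "\<not> is_V (Leaf i)"
    and vertex_eq: "vertex a ts = V (op_comp P (map (length \<circ> inputs) ts) a (map label ts))
      (concat (map inputs ts))"
    and leaves_V [simp]: "leaves (V a ts) = concat (map leaves ts)"
    and alternating_V: "alternating O1 O2 (V a ts) \<longleftrightarrow>
      2 \<le> length ts \<and> a \<in> op_carrier P (length ts) \<and> (\<forall>t\<in>set ts. \<not> is_V t \<and> alternating O1 O2 t)"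
    and relabel_V: "relabel \<sigma> (V a ts) = V a (map (relabel \<sigma>) ts)"
    and is_V_relabel: "is_V (relabel \<sigma> t) \<longleftrightarrow> is_V t"
    and graft_V: "graft O1 O2 s (V a ts) = vertex a (map (graft O1 O2 s) ts)"
    and linear_V: "vertex_linear O1 O2 c d (V a ts) (V b ts)
      (V ((c \<odot>\<^bsub>op_space P (length ts)\<^esub> a) \<oplus>\<^bsub>op_space P (length ts)\<^esub> (d \<odot>\<^bsub>op_space P (length ts)\<^esub> b)) ts)"
    and linear_below: "vertex_linear O1 O2 c d t u v \<Longrightarrow>
      vertex_linear O1 O2 c d (V a (ls @ t # rs)) (V a (ls @ u # rs)) (V a (ls @ v # rs))"
    and linear_cases: "vertex_linear O1 O2 c d t u v \<Longrightarrow>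
      (\<exists>a b ts. t = V a ts \<and> u = V b ts \<and> v = V ((c \<odot>\<^bsub>op_space P (length ts)\<^esub> a)
        \<oplus>\<^bsub>op_space P (length ts)\<^esub> (d \<odot>\<^bsub>op_space P (length ts)\<^esub> b)) ts) \<or>
      (\<exists>a ls rs t' u' v'. vertex_linear O1 O2 c d t' u' v' \<and>
        t = V a (ls @ t' # rs) \<and> u = V a (ls @ u' # rs) \<and> v = V a (ls @ v' # rs)) \<or>
      \<not> is_V t \<and> \<not> is_V u \<and> \<not> is_V v"
    and reorder_V: "\<sigma> permutes {..<length ts} \<Longrightarrow>
      vertex_reorder O1 O2 (V (op_act P (length ts) \<sigma> a) ts) (V a (permute_list \<sigma> ts))"
    and reorder_below: "vertex_reorder O1 O2 t u \<Longrightarrow>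
      vertex_reorder O1 O2 (V a (ls @ t # rs)) (V a (ls @ u # rs))"
    and reorder_cases: "vertex_reorder O1 O2 t u \<Longrightarrow>
      (\<exists>a ts \<sigma>. \<sigma> permutes {..<length ts} \<and>
        t = V (op_act P (length ts) \<sigma> a) ts \<and> u = V a (permute_list \<sigma> ts)) \<or>
      (\<exists>a ls rs t' u'. vertex_reorder O1 O2 t' u' \<and>
        t = V a (ls @ t' # rs) \<and> u = V a (ls @ u' # rs)) \<or>
      \<not> is_V t \<and> \<not> is_V u"
begin

lemma is_V_V [simp]: "is_V (V a ts)"
  using is_V_iff by blast

lemma label_closed: "alternating O1 O2 t \<Longrightarrow> label t \<in> op_carrier P (length (inputs t))"
  using id_closed by (cases "is_V t") (auto simp: is_V_iff[of t] alternating_V label_other inputs_other)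

lemma length_inputs: "alternating O1 O2 t \<Longrightarrow> 1 \<le> length (inputs t)"
  by (cases "is_V t") (auto simp: is_V_iff[of t] alternating_V inputs_other)

lemma inputs_alternating:
  "\<lbrakk>alternating O1 O2 t; u \<in> set (inputs t)\<rbrakk> \<Longrightarrow> \<not> is_V u \<and> alternating O1 O2 u"
  by (cases "is_V t") (auto simp: is_V_iff[of t] alternating_V inputs_other)

lemma leaves_inputs: "concat (map leaves (inputs t)) = leaves t"
  by (cases "is_V t") (auto simp: is_V_iff[of t] inputs_other)

lemma leaves_vertex: "leaves (vertex a us) = concat (map leaves us)"
proof -
  have "concat (map leaves (concat (map inputs us))) = concat (map leaves us)"
    by (induction us) (simp_all add: leaves_inputs)
  then show ?thesis by (simp add: vertex_eq)
qed

lemma length_concat_inputs: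
  "length (concat (map inputs us)) = sum_list (map (length \<circ> inputs) us)"
  by (simp add: length_concat)

lemma arity_list_inputs:
  assumes "us \<noteq> []" "\<And>u. u \<in> set us \<Longrightarrow> alternating O1 O2 u"
  shows "arity_list (map (length \<circ> inputs) us)"
  using assms length_inputs by (auto simp: arity_list_def)

lemma op_args_labels:
  assumes "\<And>u. u \<in> set us \<Longrightarrow> alternating O1 O2 u"
  shows "op_args P (map (length \<circ> inputs) us) (map label us)"
  using assms label_closed by (simp add: op_args_def list_all2_map1 list_all2_map2 list_all2_same)

lemma alternating_vertex:
  assumes "2 \<le> length us" "a \<in> op_carrier P (length us)"
    and us: "\<And>u. u \<in> set us \<Longrightarrow> alternating O1 O2 u"
  shows "alternating O1 O2 (vertex a us)"
proof -
  have "length us \<le> sum_list (map (length \<circ> inputs) us)"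
    using us length_inputs by (induction us) force+
  then have "2 \<le> length (concat (map inputs us))"
    using assms(1) by (simp add: length_concat_inputs)
  moreover have "op_comp P (map (length \<circ> inputs) us) a (map label us) \<in>
      op_carrier P (length (concat (map inputs us)))"
    unfolding length_concat_inputs using assms by (intro comp_closed arity_list_inputs op_args_labels) auto
  ultimately show ?thesis
    using us inputs_alternating by (auto simp: vertex_eq alternating_V)
qed

lemma vertex_relabel: "relabel \<sigma> (vertex a us) = vertex a (map (relabel \<sigma>) us)"
proof -
  have "label (relabel \<sigma> u) = label u \<and> inputs (relabel \<sigma> u) = map (relabel \<sigma>) (inputs u)" for u
    using is_V_iff[of u] is_V_relabel[of \<sigma> u]
    by (cases "is_V u") (auto simp: relabel_V label_other inputs_other)
  then show ?thesis
    by (simp add: vertex_eq relabel_V map_concat comp_def)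
qed

text \<open>
  If there is nothing to contract, then identities are composed into the label.
\<close>

lemma vertex_uncontracted:
  assumes "us \<noteq> []" "a \<in> op_carrier P (length us)" "\<And>u. u \<in> set us \<Longrightarrow> \<not> is_V u"
  shows "vertex a us = V a us"
proof -
  have "map (length \<circ> inputs) us = replicate (length us) 1"
    and "map label us = replicate (length us) (op_id P)"
    using assms(3) by (auto simp: map_replicate_const[symmetric] label_other inputs_other)
  moreover have "concat (map inputs us) = us"
    using assms(3) by (induction us) (simp_all add: inputs_other)
  moreover have "1 \<le> length us"
    using assms(1) by (simp add: Suc_le_eq)
  ultimately show ?thesis
    using assms(2) comp_id_right[of "length us" a] by (simp add: vertex_eq)
qed

text \<open>
  Contraction and grafting commute by associativity of the composition of labels; a root of the
  other colour enters this with the identity as label.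
\<close>

lemma graft_vertex:
  assumes "us \<noteq> []" "a \<in> op_carrier P (length us)"
    and us: "\<And>u. u \<in> set us \<Longrightarrow> alternating O1 O2 u"
    and gr: "\<And>u v. \<lbrakk>u \<in> set us; v \<in> {u} \<union> set (inputs u)\<rbrakk> \<Longrightarrow> alternating O1 O2 (graft O1 O2 s v)"
  shows "graft O1 O2 s (vertex a us) = vertex a (map (graft O1 O2 s) us)"
proof -
  let ?g = "graft O1 O2 s"
  have concat_map_concat: "concat (concat (map f vs)) = concat (map (\<lambda>u. concat (f u)) vs)"
    for f :: "('a, 'b) ltree \<Rightarrow> ('a, 'b) ltree list list" and vs
    by (induction vs) simp_all
  let ?n = "length \<circ> inputs" and ?p = "\<lambda>u. map (length \<circ> inputs) (map ?g (inputs u))"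
    and ?z = "\<lambda>u. map label (map ?g (inputs u))"
  have contract: "sum_list (?p u) = length (inputs (?g u)) \<and>
      op_comp P (?p u) (label u) (?z u) = label (?g u) \<and>
      concat (map inputs (map ?g (inputs u))) = inputs (?g u)" if u: "u \<in> set us" for u
  proof (cases "is_V u")
    case True
    then obtain b ts where "u = V b ts"
      using is_V_iff by blast
    then show ?thesis
      by (simp add: graft_V vertex_eq length_concat comp_def)
  next
    case False
    have "alternating O1 O2 (?g u)"
      using gr[OF u] by simp
    then show ?thesis
      using False comp_id_left[OF length_inputs label_closed, of "?g u"]
      by (simp add: label_other inputs_other)
  qed
  have "?g (vertex a us) =
      V (op_comp P (concat (map ?p us)) (op_comp P (map ?n us) a (map label us)) (concat (map ?z us)))
        (concat (map (\<lambda>u. concat (map inputs (map ?g (inputs u)))) us))"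
    by (simp add: vertex_eq graft_V map_concat comp_def concat_map_concat)
  also have "op_comp P (concat (map ?p us)) (op_comp P (map ?n us) a (map label us)) (concat (map ?z us)) =
      op_comp P (map (\<lambda>u. sum_list (?p u)) us) a (map (\<lambda>u. op_comp P (?p u) (label u) (?z u)) us)"
  proof (rule comp_assoc_map)
    fix u assume u: "u \<in> set us"
    have *: "alternating O1 O2 w" if "w \<in> set (map ?g (inputs u))" for w
      using that gr[OF u] by auto
    have "map ?g (inputs u) \<noteq> []"
      using length_inputs[OF us[OF u]] by auto
    from arity_list_inputs[OF this *] op_args_labels[of "map ?g (inputs u)", OF *]
    show "label u \<in> op_carrier P (?n u) \<and> length (?p u) = ?n u \<and>
        arity_list (?p u) \<and> op_args P (?p u) (?z u)"
      using us[OF u] by (simp add: label_closed)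
  qed fact+
  also have "map (\<lambda>u. sum_list (?p u)) us = map ?n (map ?g us)"
    unfolding map_map[of ?n ?g us] by (intro map_cong refl) (simp only: contract comp_apply)
  also have "map (\<lambda>u. op_comp P (?p u) (label u) (?z u)) us = map label (map ?g us)"
    unfolding map_map[of label ?g us] by (intro map_cong refl) (simp only: contract comp_apply)
  also have "map (\<lambda>u. concat (map inputs (map ?g (inputs u)))) us = map inputs (map ?g us)"
    unfolding map_map[of inputs ?g us] by (intro map_cong refl) (simp only: contract comp_apply)
  finally show ?thesis
    by (simp only: vertex_eq)
qed

lemma linear_vertex_label:
  assumes "us \<noteq> []" "a \<in> op_carrier P (length us)" "b \<in> op_carrier P (length us)"
    and "\<And>u. u \<in> set us \<Longrightarrow> alternating O1 O2 u"
  shows "vertex_linear O1 O2 c d (vertex a us) (vertex b us)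
    (vertex ((c \<odot>\<^bsub>op_space P (length us)\<^esub> a) \<oplus>\<^bsub>op_space P (length us)\<^esub>
      (d \<odot>\<^bsub>op_space P (length us)\<^esub> b)) us)"
  using linear_V[of c d _ "concat (map inputs us)"] assms
    comp_linear_left[OF arity_list_inputs, of us a b "map label us"]
  by (simp add: vertex_eq op_args_labels length_concat_inputs)

text \<open>
  A linear relation in an input becomes one in the contracted tree. If the relation is at a root that
  gets contracted, its label moves into an argument of the composed label, and composition is
  linear there; otherwise the relation stays below the new root.
\<close>

lemma linear_vertex_input:
  assumes lin: "vertex_linear O1 O2 c d t u v"
    and a: "a \<in> op_carrier P (length (ls @ t # rs))"
    and alt: "\<And>w. w \<in> {t, u, v} \<union> set ls \<union> set rs \<Longrightarrow> alternating O1 O2 w"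
  shows "vertex_linear O1 O2 c d (vertex a (ls @ t # rs)) (vertex a (ls @ u # rs)) (vertex a (ls @ v # rs))"
  using linear_cases[OF lin]
proof (elim disjE exE conjE)
  fix x y ts
  assume t: "t = V x ts" and u: "u = V y ts"
    and v: "v = V ((c \<odot>\<^bsub>op_space P (length ts)\<^esub> x) \<oplus>\<^bsub>op_space P (length ts)\<^esub>
      (d \<odot>\<^bsub>op_space P (length ts)\<^esub> y)) ts"
  let ?n = "map (length \<circ> inputs)"
  have "arity_list (?n (ls @ t # rs))"
    using alt by (intro arity_list_inputs) auto
  then have arity: "arity_list (?n ls @ length ts # ?n rs)"
    by (simp add: t)
  have args: "op_args P (?n ls) (map label ls)" "op_args P (?n rs) (map label rs)"
    using alt by (auto intro!: op_args_labels)
  have "x \<in> op_carrier P (length ts)" "y \<in> op_carrier P (length ts)"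
    using alt[of t] alt[of u] by (auto simp: t u alternating_V)
  moreover have "a \<in> op_carrier P (length (?n ls @ length ts # ?n rs))"
    using a by simp
  ultimately show ?thesis
    using comp_linear_right[OF arity _ args, of a x y c d]
      linear_V[of c d _ "concat (map inputs ls) @ ts @ concat (map inputs rs)"]
    by (simp add: vertex_eq t u v length_concat_inputs)
next
  fix b ls' rs' t' u' v'
  assume "vertex_linear O1 O2 c d t' u' v'" "t = V b (ls' @ t' # rs')"
    "u = V b (ls' @ u' # rs')" "v = V b (ls' @ v' # rs')"
  then show ?thesis
    using linear_below[of c d t' u' v' _ "concat (map inputs ls) @ ls'" "rs' @ concat (map inputs rs)"]
    by (simp add: vertex_eq)
next
  assume "\<not> is_V t" "\<not> is_V u" "\<not> is_V v"
  then show ?thesis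
    using linear_below[OF lin, of _ "concat (map inputs ls)" "concat (map inputs rs)"]
    by (simp add: vertex_eq label_other inputs_other)
qed

text \<open>
  Reordering the inputs of a vertex before contraction is reordering them after it, by blocks: this is
  equivariance of the composition of labels in its outer argument.
\<close>

lemma reorder_vertex_label:
  assumes "us \<noteq> []" "a \<in> op_carrier P (length us)" "\<sigma> permutes {..<length us}"
    and "\<And>u. u \<in> set us \<Longrightarrow> alternating O1 O2 u"
  shows "vertex_reorder O1 O2 (vertex (op_act P (length us) \<sigma> a) us) (vertex a (permute_list \<sigma> us))"
proof -
  let ?n = "map (length \<circ> inputs) us"
  have n: "?n = map length (map inputs us)"
    by simp
  note len = length_concat_inputs[of us]
  have perm: "block_perm \<sigma> ?n permutes {..<length (concat (map inputs us))}"
    unfolding len using assms(3) by (intro block_perm_permutes) simp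
  have "op_comp P ?n (op_act P (length us) \<sigma> a) (map label us) =
      op_act P (sum_list ?n) (block_perm \<sigma> ?n)
        (op_comp P (permute_list \<sigma> ?n) a (permute_list \<sigma> (map label us)))"
    using comp_equivariant_left[of ?n a "map label us" \<sigma>] assms
    by (simp add: arity_list_inputs op_args_labels)
  moreover have "permute_list (block_perm \<sigma> ?n) (concat (map inputs us)) =
      concat (map inputs (permute_list \<sigma> us))"
    using permute_list_block_perm[of \<sigma> "map inputs us"] assms(3) unfolding n
    by (simp add: permute_list_map)
  ultimately show ?thesis
    using reorder_V[OF perm, of "op_comp P (permute_list \<sigma> ?n) a (permute_list \<sigma> (map label us))"] assms(3)
    by (simp add: vertex_eq len permute_list_map)
qed

text \<open>
  As for linear relations; at a contracted root, equivariance in an inner argument takes the place of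
  linearity.
\<close>

lemma reorder_vertex_input:
  assumes re: "vertex_reorder O1 O2 t u"
    and a: "a \<in> op_carrier P (length (ls @ t # rs))"
    and alt: "\<And>w. w \<in> {t, u} \<union> set ls \<union> set rs \<Longrightarrow> alternating O1 O2 w"
  shows "vertex_reorder O1 O2 (vertex a (ls @ t # rs)) (vertex a (ls @ u # rs))"
  using reorder_cases[OF re]
proof (elim disjE exE conjE)
  fix x ts \<sigma>
  assume \<sigma>: "\<sigma> permutes {..<length ts}"
    and t: "t = V (op_act P (length ts) \<sigma> x) ts" and u: "u = V x (permute_list \<sigma> ts)"
  let ?n = "map (length \<circ> inputs)"
  let ?ns = "?n ls @ length ts # ?n rs"
  let ?us = "concat (map inputs ls) @ ts @ concat (map inputs rs)"
  let ?\<rho> = "block_sum ?ns (replicate (length (?n ls)) id @ \<sigma> # replicate (length (?n rs)) id)"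
  have "arity_list (?n (ls @ t # rs))"
    using alt by (intro arity_list_inputs) auto
  then have arity: "arity_list ?ns"
    by (simp add: t)
  have args: "op_args P (?n ls) (map label ls)" "op_args P (?n rs) (map label rs)"
    using alt by (auto intro!: op_args_labels)
  have x: "x \<in> op_carrier P (length ts)"
    using alt[of u] by (auto simp: u alternating_V)
  have inputs: "permute_list ?\<rho> ?us = concat (map inputs ls) @ permute_list \<sigma> ts @ concat (map inputs rs)"
    using permute_list_block_sum_single[OF \<sigma>, of "map inputs ls" "map inputs rs"] by simp
  have perm: "?\<rho> permutes {..<length ?us}"
    using block_sum_single_permutes[OF \<sigma>, of "?n ls" "?n rs"] by (simp add: length_concat_inputs)
  have "a \<in> op_carrier P (length ?ns)"
    using a by simp
  from comp_act_right[OF arity this args x \<sigma>]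
  show ?thesis
    using reorder_V[OF perm, of "op_comp P ?ns a (map label ls @ x # map label rs)"] inputs
    by (simp add: vertex_eq t u length_concat_inputs)
next
  fix b ls' rs' t' u'
  assume "vertex_reorder O1 O2 t' u'" "t = V b (ls' @ t' # rs')" "u = V b (ls' @ u' # rs')"
  then show ?thesis
    using reorder_below[of t' u' _ "concat (map inputs ls) @ ls'" "rs' @ concat (map inputs rs)"]
    by (simp add: vertex_eq)
next
  assume "\<not> is_V t" "\<not> is_V u"
  then show ?thesis
    using reorder_below[OF re, of _ "concat (map inputs ls)" "concat (map inputs rs)"]
    by (simp add: vertex_eq label_other inputs_other)
qed

end

locale operad_pair = O1: symmetric_operad O1 + O2: symmetric_operad O2
  for O1 :: "('k::field, 'a) operad" and O2 :: "('k, 'b) operad"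

sublocale operad_pair \<subseteq>
  black: vertex_colour O1 O1 O2 Black is_Black "black_label O1" black_inputs "black_vertex O1"
proof unfold_locales
  fix t u v :: "('a, 'b) ltree" and c d
  show "is_Black t \<longleftrightarrow> (\<exists>a ts. t = Black a ts)"
    by (cases t) auto
  show "\<not> is_Black t \<Longrightarrow> black_label O1 t = op_id O1"
    by (cases t) auto
  show "\<not> is_Black t \<Longrightarrow> black_inputs t = [t]"
    by (cases t) auto
  show "is_Black (relabel \<sigma> t) \<longleftrightarrow> is_Black t" for \<sigma>
    by (cases t) auto
  show "(\<exists>a b ts. t = Black a ts \<and> u = Black b ts \<and> v = Black ((c \<odot>\<^bsub>op_space O1 (length ts)\<^esub> a)
        \<oplus>\<^bsub>op_space O1 (length ts)\<^esub> (d \<odot>\<^bsub>op_space O1 (length ts)\<^esub> b)) ts) \<or>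
      (\<exists>a ls rs t' u' v'. vertex_linear O1 O2 c d t' u' v' \<and>
        t = Black a (ls @ t' # rs) \<and> u = Black a (ls @ u' # rs) \<and> v = Black a (ls @ v' # rs)) \<or>
      \<not> is_Black t \<and> \<not> is_Black u \<and> \<not> is_Black v" if "vertex_linear O1 O2 c d t u v"
    using that by (cases rule: vertex_linear.cases) (simp; fail | blast)+
  show "(\<exists>a ts \<sigma>. \<sigma> permutes {..<length ts} \<and>
        t = Black (op_act O1 (length ts) \<sigma> a) ts \<and> u = Black a (permute_list \<sigma> ts)) \<or>
      (\<exists>a ls rs t' u'. vertex_reorder O1 O2 t' u' \<and>
        t = Black a (ls @ t' # rs) \<and> u = Black a (ls @ u' # rs)) \<or>
      \<not> is_Black t \<and> \<not> is_Black u" if "vertex_reorder O1 O2 t u"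
    using that by (cases rule: vertex_reorder.cases) (simp; fail | blast)+
qed (auto simp: black_vertex_def intro: vertex_linear.intros vertex_reorder.intros)

sublocale operad_pair \<subseteq>
  white: vertex_colour O2 O1 O2 White is_White "white_label O2" white_inputs "white_vertex O2"
proof unfold_locales
  fix t u v :: "('a, 'b) ltree" and c d
  show "is_White t \<longleftrightarrow> (\<exists>a ts. t = White a ts)"
    by (cases t) auto
  show "\<not> is_White t \<Longrightarrow> white_label O2 t = op_id O2"
    by (cases t) auto
  show "\<not> is_White t \<Longrightarrow> white_inputs t = [t]"
    by (cases t) auto
  show "is_White (relabel \<sigma> t) \<longleftrightarrow> is_White t" for \<sigma>
    by (cases t) auto
  show "(\<exists>a b ts. t = White a ts \<and> u = White b ts \<and> v = White ((c \<odot>\<^bsub>op_space O2 (length ts)\<^esub> a)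
        \<oplus>\<^bsub>op_space O2 (length ts)\<^esub> (d \<odot>\<^bsub>op_space O2 (length ts)\<^esub> b)) ts) \<or>
      (\<exists>a ls rs t' u' v'. vertex_linear O1 O2 c d t' u' v' \<and>
        t = White a (ls @ t' # rs) \<and> u = White a (ls @ u' # rs) \<and> v = White a (ls @ v' # rs)) \<or>
      \<not> is_White t \<and> \<not> is_White u \<and> \<not> is_White v" if "vertex_linear O1 O2 c d t u v"
    using that by (cases rule: vertex_linear.cases) (simp; fail | blast)+
  show "(\<exists>a ts \<sigma>. \<sigma> permutes {..<length ts} \<and>
        t = White (op_act O2 (length ts) \<sigma> a) ts \<and> u = White a (permute_list \<sigma> ts)) \<or>
      (\<exists>a ls rs t' u'. vertex_reorder O1 O2 t' u' \<and>
        t = White a (ls @ t' # rs) \<and> u = White a (ls @ u' # rs)) \<or>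
      \<not> is_White t \<and> \<not> is_White u" if "vertex_reorder O1 O2 t u"
    using that by (cases rule: vertex_reorder.cases) (simp; fail | blast)+
qed (auto simp: white_vertex_def intro: vertex_linear.intros vertex_reorder.intros)

section \<open>Grafting\<close>

context operad_pair
begin

lemma alternating_graft:
  "\<lbrakk>alternating O1 O2 t; \<forall>i\<in>set (leaves t). alternating O1 O2 (s i)\<rbrakk> \<Longrightarrow>
    alternating O1 O2 (graft O1 O2 s t)"
proof (induction t)
  case (Black a ts)
  then show ?case by (auto intro!: black.alternating_vertex)
next
  case (White b ts)
  then show ?case by (auto intro!: white.alternating_vertex)
qed simp

lemma leaves_graft: "leaves (graft O1 O2 s t) = concat (map (\<lambda>i. leaves (s i)) (leaves t))"
proof -
  have "concat (map (\<lambda>u. concat (map g (leaves u))) us) = concat (map g (concat (map leaves us)))"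
    for us :: "('a, 'b) ltree list" and g :: "nat \<Rightarrow> nat list"
    by (induction us) simp_all
  then show ?thesis
    by (induction t)
      (simp_all add: black.leaves_vertex white.leaves_vertex comp_def cong: map_cong)
qed

lemma graft_cong:
  "(\<And>i. i \<in> set (leaves t) \<Longrightarrow> s i = s' i) \<Longrightarrow> graft O1 O2 s t = graft O1 O2 s' t"
proof (induction t)
  case (Black a ts)
  then have "map (graft O1 O2 s) ts = map (graft O1 O2 s') ts" by auto
  then show ?case by (simp only: graft.simps)
next
  case (White b ts)
  then have "map (graft O1 O2 s) ts = map (graft O1 O2 s') ts" by auto
  then show ?case by (simp only: graft.simps)
qed simp

lemma graft_Leaf: "alternating O1 O2 t \<Longrightarrow> graft O1 O2 Leaf t = t"
proof (induction t)
  case (Black a ts)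
  then have "map (graft O1 O2 Leaf) ts = ts" by (intro map_idI) auto
  with Black.prems show ?case by (auto intro!: black.vertex_uncontracted)
next
  case (White b ts)
  then have "map (graft O1 O2 Leaf) ts = ts" by (intro map_idI) auto
  with White.prems show ?case by (auto intro!: white.vertex_uncontracted)
qed simp

lemma relabel_graft: "relabel \<sigma> (graft O1 O2 s t) = graft O1 O2 (\<lambda>i. relabel \<sigma> (s i)) t"
  by (induction t) (simp_all add: black.vertex_relabel white.vertex_relabel comp_def cong: map_cong)

lemma graft_relabel: "graft O1 O2 s (relabel \<sigma> t) = graft O1 O2 (\<lambda>i. s (\<sigma> i)) t"
  by (induction t) (simp_all add: comp_def cong: map_cong)

lemma alternating_relabel: "alternating O1 O2 (relabel \<sigma> t) \<longleftrightarrow> alternating O1 O2 t"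
  by (induction t) (auto simp: black.is_V_relabel white.is_V_relabel)

text \<open>
  Relabelling is grafting of leaves, so that whatever grafting preserves is preserved by relabelling.
\<close>

lemma relabel_as_graft: "alternating O1 O2 t \<Longrightarrow> relabel \<sigma> t = graft O1 O2 (\<lambda>i. Leaf (\<sigma> i)) t"
  using graft_Leaf[of "relabel \<sigma> t"] by (simp add: alternating_relabel graft_relabel)

text \<open>
  Associativity of the composition of trees holds for the trees themselves, not only modulo the
  relations.
\<close>

lemma graft_graft:
  "\<lbrakk>alternating O1 O2 t; \<forall>i\<in>set (leaves t). alternating O1 O2 (s i) \<and>
      (\<forall>j\<in>set (leaves (s i)). alternating O1 O2 (s' j))\<rbrakk> \<Longrightarrow>
    graft O1 O2 s' (graft O1 O2 s t) = graft O1 O2 (\<lambda>i. graft O1 O2 s' (s i)) t"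
proof (induction t)
  case (Black a ts)
  let ?us = "map (graft O1 O2 s) ts"
  have us: "alternating O1 O2 u" "\<forall>j\<in>set (leaves u). alternating O1 O2 (s' j)" if "u \<in> set ?us" for u
    using that Black.prems by (auto simp: leaves_graft intro!: alternating_graft)
  have "graft O1 O2 s' (black_vertex O1 a ?us) = black_vertex O1 a (map (graft O1 O2 s') ?us)"
  proof (rule black.graft_vertex)
    fix u v assume u: "u \<in> set ?us" and v: "v \<in> {u} \<union> set (black_inputs u)"
    moreover have "set (leaves v) \<subseteq> set (leaves u)"
      using v black.leaves_inputs[of u] by (auto simp flip: black.leaves_inputs[of u])
    ultimately show "alternating O1 O2 (graft O1 O2 s' v)"
      using us[OF u] black.inputs_alternating[of u v] by (intro alternating_graft) auto
  qed (use Black.prems us in auto)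
  also have "map (graft O1 O2 s') ?us = map (graft O1 O2 (\<lambda>i. graft O1 O2 s' (s i))) ts"
    using Black by auto
  finally show ?case by simp
next
  case (White b ts)
  let ?us = "map (graft O1 O2 s) ts"
  have us: "alternating O1 O2 u" "\<forall>j\<in>set (leaves u). alternating O1 O2 (s' j)" if "u \<in> set ?us" for u
    using that White.prems by (auto simp: leaves_graft intro!: alternating_graft)
  have "graft O1 O2 s' (white_vertex O2 b ?us) = white_vertex O2 b (map (graft O1 O2 s') ?us)"
  proof (rule white.graft_vertex)
    fix u v assume u: "u \<in> set ?us" and v: "v \<in> {u} \<union> set (white_inputs u)"
    moreover have "set (leaves v) \<subseteq> set (leaves u)"
      using v by (auto simp flip: white.leaves_inputs[of u])
    ultimately show "alternating O1 O2 (graft O1 O2 s' v)"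
      using us[OF u] white.inputs_alternating[of u v] by (intro alternating_graft) auto
  qed (use White.prems us in auto)
  also have "map (graft O1 O2 s') ?us = map (graft O1 O2 (\<lambda>i. graft O1 O2 s' (s i))) ts"
    using White by auto
  finally show ?case by simp
qed simp

text \<open>
  A relation in the outer tree survives grafting. It remains a single instance, with the same
  coefficients, since contraction treats all labels in the same way.
\<close>

lemma linear_graft:
  "\<lbrakk>vertex_linear O1 O2 c d t u v;
    \<forall>w\<in>{t, u, v}. alternating O1 O2 w \<and> (\<forall>i\<in>set (leaves w). alternating O1 O2 (s i))\<rbrakk> \<Longrightarrow>
    vertex_linear O1 O2 c d (graft O1 O2 s t) (graft O1 O2 s u) (graft O1 O2 s v)"
proof (induction rule: vertex_linear.induct)
  case (black V ts a b)
  then have "ts \<noteq> []" "\<And>w. w \<in> set (map (graft O1 O2 s) ts) \<Longrightarrow> alternating O1 O2 w"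
    by (auto intro: alternating_graft)
  with black show ?case
    using black.linear_vertex_label[of "map (graft O1 O2 s) ts" a b c d] by simp
next
  case (white V ts a b)
  then have "ts \<noteq> []" "\<And>w. w \<in> set (map (graft O1 O2 s) ts) \<Longrightarrow> alternating O1 O2 w"
    by (auto intro: alternating_graft)
  with white show ?case
    using white.linear_vertex_label[of "map (graft O1 O2 s) ts" a b c d] by simp
next
  case (below_black t u v e ls rs)
  have "alternating O1 O2 (graft O1 O2 s w)" if "w \<in> {t, u, v} \<union> set ls \<union> set rs" for w
    using that below_black.prems by (intro alternating_graft) auto
  with below_black show ?case
    using black.linear_vertex_input[of c d "graft O1 O2 s t" "graft O1 O2 s u" "graft O1 O2 s v" e
        "map (graft O1 O2 s) ls" "map (graft O1 O2 s) rs"] by auto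
next
  case (below_white t u v e ls rs)
  have "alternating O1 O2 (graft O1 O2 s w)" if "w \<in> {t, u, v} \<union> set ls \<union> set rs" for w
    using that below_white.prems by (intro alternating_graft) auto
  with below_white show ?case
    using white.linear_vertex_input[of c d "graft O1 O2 s t" "graft O1 O2 s u" "graft O1 O2 s v" e
        "map (graft O1 O2 s) ls" "map (graft O1 O2 s) rs"] by auto
qed

lemma reorder_graft:
  "\<lbrakk>vertex_reorder O1 O2 t u;
    \<forall>w\<in>{t, u}. alternating O1 O2 w \<and> (\<forall>i\<in>set (leaves w). alternating O1 O2 (s i))\<rbrakk> \<Longrightarrow>
    vertex_reorder O1 O2 (graft O1 O2 s t) (graft O1 O2 s u)"
proof (induction rule: vertex_reorder.induct)
  case (black \<sigma> ts a)
  then have "ts \<noteq> []" "\<And>w. w \<in> set (map (graft O1 O2 s) ts) \<Longrightarrow> alternating O1 O2 w"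
    by (auto intro: alternating_graft)
  with black show ?case
    using black.reorder_vertex_label[of "map (graft O1 O2 s) ts" a \<sigma>] by (simp add: permute_list_map)
next
  case (white \<sigma> ts b)
  then have "ts \<noteq> []" "\<And>w. w \<in> set (map (graft O1 O2 s) ts) \<Longrightarrow> alternating O1 O2 w"
    by (auto intro: alternating_graft)
  with white show ?case
    using white.reorder_vertex_label[of "map (graft O1 O2 s) ts" b \<sigma>] by (simp add: permute_list_map)
next
  case (below_black t u e ls rs)
  have "alternating O1 O2 (graft O1 O2 s w)" if "w \<in> {t, u} \<union> set ls \<union> set rs" for w
    using that below_black.prems by (intro alternating_graft) auto
  with below_black show ?case
    using black.reorder_vertex_input[of "graft O1 O2 s t" "graft O1 O2 s u" e
        "map (graft O1 O2 s) ls" "map (graft O1 O2 s) rs"] by auto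
next
  case (below_white t u e ls rs)
  have "alternating O1 O2 (graft O1 O2 s w)" if "w \<in> {t, u} \<union> set ls \<union> set rs" for w
    using that below_white.prems by (intro alternating_graft) auto
  with below_white show ?case
    using white.reorder_vertex_input[of "graft O1 O2 s t" "graft O1 O2 s u" e
        "map (graft O1 O2 s) ls" "map (graft O1 O2 s) rs"] by auto
qed

lemma split_inputs_at_leaf:
  assumes "distinct (concat (map leaves ts))" "i \<in> set (concat (map leaves ts))"
  obtains ls t rs where "ts = ls @ t # rs" "i \<in> set (leaves t)" "distinct (leaves t)"
    "i \<notin> set (concat (map leaves ls))" "i \<notin> set (concat (map leaves rs))"
proof -
  obtain t where t: "t \<in> set ts" "i \<in> set (leaves t)"
    using assms(2) by auto
  then obtain ls rs where "ts = ls @ t # rs"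
    by (meson split_list)
  then show thesis
    using that[of ls t rs] t assms(1) by auto
qed

text \<open>
  A relation in a tree grafted at the leaf \<open>i\<close> is carried up from \<open>i\<close> to the root, one vertex at a time;
  \<open>i\<close> occurs only once, so that all other inputs passed on the way are unaffected. The relation is
  taken ternary to cover linearity, and binary relations by repeating an argument.
\<close>

lemma relation_graft_at:
  assumes below_black: "\<And>t u v e ls rs. \<lbrakk>R t u v; e \<in> op_carrier O1 (length (ls @ t # rs));
      \<forall>w\<in>{t, u, v} \<union> set ls \<union> set rs. alternating O1 O2 w\<rbrakk> \<Longrightarrow>
      R (black_vertex O1 e (ls @ t # rs)) (black_vertex O1 e (ls @ u # rs)) (black_vertex O1 e (ls @ v # rs))"
    and below_white: "\<And>t u v e ls rs. \<lbrakk>R t u v; e \<in> op_carrier O2 (length (ls @ t # rs));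
      \<forall>w\<in>{t, u, v} \<union> set ls \<union> set rs. alternating O1 O2 w\<rbrakk> \<Longrightarrow>
      R (white_vertex O2 e (ls @ t # rs)) (white_vertex O2 e (ls @ u # rs)) (white_vertex O2 e (ls @ v # rs))"
    and pqr: "R p q r" and alt_pqr: "\<forall>w\<in>{p, q, r}. alternating O1 O2 w"
  shows "\<lbrakk>alternating O1 O2 t; distinct (leaves t); i \<in> set (leaves t);
      \<forall>j\<in>set (leaves t) - {i}. alternating O1 O2 (s j)\<rbrakk> \<Longrightarrow>
    R (graft O1 O2 (s(i := p)) t) (graft O1 O2 (s(i := q)) t) (graft O1 O2 (s(i := r)) t)"
proof (induction t)
  case (Leaf j)
  then show ?case using pqr by simp
next
  case (Black a ts)
  have "distinct (concat (map leaves ts))" "i \<in> set (concat (map leaves ts))"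
    using Black.prems by simp_all
  then obtain ls t rs where ts: "ts = ls @ t # rs" and t: "i \<in> set (leaves t)" "distinct (leaves t)"
    and other: "i \<notin> set (concat (map leaves ls))" "i \<notin> set (concat (map leaves rs))"
    by (rule split_inputs_at_leaf)
  have fixed: "map (graft O1 O2 (s(i := w))) ls = map (graft O1 O2 s) ls"
    "map (graft O1 O2 (s(i := w))) rs = map (graft O1 O2 s) rs" for w
    using other by (auto intro!: graft_cong)
  have step: "R (graft O1 O2 (s(i := p)) t) (graft O1 O2 (s(i := q)) t) (graft O1 O2 (s(i := r)) t)"
    by (rule Black.IH) (use Black.prems t in \<open>auto simp: ts\<close>)
  have "alternating O1 O2 (graft O1 O2 (s(i := w)) t)" if "w \<in> {p, q, r}" for w
    using that alt_pqr Black.prems by (intro alternating_graft) (auto simp: ts)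
  moreover have "alternating O1 O2 (graft O1 O2 s w)" if "w \<in> set ls \<union> set rs" for w
    using that other Black.prems by (intro alternating_graft) (auto simp: ts)
  ultimately have alt: "\<forall>w\<in>{graft O1 O2 (s(i := p)) t, graft O1 O2 (s(i := q)) t, graft O1 O2 (s(i := r)) t}
      \<union> set (map (graft O1 O2 s) ls) \<union> set (map (graft O1 O2 s) rs). alternating O1 O2 w"
    by (auto simp del: fun_upd_apply)
  show ?case
    unfolding ts graft.simps map_append list.map fixed
    by (rule below_black[OF step _ alt]) (use Black.prems ts in auto)
next
  case (White b ts)
  have "distinct (concat (map leaves ts))" "i \<in> set (concat (map leaves ts))"
    using White.prems by simp_all
  then obtain ls t rs where ts: "ts = ls @ t # rs" and t: "i \<in> set (leaves t)" "distinct (leaves t)"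
    and other: "i \<notin> set (concat (map leaves ls))" "i \<notin> set (concat (map leaves rs))"
    by (rule split_inputs_at_leaf)
  have fixed: "map (graft O1 O2 (s(i := w))) ls = map (graft O1 O2 s) ls"
    "map (graft O1 O2 (s(i := w))) rs = map (graft O1 O2 s) rs" for w
    using other by (auto intro!: graft_cong)
  have step: "R (graft O1 O2 (s(i := p)) t) (graft O1 O2 (s(i := q)) t) (graft O1 O2 (s(i := r)) t)"
    by (rule White.IH) (use White.prems t in \<open>auto simp: ts\<close>)
  have "alternating O1 O2 (graft O1 O2 (s(i := w)) t)" if "w \<in> {p, q, r}" for w
    using that alt_pqr White.prems by (intro alternating_graft) (auto simp: ts)
  moreover have "alternating O1 O2 (graft O1 O2 s w)" if "w \<in> set ls \<union> set rs" for w
    using that other White.prems by (intro alternating_graft) (auto simp: ts)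
  ultimately have alt: "\<forall>w\<in>{graft O1 O2 (s(i := p)) t, graft O1 O2 (s(i := q)) t, graft O1 O2 (s(i := r)) t}
      \<union> set (map (graft O1 O2 s) ls) \<union> set (map (graft O1 O2 s) rs). alternating O1 O2 w"
    by (auto simp del: fun_upd_apply)
  show ?case
    unfolding ts graft.simps map_append list.map fixed
    by (rule below_white[OF step _ alt]) (use White.prems ts in auto)
qed

lemma linear_graft_at:
  assumes "vertex_linear O1 O2 c d p q r" "\<forall>w\<in>{p, q, r}. alternating O1 O2 w"
    and "alternating O1 O2 t" "distinct (leaves t)" "i \<in> set (leaves t)"
    and "\<forall>j\<in>set (leaves t) - {i}. alternating O1 O2 (s j)"
  shows "vertex_linear O1 O2 c d
    (graft O1 O2 (s(i := p)) t) (graft O1 O2 (s(i := q)) t) (graft O1 O2 (s(i := r)) t)"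
  by (rule relation_graft_at[where R = "vertex_linear O1 O2 c d", OF _ _ assms])
    (blast intro: black.linear_vertex_input white.linear_vertex_input)+

lemma reorder_graft_at:
  assumes "vertex_reorder O1 O2 p q" "\<forall>w\<in>{p, q}. alternating O1 O2 w"
    and "alternating O1 O2 t" "distinct (leaves t)" "i \<in> set (leaves t)"
    and "\<forall>j\<in>set (leaves t) - {i}. alternating O1 O2 (s j)"
  shows "vertex_reorder O1 O2 (graft O1 O2 (s(i := p)) t) (graft O1 O2 (s(i := q)) t)"
  by (rule relation_graft_at[where R = "\<lambda>t u v. vertex_reorder O1 O2 t u" and r = q, OF _ _ assms(1) _ assms(3-6)])
    (use assms(2) in \<open>auto intro: black.reorder_vertex_input white.reorder_vertex_input\<close>)

end

section \<open>Composition of numbered trees\<close>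

lemma relabel_relabel: "relabel \<sigma> (relabel \<tau> t) = relabel (\<lambda>i. \<sigma> (\<tau> i)) t"
  by (induction t) simp_all

lemma leaves_relabel: "leaves (relabel \<sigma> t) = map \<sigma> (leaves t)"
  by (induction t) (simp_all add: map_concat comp_def cong: map_cong)

lemma relabel_cong: "(\<And>i. i \<in> set (leaves t) \<Longrightarrow> \<sigma> i = \<tau> i) \<Longrightarrow> relabel \<sigma> t = relabel \<tau> t"
  by (induction t) auto

lemma relabel_ident: "(\<And>i. i \<in> set (leaves t) \<Longrightarrow> \<sigma> i = i) \<Longrightarrow> relabel \<sigma> t = t"
  by (induction t) (auto intro: map_idI)

text \<open>
  In this form the condition on leaves passes easily through \<open>concat\<close> and permutations.
\<close>

lemma alt_trees_iff_mset:
  "t \<in> alt_trees O1 O2 n \<longleftrightarrow> alternating O1 O2 t \<and> mset (leaves t) = mset [0..<n]"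
proof -
  have "distinct (leaves t) \<and> set (leaves t) = {..<n} \<longleftrightarrow> mset (leaves t) = mset [0..<n]"
    using set_eq_iff_mset_eq_distinct[of "leaves t" "[0..<n]"]
      mset_eq_imp_distinct_iff[of "leaves t" "[0..<n]"]
    by (auto simp: atLeast0LessThan dest: mset_eq_setD)
  then show ?thesis by (simp add: alt_trees_def)
qed

lemma
  assumes "t \<in> alt_trees O1 O2 n"
  shows alt_trees_alternating: "alternating O1 O2 t"
    and alt_trees_distinct: "distinct (leaves t)"
    and alt_trees_set_leaves: "set (leaves t) = {..<n}"
    and alt_trees_length_leaves: "length (leaves t) = n"
  using assms distinct_card[of "leaves t"] by (simp_all add: alt_trees_def)

abbreviation alt_forest ::
    "('k, 'a) operad \<Rightarrow> ('k, 'b) operad \<Rightarrow> nat list \<Rightarrow> ('a, 'b) ltree list \<Rightarrow> bool" where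
  "alt_forest O1 O2 ns ts \<equiv> list_all2 (\<lambda>n t. t \<in> alt_trees O1 O2 n) ns ts"

text \<open>
  Maps of trees that carry each instance of a relation to an instance of the same relation, and so
  induce linear maps between the spaces of classes.
\<close>

definition relation_map :: "('k::field, 'a) operad \<Rightarrow> ('k, 'b) operad \<Rightarrow> nat \<Rightarrow> nat \<Rightarrow>
    (('a, 'b) ltree \<Rightarrow> ('a, 'b) ltree) \<Rightarrow> bool" where
  "relation_map O1 O2 n m f \<longleftrightarrow>
    (\<forall>t\<in>alt_trees O1 O2 n. f t \<in> alt_trees O1 O2 m) \<and>
    (\<forall>c d t u v. vertex_linear O1 O2 c d t u v \<longrightarrow> {t, u, v} \<subseteq> alt_trees O1 O2 n \<longrightarrow>
      vertex_linear O1 O2 c d (f t) (f u) (f v)) \<and>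
    (\<forall>t u. vertex_reorder O1 O2 t u \<longrightarrow> {t, u} \<subseteq> alt_trees O1 O2 n \<longrightarrow>
      vertex_reorder O1 O2 (f t) (f u))"

context operad_pair
begin

lemma relabel_alt_trees:
  assumes "t \<in> alt_trees O1 O2 n" "\<sigma> permutes {..<n}"
  shows "relabel \<sigma> t \<in> alt_trees O1 O2 n"
proof -
  have "mset (map \<sigma> (leaves t)) = mset (map \<sigma> [0..<n])"
    using assms(1) by (simp add: alt_trees_iff_mset)
  also have "\<dots> = mset [0..<n]"
    using permutes_image_mset[OF assms(2)] by (simp add: atLeast0LessThan)
  finally show ?thesis
    using assms(1) by (simp add: alt_trees_iff_mset alternating_relabel leaves_relabel)
qed

lemma linear_relabel:
  assumes "vertex_linear O1 O2 c d t u v" "\<forall>w\<in>{t, u, v}. alternating O1 O2 w"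
  shows "vertex_linear O1 O2 c d (relabel \<sigma> t) (relabel \<sigma> u) (relabel \<sigma> v)"
  using assms linear_graft[OF assms(1), of "\<lambda>i. Leaf (\<sigma> i)"] by (simp add: relabel_as_graft)

lemma reorder_relabel:
  assumes "vertex_reorder O1 O2 t u" "\<forall>w\<in>{t, u}. alternating O1 O2 w"
  shows "vertex_reorder O1 O2 (relabel \<sigma> t) (relabel \<sigma> u)"
  using assms reorder_graft[OF assms(1), of "\<lambda>i. Leaf (\<sigma> i)"] by (simp add: relabel_as_graft)

lemma relation_map_relabel:
  assumes "\<sigma> permutes {..<n}"
  shows "relation_map O1 O2 n n (relabel \<sigma>)"
  using assms by (auto simp: relation_map_def relabel_alt_trees alt_trees_alternating
      intro!: linear_relabel reorder_relabel)

lemma slot_alternating: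
  assumes "alt_forest O1 O2 ns ts" "i < length ns"
  shows "alternating O1 O2 (relabel \<sigma> (ts ! i))"
  by (simp add: alternating_relabel alt_trees_alternating[OF list_all2_nthD[OF assms]])

lemma tree_comp_alt_trees:
  assumes t: "t \<in> alt_trees O1 O2 (length ns)" and ts: "alt_forest O1 O2 ns ts"
  shows "tree_comp O1 O2 ns t ts \<in> alt_trees O1 O2 (sum_list ns)"
proof -
  have "mset (concat (map (\<lambda>i. map (\<lambda>j. block_start ns i + j) (leaves (ts ! i))) (leaves t))) =
      mset (concat (map (\<lambda>i. map (\<lambda>j. block_start ns i + j) [0..<ns ! i]) [0..<length ns]))"
  proof (rule mset_concat_cong)
    fix i assume "i \<in> set (leaves t)"
    then have "i < length ns"
      using alt_trees_set_leaves[OF t] by auto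
    then show "mset (map (\<lambda>j. block_start ns i + j) (leaves (ts ! i))) =
        mset (map (\<lambda>j. block_start ns i + j) [0..<ns ! i])"
      using ts by (simp add: list_all2_conv_all_nth alt_trees_iff_mset)
  qed (use t in \<open>simp add: alt_trees_iff_mset\<close>)
  also have "\<dots> = mset [0..<sum_list ns]"
    using map_upt_blocks[of "\<lambda>j. j" ns] by simp
  finally show ?thesis
    using t ts slot_alternating alt_trees_set_leaves[OF t]
    by (auto simp: alt_trees_iff_mset tree_comp_def leaves_graft leaves_relabel intro!: alternating_graft)
qed

lemma relation_map_tree_comp_left:
  assumes ts: "alt_forest O1 O2 ns ts"
  shows "relation_map O1 O2 (length ns) (sum_list ns) (\<lambda>t. tree_comp O1 O2 ns t ts)"
  unfolding relation_map_def
proof (intro conjI allI impI ballI)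
  fix c d t u v
  assume "vertex_linear O1 O2 c d t u v" "{t, u, v} \<subseteq> alt_trees O1 O2 (length ns)"
  then show "vertex_linear O1 O2 c d (tree_comp O1 O2 ns t ts) (tree_comp O1 O2 ns u ts)
      (tree_comp O1 O2 ns v ts)"
    using slot_alternating[OF ts] unfolding tree_comp_def
    by (intro linear_graft) (auto simp: alt_trees_alternating alt_trees_set_leaves)
next
  fix t u
  assume "vertex_reorder O1 O2 t u" "{t, u} \<subseteq> alt_trees O1 O2 (length ns)"
  then show "vertex_reorder O1 O2 (tree_comp O1 O2 ns t ts) (tree_comp O1 O2 ns u ts)"
    using slot_alternating[OF ts] unfolding tree_comp_def
    by (intro reorder_graft) (auto simp: alt_trees_alternating alt_trees_set_leaves)
qed (use ts in \<open>simp add: tree_comp_alt_trees\<close>)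

lemma relation_map_tree_comp_right:
  assumes t: "t \<in> alt_trees O1 O2 (length (ms @ n # ns))"
    and ts: "alt_forest O1 O2 ms ts" "alt_forest O1 O2 ns us"
  shows "relation_map O1 O2 n (sum_list (ms @ n # ns))
    (\<lambda>p. tree_comp O1 O2 (ms @ n # ns) t (ts @ p # us))"
proof -
  let ?ns = "ms @ n # ns"
  let ?\<sigma> = "\<lambda>i j. block_start ?ns i + j"
  \<comment> \<open>the trees grafted at the other leaves; the entry at \<open>length ms\<close> is a dummy that gets overwritten\<close>
  define s where "s = (\<lambda>i. relabel (?\<sigma> i) ((ts @ Leaf 0 # us) ! i))"
  have len: "length ts = length ms"
    using ts by (simp add: list_all2_lengthD)
  have comp: "tree_comp O1 O2 ?ns t (ts @ p # us) =
      graft O1 O2 (s(length ms := relabel (?\<sigma> (length ms)) p)) t" for p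
    unfolding tree_comp_def s_def
    by (intro graft_cong) (auto simp: nth_append len)
  have s: "alternating O1 O2 (s i)" if "i < length ?ns" "i \<noteq> length ms" for i
  proof -
    have "i - length ms - 1 < length ns" if "length ms < i"
      using that \<open>i < length ?ns\<close> by simp
    then show ?thesis
      using that ts by (auto simp: s_def alternating_relabel nth_append nth_Cons' list_all2_conv_all_nth
          alt_trees_alternating)
  qed
  have closed: "tree_comp O1 O2 ?ns t (ts @ p # us) \<in> alt_trees O1 O2 (sum_list ?ns)"
    if "p \<in> alt_trees O1 O2 n" for p
    using t ts that by (intro tree_comp_alt_trees) (auto intro: list_all2_appendI)
  have t': "alternating O1 O2 t" "distinct (leaves t)" "length ms \<in> set (leaves t)"
    "\<forall>j\<in>set (leaves t) - {length ms}. alternating O1 O2 (s j)"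
    using t s by (auto simp: alt_trees_alternating alt_trees_distinct alt_trees_set_leaves)
  show ?thesis
    unfolding relation_map_def comp
  proof (intro conjI allI ballI impI)
    fix c d p q r
    assume "vertex_linear O1 O2 c d p q r" "{p, q, r} \<subseteq> alt_trees O1 O2 n"
    then show "vertex_linear O1 O2 c d
        (graft O1 O2 (s(length ms := relabel (?\<sigma> (length ms)) p)) t)
        (graft O1 O2 (s(length ms := relabel (?\<sigma> (length ms)) q)) t)
        (graft O1 O2 (s(length ms := relabel (?\<sigma> (length ms)) r)) t)"
      using t' by (intro linear_graft_at)
        (auto simp: alternating_relabel alt_trees_alternating intro!: linear_relabel)
  next
    fix p q
    assume "vertex_reorder O1 O2 p q" "{p, q} \<subseteq> alt_trees O1 O2 n"
    then show "vertex_reorder O1 O2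
        (graft O1 O2 (s(length ms := relabel (?\<sigma> (length ms)) p)) t)
        (graft O1 O2 (s(length ms := relabel (?\<sigma> (length ms)) q)) t)"
      using t' by (intro reorder_graft_at)
        (auto simp: alternating_relabel alt_trees_alternating intro!: reorder_relabel)
  qed (use closed comp in auto)
qed

lemma tree_comp_id_left:
  "tree_comp O1 O2 [n] (Leaf 0) [t] = t"
  by (simp add: tree_comp_def relabel_ident)

lemma tree_comp_id_right:
  assumes "t \<in> alt_trees O1 O2 n"
  shows "tree_comp O1 O2 (replicate n 1) t (replicate n (Leaf 0)) = t"
proof -
  have "block_start (replicate n 1) i = i" if "i < n" for i
    using that by (simp add: block_start_def sum_list_replicate)
  then have "tree_comp O1 O2 (replicate n 1) t (replicate n (Leaf 0)) = graft O1 O2 Leaf t"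
    unfolding tree_comp_def using alt_trees_set_leaves[OF assms] by (intro graft_cong) auto
  then show ?thesis
    using assms by (simp add: graft_Leaf alt_trees_alternating)
qed

lemma tree_comp_assoc:
  assumes t: "t \<in> alt_trees O1 O2 (length ns)" and ts: "alt_forest O1 O2 ns ts"
    and pss: "list_all2 (\<lambda>n ps. length ps = n) ns pss" and uss: "list_all2 (alt_forest O1 O2) pss uss"
  shows "tree_comp O1 O2 (concat pss) (tree_comp O1 O2 ns t ts) (concat uss) =
    tree_comp O1 O2 (map sum_list pss) t
      (map (\<lambda>i. tree_comp O1 O2 (pss ! i) (ts ! i) (uss ! i)) [0..<length ns])"
proof -
  define s' where "s' = (\<lambda>j. relabel (\<lambda>k. block_start (concat pss) j + k) (concat uss ! j))"
  have ns: "ns = map length pss"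
    using pss by (auto simp: list_all2_conv_all_nth intro: nth_equalityI)
  have len: "length uss = length pss" "map length uss = ns"
    using uss by (auto simp: ns list_all2_conv_all_nth intro!: nth_equalityI)
  have i: "i < length pss" if "i \<in> set (leaves t)" for i
    using that alt_trees_set_leaves[OF t] by (simp add: ns)
  have j: "j < length (pss ! i)" if "i < length pss" "j \<in> set (leaves (ts ! i))" for i j
  proof -
    have "ts ! i \<in> alt_trees O1 O2 (ns ! i)"
      using list_all2_nthD[OF ts, of i] that by (simp add: ns)
    then show ?thesis
      using that alt_trees_set_leaves[of "ts ! i" O1 O2 "ns ! i"] by (simp add: ns)
  qed
  have s': "s' (block_start ns i + j) =
      relabel (\<lambda>k. block_start (map sum_list pss) i + (block_start (pss ! i) j + k)) (uss ! i ! j)"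
    if "i < length pss" "j < length (pss ! i)" for i j
  proof -
    have "j < length (uss ! i)"
      using that uss by (simp add: list_all2_conv_all_nth)
    then show ?thesis
      using that block_start_concat[of i pss j] nth_concat_block[of i uss j] len
      by (simp add: s'_def ns) (rule relabel_cong, simp)
  qed
  have alt: "alternating O1 O2 (s' (block_start ns i + j))" if "i < length pss" "j < length (pss ! i)" for i j
  proof -
    have "uss ! i ! j \<in> alt_trees O1 O2 (pss ! i ! j)"
      using that uss by (simp add: list_all2_conv_all_nth)
    then show ?thesis
      by (simp add: s'[OF that] alternating_relabel alt_trees_alternating)
  qed
  have "tree_comp O1 O2 (concat pss) (tree_comp O1 O2 ns t ts) (concat uss) =
      graft O1 O2 s' (graft O1 O2 (\<lambda>i. relabel (\<lambda>j. block_start ns i + j) (ts ! i)) t)"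
    by (simp add: tree_comp_def s'_def)
  also have "\<dots> = graft O1 O2 (\<lambda>i. graft O1 O2 s' (relabel (\<lambda>j. block_start ns i + j) (ts ! i))) t"
    using t ts i j alt slot_alternating[OF ts]
    by (intro graft_graft) (auto simp: alt_trees_alternating leaves_relabel ns)
  also have "\<dots> = graft O1 O2 (\<lambda>i. relabel (\<lambda>k. block_start (map sum_list pss) i + k)
      (tree_comp O1 O2 (pss ! i) (ts ! i) (uss ! i))) t"
    using i j by (intro graft_cong)
      (auto simp: graft_relabel tree_comp_def relabel_graft relabel_relabel s' intro!: graft_cong)
  also have "\<dots> = tree_comp O1 O2 (map sum_list pss) t
      (map (\<lambda>i. tree_comp O1 O2 (pss ! i) (ts ! i) (uss ! i)) [0..<length ns])"
    using i unfolding tree_comp_def[of O1 O2 "map sum_list pss"] by (intro graft_cong) (auto simp: ns)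
  finally show ?thesis .
qed

text \<open>
  Equivariance of the composition of trees in the outer tree, again without passing to classes: only
  the numbers of the leaves matter, and both sides number them in the same way.
\<close>

lemma tree_comp_relabel_left:
  assumes t: "t \<in> alt_trees O1 O2 (length ns)" and ts: "alt_forest O1 O2 ns ts"
    and \<sigma>: "\<sigma> permutes {..<length ns}"
  shows "tree_comp O1 O2 ns (relabel \<sigma> t) ts =
    relabel (block_perm \<sigma> ns) (tree_comp O1 O2 (permute_list \<sigma> ns) t (permute_list \<sigma> ts))"
  unfolding tree_comp_def graft_relabel relabel_graft relabel_relabel
proof (rule graft_cong)
  fix i assume "i \<in> set (leaves t)"
  then have i: "i < length ns"
    using alt_trees_set_leaves[OF t] by auto
  then have \<sigma>i: "\<sigma> i < length ns"
    using permutes_in_image[OF \<sigma>] by simp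
  have len: "length ts = length ns"
    using ts by (simp add: list_all2_lengthD)
  have "j < ns ! \<sigma> i" if "j \<in> set (leaves (ts ! \<sigma> i))" for j
    using that list_all2_nthD[OF ts \<sigma>i] by (auto dest: alt_trees_set_leaves)
  then show "relabel (\<lambda>j. block_start ns (\<sigma> i) + j) (ts ! \<sigma> i) =
      relabel (\<lambda>j. block_perm \<sigma> ns (block_start (permute_list \<sigma> ns) i + j)) (permute_list \<sigma> ts ! i)"
    using i \<sigma> by (auto simp: permute_list_nth len block_perm_element intro!: relabel_cong)
qed

lemma tree_comp_relabel_right:
  assumes t: "t \<in> alt_trees O1 O2 (length ns)" and ts: "alt_forest O1 O2 ns ts"
    and \<tau>s: "list_all2 (\<lambda>n \<tau>. \<tau> permutes {..<n}) ns \<tau>s"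
  shows "tree_comp O1 O2 ns t (map (\<lambda>i. relabel (\<tau>s ! i) (ts ! i)) [0..<length ns]) =
    relabel (block_sum ns \<tau>s) (tree_comp O1 O2 ns t ts)"
  unfolding tree_comp_def relabel_graft relabel_relabel
proof (rule graft_cong)
  fix i assume "i \<in> set (leaves t)"
  then have i: "i < length ns"
    using alt_trees_set_leaves[OF t] by auto
  have "j < ns ! i" if "j \<in> set (leaves (ts ! i))" for j
    using that list_all2_nthD[OF ts i] by (auto dest: alt_trees_set_leaves)
  then show "relabel (\<lambda>j. block_start ns i + j) (map (\<lambda>i. relabel (\<tau>s ! i) (ts ! i)) [0..<length ns] ! i) =
      relabel (\<lambda>j. block_sum ns \<tau>s (block_start ns i + j)) (ts ! i)"
    using i by (auto simp: relabel_relabel block_sum_element intro!: relabel_cong)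
qed

end

section \<open>Linear extension and tensor products\<close>

text \<open>
  The linear extension of \<open>f\<close>. With \<open>single\<close> as unit, formal combinations form a commutative monad
  (\<open>lin_lin\<close>, \<open>lin_ident\<close>, \<open>lin_commute\<close>); computing in it replaces all expansions of multilinear
  maps by computations with single trees.
\<close>

definition lin :: "('t \<Rightarrow> 'u \<Rightarrow>\<^sub>0 'k) \<Rightarrow> ('t \<Rightarrow>\<^sub>0 'k::field) \<Rightarrow> 'u \<Rightarrow>\<^sub>0 'k" where
  "lin f x = (\<Sum>t\<in>Poly_Mapping.keys x. scale (Poly_Mapping.lookup x t) (f t))"

lemma scale_single: "scale c (Poly_Mapping.single t a) = Poly_Mapping.single t (c * a)"
  by (rule poly_mapping_eqI) (simp add: lookup_scale lookup_single when_def)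

lemma lin_superset:
  "\<lbrakk>finite A; Poly_Mapping.keys x \<subseteq> A\<rbrakk> \<Longrightarrow> lin f x = (\<Sum>t\<in>A. scale (Poly_Mapping.lookup x t) (f t))"
  unfolding lin_def by (rule sum.mono_neutral_left) (auto simp: in_keys_iff)

lemma lin_add: "lin f (x + y) = lin f x + lin f y"
proof -
  let ?A = "Poly_Mapping.keys x \<union> Poly_Mapping.keys y"
  have "finite ?A" "Poly_Mapping.keys (x + y) \<subseteq> ?A"
    by (simp_all add: Poly_Mapping.keys_add)
  then show ?thesis
    by (simp add: lin_superset[of ?A] lookup_add formal.scale_left_distrib sum.distrib)
qed

lemma lin_scale: "lin f (scale c x) = scale c (lin f x)"
proof -
  have "Poly_Mapping.keys (scale c x) \<subseteq> Poly_Mapping.keys x"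
    by (auto simp: in_keys_iff lookup_scale)
  then show ?thesis
    by (simp add: lin_superset[of "Poly_Mapping.keys x"] lookup_scale formal.scale_sum_right)
qed

lemma lin_0 [simp]: "lin f 0 = 0"
  by (simp add: lin_def)

lemma lin_diff: "lin f (x - y) = lin f x - lin f y"
  using lin_add[of f "x - y" y] by (simp add: eq_diff_eq)

lemma lin_single [simp]: "lin f (Poly_Mapping.single t c) = scale c (f t)"
  by (simp add: lin_superset[of "{t}"])

lemma lin_sum: "lin f (\<Sum>a\<in>A. g a) = (\<Sum>a\<in>A. lin f (g a))"
  by (induction A rule: infinite_finite_induct) (simp_all add: lin_add)

lemma lin_lin: "lin f (lin g x) = lin (\<lambda>t. lin f (g t)) x"
  by (simp add: lin_def[of g] lin_sum lin_scale) (simp add: lin_def[of "\<lambda>t. lin f (g t)"])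

lemma lin_cong: "(\<And>t. t \<in> Poly_Mapping.keys x \<Longrightarrow> f t = g t) \<Longrightarrow> lin f x = lin g x"
  by (simp add: lin_def)

lemma lin_ident: "lin (\<lambda>t. Poly_Mapping.single t 1) x = x"
proof (rule poly_mapping_eqI)
  fix u
  have "Poly_Mapping.lookup (lin (\<lambda>t. Poly_Mapping.single t 1) x) u =
      (\<Sum>t\<in>Poly_Mapping.keys x. if t = u then Poly_Mapping.lookup x t else 0)"
    unfolding lin_def lookup_sum
    by (intro sum.cong) (auto simp: lookup_scale lookup_single when_def)
  also have "\<dots> = Poly_Mapping.lookup x u"
    by (auto simp: in_keys_iff)
  finally show "Poly_Mapping.lookup (lin (\<lambda>t. Poly_Mapping.single t 1) x) u = Poly_Mapping.lookup x u" .
qed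

lemma lin_commute: "lin (\<lambda>t. lin (f t) y) x = lin (\<lambda>u. lin (\<lambda>t. f t u) x) y"
proof -
  have "lin (\<lambda>t. lin (f t) y) x = (\<Sum>t\<in>Poly_Mapping.keys x. \<Sum>u\<in>Poly_Mapping.keys y.
      scale (Poly_Mapping.lookup x t * Poly_Mapping.lookup y u) (f t u))"
    by (simp add: lin_def formal.scale_sum_right)
  also have "\<dots> = lin (\<lambda>u. lin (\<lambda>t. f t u) x) y"
    by (subst sum.swap) (simp add: lin_def formal.scale_sum_right mult.commute)
  finally show ?thesis .
qed

lemma lin_in_subspace:
  assumes "formal.subspace S" "\<And>t. t \<in> Poly_Mapping.keys x \<Longrightarrow> f t \<in> S"
  shows "lin f x \<in> S"
  unfolding lin_def using assms by (intro formal.subspace_sum formal.subspace_scale)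

lemma lin_in_span:
  assumes "x \<in> formal.span S" "formal.subspace T" "\<And>y. y \<in> S \<Longrightarrow> lin f y \<in> T"
  shows "lin f x \<in> T"
proof (rule formal.span_induct[OF assms(1)])
  show "formal.subspace {y. lin f y \<in> T}"
    using assms(2) by (auto simp: formal.subspace_def lin_add lin_scale)
qed (use assms(3) in auto)

text \<open>
  The tensor product of the vectors in a list, as a vector in the free vector space on lists. A
  multilinear map is \<open>lin\<close> applied to it.
\<close>

fun tensor :: "('t \<Rightarrow>\<^sub>0 'k::field) list \<Rightarrow> 't list \<Rightarrow>\<^sub>0 'k" where
  "tensor [] = Poly_Mapping.single [] 1"
| "tensor (y # ys) = lin (\<lambda>t. lin (\<lambda>ts. Poly_Mapping.single (t # ts) 1) (tensor ys)) y"

lemma lin_tensor_Cons: "lin g (tensor (y # ys)) = lin (\<lambda>t. lin (\<lambda>ts. g (t # ts)) (tensor ys)) y"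
  by (simp add: lin_lin)

declare tensor.simps(2) [simp del]

lemma lin_tensor_append:
  "lin g (tensor (xs @ ys)) = lin (\<lambda>ts. lin (\<lambda>us. g (ts @ us)) (tensor ys)) (tensor xs)"
  by (induction xs arbitrary: g) (simp_all add: lin_tensor_Cons)

lemma lin_tensor_concat:
  "lin g (tensor (concat yss)) = lin (\<lambda>tss. g (concat tss)) (tensor (map tensor yss))"
  by (induction yss arbitrary: g) (simp_all add: lin_tensor_Cons lin_tensor_append)

lemma in_listset_iff: "ts \<in> listset As \<longleftrightarrow> list_all2 (\<in>) ts As"
  by (induction As arbitrary: ts) (auto simp: set_Cons_def list_all2_Cons2)

text \<open>
  This is the sum in the definition of \<open>tree_comp_ext\<close>. In contrast to the recursion, it is visibly
  symmetric in the entries of the list, which gives \<open>lin_tensor_permute\<close>.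
\<close>

lemma lin_tensor:
  "lin g (tensor ys) = (\<Sum>ts\<in>listset (map Poly_Mapping.keys ys).
    scale (\<Prod>i<length ys. Poly_Mapping.lookup (ys ! i) (ts ! i)) (g ts))"
proof (induction ys arbitrary: g)
  case (Cons y ys)
  let ?T = "listset (map Poly_Mapping.keys ys)"
  have "listset (map Poly_Mapping.keys (y # ys)) =
      (\<lambda>p. fst p # snd p) ` (Poly_Mapping.keys y \<times> ?T)"
    by (force simp: set_Cons_def)
  moreover have "inj_on (\<lambda>p. fst p # snd p) (Poly_Mapping.keys y \<times> ?T)"
    by (auto simp: inj_on_def)
  ultimately have "(\<Sum>ts\<in>listset (map Poly_Mapping.keys (y # ys)).
      scale (\<Prod>i<length (y # ys). Poly_Mapping.lookup ((y # ys) ! i) (ts ! i)) (g ts)) =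
    (\<Sum>(t, ts)\<in>Poly_Mapping.keys y \<times> ?T. scale (Poly_Mapping.lookup y t)
      (scale (\<Prod>i<length ys. Poly_Mapping.lookup (ys ! i) (ts ! i)) (g (t # ts))))"
    by (simp add: sum.reindex case_prod_beta prod.lessThan_Suc_shift comp_def del: listset.simps prod.lessThan_Suc)
  also have "\<dots> = (\<Sum>t\<in>Poly_Mapping.keys y. \<Sum>ts\<in>?T. scale (Poly_Mapping.lookup y t)
      (scale (\<Prod>i<length ys. Poly_Mapping.lookup (ys ! i) (ts ! i)) (g (t # ts))))"
    by (simp add: sum.cartesian_product)
  also have "\<dots> = lin g (tensor (y # ys))"
    by (simp only: lin_tensor_Cons Cons.IH lin_def[of _ y] formal.scale_sum_right)
  finally show ?case by simp
qed simp

lemma lin_tensor_cong: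
  assumes "\<And>ts. list_all2 (\<lambda>t y. t \<in> Poly_Mapping.keys y) ts ys \<Longrightarrow> f ts = g ts"
  shows "lin f (tensor ys) = lin g (tensor ys)"
  unfolding lin_tensor using assms
  by (intro sum.cong) (auto simp: in_listset_iff list_all2_map2)

lemma lin_tensor_in_subspace:
  assumes "formal.subspace S" "\<And>ts. list_all2 (\<lambda>t y. t \<in> Poly_Mapping.keys y) ts ys \<Longrightarrow> f ts \<in> S"
  shows "lin f (tensor ys) \<in> S"
  unfolding lin_tensor using assms
  by (intro formal.subspace_sum formal.subspace_scale) (auto simp: in_listset_iff list_all2_map2)

lemma keys_tensor:
  assumes "ts \<in> Poly_Mapping.keys (tensor ys)"
  shows "list_all2 (\<lambda>t y. t \<in> Poly_Mapping.keys y) ts ys"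
proof (rule ccontr)
  assume no: "\<not> ?thesis"
  have "Poly_Mapping.lookup (lin (\<lambda>us. Poly_Mapping.single us 1) (tensor ys)) ts = 0"
    unfolding lin_tensor lookup_sum
    using no by (intro sum.neutral)
      (auto simp: lookup_scale lookup_single when_def in_listset_iff list_all2_map2)
  then show False
    using assms by (simp add: lin_ident in_keys_iff)
qed

lemma tensor_replicate_single:
  "tensor (replicate n (Poly_Mapping.single t 1)) = Poly_Mapping.single (replicate n t) 1"
  by (induction n) (simp_all add: tensor.simps(2))

lemma lin_tensor_permute:
  fixes ys :: "('t \<Rightarrow>\<^sub>0 'k::field) list"
  assumes \<sigma>: "\<sigma> permutes {..<length ys}"
  shows "lin g (tensor (permute_list \<sigma> ys)) = lin (\<lambda>ts. g (permute_list \<sigma> ts)) (tensor ys)"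
proof -
  let ?T = "\<lambda>ys. listset (map Poly_Mapping.keys ys)"
  have len: "length ts = length ys" if "ts \<in> ?T ys" for ts ys
    using that by (auto simp: in_listset_iff dest: list_all2_lengthD)
  have mem: "permute_list \<tau> ts \<in> ?T (permute_list \<tau> zs)"
    if "\<tau> permutes {..<length zs}" "ts \<in> ?T zs" for \<tau> ts zs
    using that len[OF that(2)] list_all2_permute_list_iff[where P = "(\<in>)" and p = \<tau> and xs = ts and ys = "map Poly_Mapping.keys zs"]
    by (simp add: in_listset_iff permute_list_map)
  have inv: "permute_list \<sigma> (permute_list (inv_into UNIV \<sigma>) ts) = ts \<and> permute_list (inv_into UNIV \<sigma>) (permute_list \<sigma> ts) = ts"
    if "length ts = length ys" for ts :: "'t list"
    using that \<sigma> permutes_inv[OF \<sigma>] permutes_inv_o[OF \<sigma>]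
    by (simp flip: permute_list_compose)
  have "bij_betw (permute_list \<sigma>) (?T ys) (?T (permute_list \<sigma> ys))"
  proof (rule bij_betw_byWitness[where f' = "permute_list (inv_into UNIV \<sigma>)"])
    show "permute_list \<sigma> ` ?T ys \<subseteq> ?T (permute_list \<sigma> ys)"
      using mem[OF \<sigma>] by auto
    show "permute_list (inv_into UNIV \<sigma>) ` ?T (permute_list \<sigma> ys) \<subseteq> ?T ys"
    proof
      fix us assume "us \<in> permute_list (inv_into UNIV \<sigma>) ` ?T (permute_list \<sigma> ys)"
      then show "us \<in> ?T ys"
        using mem[of "inv_into UNIV \<sigma>" "permute_list \<sigma> ys"] permutes_inv[OF \<sigma>] \<sigma> permutes_inv_o[OF \<sigma>]
        by (auto simp flip: permute_list_compose)
    qed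
    show "\<forall>ts\<in>?T ys. permute_list (inv_into UNIV \<sigma>) (permute_list \<sigma> ts) = ts"
      using inv[OF len] by blast
    show "\<forall>ts\<in>?T (permute_list \<sigma> ys). permute_list \<sigma> (permute_list (inv_into UNIV \<sigma>) ts) = ts"
      using inv len by (metis length_permute_list)
  qed
  then have "lin g (tensor (permute_list \<sigma> ys)) = (\<Sum>ts\<in>?T ys.
      scale (\<Prod>i<length ys. Poly_Mapping.lookup (permute_list \<sigma> ys ! i) (permute_list \<sigma> ts ! i))
        (g (permute_list \<sigma> ts)))"
    by (simp add: lin_tensor sum.reindex_bij_betw[symmetric, where h = "permute_list \<sigma>"])
  also have "\<dots> = lin (\<lambda>ts. g (permute_list \<sigma> ts)) (tensor ys)"
    unfolding lin_tensor
  proof (intro sum.cong arg_cong2[of _ _ _ _ scale] refl)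
    fix ts assume ts: "ts \<in> ?T ys"
    have "(\<Prod>i<length ys. Poly_Mapping.lookup (permute_list \<sigma> ys ! i) (permute_list \<sigma> ts ! i)) =
        (\<Prod>i<length ys. Poly_Mapping.lookup (ys ! \<sigma> i) (ts ! \<sigma> i))"
      using \<sigma> len[OF ts] by (intro prod.cong) (auto simp: permute_list_nth)
    also have "\<dots> = (\<Prod>i<length ys. Poly_Mapping.lookup (ys ! i) (ts ! i))"
      by (rule prod.reindex_bij_betw[OF permutes_imp_bij[OF \<sigma>]])
    finally show "(\<Prod>i<length ys. Poly_Mapping.lookup (permute_list \<sigma> ys ! i) (permute_list \<sigma> ts ! i)) =
        (\<Prod>i<length ys. Poly_Mapping.lookup (ys ! i) (ts ! i))" .
  qed
  finally show ?thesis .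
qed

lemma lin_tensor_map2:
  assumes "length fs = length ys"
  shows "lin g (tensor (map2 (\<lambda>f y. lin (\<lambda>t. Poly_Mapping.single (f t) 1) y) fs ys)) =
    lin (\<lambda>ts. g (map2 (\<lambda>f t. f t) fs ts)) (tensor ys)"
  using assms by (induction fs ys arbitrary: g rule: list_induct2) (simp_all add: lin_tensor_Cons lin_lin)

text \<open>
  The inner compositions on the right-hand side of the associativity law, with \<open>hs\<close> the inner
  composition maps on trees and \<open>ws\<close> the tensor products of the innermost arguments.
\<close>

lemma lin_tensor_map3:
  assumes "length hs = length ys" "length ys = length ws"
  shows "lin g (tensor (map2 (\<lambda>(h, y) w. lin (\<lambda>t. lin (\<lambda>us. Poly_Mapping.single (h t us) 1) w) y)
      (zip hs ys) ws)) =
    lin (\<lambda>ts. lin (\<lambda>uss. g (map2 (\<lambda>(h, t) us. h t us) (zip hs ts) uss)) (tensor ws)) (tensor ys)"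
  using assms
proof (induction hs ys ws arbitrary: g rule: list_induct3)
  case (Cons h hs y ys w ws)
  show ?case
    by (simp add: lin_tensor_Cons lin_lin Cons.IH lin_commute[of _ "tensor ys" w])
qed simp

lemma lin_tensor_slot:
  "lin g (tensor (xs @ y # zs)) =
    lin (\<lambda>t. lin (\<lambda>ts. lin (\<lambda>us. g (ts @ t # us)) (tensor zs)) (tensor xs)) y"
  by (simp add: lin_tensor_append lin_tensor_Cons lin_commute[of _ y])

section \<open>Composition of formal combinations of trees\<close>

abbreviation formal_forest ::
    "('k::field, 'a) operad \<Rightarrow> ('k, 'b) operad \<Rightarrow> nat list \<Rightarrow> (('a, 'b) ltree \<Rightarrow>\<^sub>0 'k) list \<Rightarrow> bool" where
  "formal_forest O1 O2 ns ys \<equiv> list_all2 (\<lambda>n y. y \<in> formal_trees O1 O2 n) ns ys"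

lemma relabel_ext_lin: "relabel_ext \<sigma> x = lin (\<lambda>t. single_tree (relabel \<sigma> t)) x"
  by (simp add: relabel_ext_def lin_def scale_single)

lemma tree_comp_ext_lin:
  "tree_comp_ext O1 O2 ns x ys = lin (\<lambda>t. lin (\<lambda>ts. single_tree (tree_comp O1 O2 ns t ts)) (tensor ys)) x"
  unfolding lin_tensor by (simp add: tree_comp_ext_def lin_def formal.scale_sum_right scale_single)

text \<open>
  Composition as a linear map in a single inner argument.
\<close>

lemma tree_comp_ext_slot:
  "tree_comp_ext O1 O2 ns x (ys @ y # zs) =
    lin (\<lambda>p. lin (\<lambda>t. lin (\<lambda>ts. lin (\<lambda>us. single_tree (tree_comp O1 O2 ns t (ts @ p # us)))
      (tensor zs)) (tensor ys)) x) y"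
  unfolding tree_comp_ext_lin lin_tensor_slot by (rule lin_commute)

lemma subspace_formal_trees: "formal.subspace (formal_trees O1 O2 n)"
  unfolding formal.subspace_def formal_trees_def
proof safe
  fix x y :: "('b, 'c) ltree \<Rightarrow>\<^sub>0 'a" and t
  assume "Poly_Mapping.keys x \<subseteq> alt_trees O1 O2 n" "Poly_Mapping.keys y \<subseteq> alt_trees O1 O2 n"
    "t \<in> Poly_Mapping.keys (x + y)"
  then show "t \<in> alt_trees O1 O2 n"
    using Poly_Mapping.keys_add[of x y] by auto
next
  fix c and x :: "('b, 'c) ltree \<Rightarrow>\<^sub>0 'a" and t
  assume "Poly_Mapping.keys x \<subseteq> alt_trees O1 O2 n" "t \<in> Poly_Mapping.keys (scale c x)"
  then show "t \<in> alt_trees O1 O2 n"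
    by (auto simp: in_keys_iff lookup_scale)
qed simp

lemma single_tree_formal: "t \<in> alt_trees O1 O2 n \<Longrightarrow> single_tree t \<in> formal_trees O1 O2 n"
  by (simp add: formal_trees_def)

lemma formal_treesD: "\<lbrakk>x \<in> formal_trees O1 O2 n; t \<in> Poly_Mapping.keys x\<rbrakk> \<Longrightarrow> t \<in> alt_trees O1 O2 n"
  by (auto simp: formal_trees_def)

lemma formal_forestD:
  assumes "formal_forest O1 O2 ns ys" "list_all2 (\<lambda>t y. t \<in> Poly_Mapping.keys y) ts ys"
  shows "alt_forest O1 O2 ns ts"
  using assms by (simp add: list_all2_conv_all_nth) (metis formal_treesD)

lemma span_tree_relators_formal: "formal.span (tree_relators O1 O2 n) \<subseteq> formal_trees O1 O2 n"
proof (rule formal.span_minimal[OF _ subspace_formal_trees])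
  show "tree_relators O1 O2 n \<subseteq> formal_trees O1 O2 n"
    unfolding tree_relators_def
    by (auto intro!: single_tree_formal formal.subspace_diff[OF subspace_formal_trees]
        formal.subspace_add[OF subspace_formal_trees] formal.subspace_scale[OF subspace_formal_trees])
qed

lemma equiv_tree_equiv:
  fixes O1 :: "('k::field, 'a) operad" and O2 :: "('k, 'b) operad"
  shows "equiv (formal_trees O1 O2 n) (tree_equiv O1 O2 n)"
proof (rule equivI)
  show "tree_equiv O1 O2 n \<subseteq> formal_trees O1 O2 n \<times> formal_trees O1 O2 n"
    by (auto simp: tree_equiv_def)
  show "refl_on (formal_trees O1 O2 n) (tree_equiv O1 O2 n)"
    by (auto simp: refl_on_def tree_equiv_def formal.span_zero)
  show "sym (tree_equiv O1 O2 n)"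
    by (auto simp: sym_def tree_equiv_def) (metis formal.span_neg minus_diff_eq)
  have "x - z \<in> formal.span S" if "x - y \<in> formal.span S" "y - z \<in> formal.span S"
    for x y z :: "('a, 'b) ltree \<Rightarrow>\<^sub>0 'k" and S
    using formal.span_add[OF that] by simp
  then show "trans (tree_equiv O1 O2 n)"
    by (auto simp: trans_def tree_equiv_def)
qed

lemma lin_formal_trees:
  assumes "x \<in> formal_trees O1 O2 n" "\<And>t. t \<in> alt_trees O1 O2 n \<Longrightarrow> f t \<in> formal_trees O1' O2' m"
  shows "lin f x \<in> formal_trees O1' O2' m"
  using assms by (intro lin_in_subspace subspace_formal_trees) (auto dest: formal_treesD)

lemma relation_map_span:
  assumes "relation_map O1 O2 n m f" "x \<in> formal.span (tree_relators O1 O2 n)"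
  shows "lin (\<lambda>t. single_tree (f t)) x \<in> formal.span (tree_relators O1 O2 m)"
proof (rule lin_in_span[OF assms(2) formal.subspace_span])
  fix y assume "y \<in> tree_relators O1 O2 n"
  then have "lin (\<lambda>t. single_tree (f t)) y \<in> tree_relators O1 O2 m"
    unfolding tree_relators_def
  proof (elim UnE CollectE exE conjE)
    fix c d t u v
    assume y: "y = single_tree v - (scale c (single_tree t) + scale d (single_tree u))"
      and "vertex_linear O1 O2 c d t u v" "{t, u, v} \<subseteq> alt_trees O1 O2 n"
    then have "vertex_linear O1 O2 c d (f t) (f u) (f v)" "{f t, f u, f v} \<subseteq> alt_trees O1 O2 m"
      using assms(1) by (auto simp: relation_map_def)
    then show "lin (\<lambda>t. single_tree (f t)) y \<in>
      {single_tree v - (scale c (single_tree t) + scale d (single_tree u)) | c d t u v.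
         vertex_linear O1 O2 c d t u v \<and> {t, u, v} \<subseteq> alt_trees O1 O2 m} \<union>
      {single_tree t - single_tree u | t u. vertex_reorder O1 O2 t u \<and> {t, u} \<subseteq> alt_trees O1 O2 m}"
      unfolding y lin_diff lin_add lin_scale lin_single formal.scale_one by blast
  next
    fix t u
    assume y: "y = single_tree t - single_tree u"
      and "vertex_reorder O1 O2 t u" "{t, u} \<subseteq> alt_trees O1 O2 n"
    then have "vertex_reorder O1 O2 (f t) (f u)" "{f t, f u} \<subseteq> alt_trees O1 O2 m"
      using assms(1) by (auto simp: relation_map_def)
    then show "lin (\<lambda>t. single_tree (f t)) y \<in>
      {single_tree v - (scale c (single_tree t) + scale d (single_tree u)) | c d t u v.
         vertex_linear O1 O2 c d t u v \<and> {t, u, v} \<subseteq> alt_trees O1 O2 m} \<union>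
      {single_tree t - single_tree u | t u. vertex_reorder O1 O2 t u \<and> {t, u} \<subseteq> alt_trees O1 O2 m}"
      unfolding y lin_diff lin_single formal.scale_one by blast
  qed
  then show "lin (\<lambda>t. single_tree (f t)) y \<in> formal.span (tree_relators O1 O2 m)"
    by (rule formal.span_base)
qed

context operad_pair
begin

lemma relabel_ext_formal:
  "\<lbrakk>\<sigma> permutes {..<n}; x \<in> formal_trees O1 O2 n\<rbrakk> \<Longrightarrow> relabel_ext \<sigma> x \<in> formal_trees O1 O2 n"
  unfolding relabel_ext_lin by (auto intro!: lin_formal_trees single_tree_formal relabel_alt_trees)

lemma relabel_ext_cong:
  assumes "\<sigma> permutes {..<n}" "(x, y) \<in> tree_equiv O1 O2 n"
  shows "(relabel_ext \<sigma> x, relabel_ext \<sigma> y) \<in> tree_equiv O1 O2 n"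
  using assms relation_map_span[OF relation_map_relabel, of \<sigma> n "x - y"]
  by (simp add: tree_equiv_def relabel_ext_formal) (simp add: relabel_ext_lin lin_diff)

lemma tree_comp_ext_formal:
  assumes "x \<in> formal_trees O1 O2 (length ns)" "formal_forest O1 O2 ns ys"
  shows "tree_comp_ext O1 O2 ns x ys \<in> formal_trees O1 O2 (sum_list ns)"
  unfolding tree_comp_ext_lin using assms
  by (auto intro!: lin_in_subspace[OF subspace_formal_trees] lin_tensor_in_subspace[OF subspace_formal_trees]
      single_tree_formal tree_comp_alt_trees dest: formal_treesD formal_forestD)

lemma tree_comp_ext_cong_left:
  assumes x: "(x, x') \<in> tree_equiv O1 O2 (length ns)" and ys: "formal_forest O1 O2 ns ys"
  shows "(tree_comp_ext O1 O2 ns x ys, tree_comp_ext O1 O2 ns x' ys) \<in> tree_equiv O1 O2 (sum_list ns)"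
proof -
  have "tree_comp_ext O1 O2 ns x ys - tree_comp_ext O1 O2 ns x' ys =
      lin (\<lambda>ts. lin (\<lambda>t. single_tree (tree_comp O1 O2 ns t ts)) (x - x')) (tensor ys)"
    unfolding tree_comp_ext_lin lin_diff[symmetric] by (rule lin_commute)
  also have "\<dots> \<in> formal.span (tree_relators O1 O2 (sum_list ns))"
    using x ys by (intro lin_tensor_in_subspace formal.subspace_span
        relation_map_span[OF relation_map_tree_comp_left]) (auto simp: tree_equiv_def formal_forestD)
  finally show ?thesis
    using assms by (simp add: tree_equiv_def tree_comp_ext_formal)
qed

lemma tree_comp_ext_cong_slot:
  assumes x: "x \<in> formal_trees O1 O2 (length (ms @ n # ns))"
    and ys: "formal_forest O1 O2 ms ys" and zs: "formal_forest O1 O2 ns zs"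
    and y: "(y, y') \<in> tree_equiv O1 O2 n"
  shows "(tree_comp_ext O1 O2 (ms @ n # ns) x (ys @ y # zs), tree_comp_ext O1 O2 (ms @ n # ns) x (ys @ y' # zs))
    \<in> tree_equiv O1 O2 (sum_list (ms @ n # ns))"
proof -
  let ?ns = "ms @ n # ns"
  have "tree_comp_ext O1 O2 ?ns x (ys @ y # zs) - tree_comp_ext O1 O2 ?ns x (ys @ y' # zs) =
      lin (\<lambda>t. lin (\<lambda>ts. lin (\<lambda>us. lin (\<lambda>p. single_tree (tree_comp O1 O2 ?ns t (ts @ p # us))) (y - y'))
        (tensor zs)) (tensor ys)) x"
    unfolding tree_comp_ext_slot lin_diff[symmetric]
    by (simp only: lin_commute[of _ x "y - y'"] lin_commute[of _ "tensor ys" "y - y'"]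
        lin_commute[of _ "tensor zs" "y - y'"])
  also have "\<dots> \<in> formal.span (tree_relators O1 O2 (sum_list ?ns))"
    using x y ys zs by (intro lin_in_subspace lin_tensor_in_subspace formal.subspace_span
        relation_map_span[OF relation_map_tree_comp_right])
      (auto simp: tree_equiv_def formal_forestD dest: formal_treesD)
  finally show ?thesis
    using x y ys zs by (auto simp: tree_equiv_def simp del: length_append sum_list.append
        intro!: tree_comp_ext_formal list_all2_appendI)
qed

text \<open>
  The inner arguments are exchanged one after the other; \<open>k\<close> counts those already exchanged.
\<close>

lemma tree_comp_ext_cong:
  assumes x: "(x, x') \<in> tree_equiv O1 O2 (length ns)"
    and ys: "formal_forest O1 O2 ns ys" and ys': "formal_forest O1 O2 ns ys'"
    and eq: "\<And>i. i < length ns \<Longrightarrow> (ys ! i, ys' ! i) \<in> tree_equiv O1 O2 (ns ! i)"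
  shows "(tree_comp_ext O1 O2 ns x ys, tree_comp_ext O1 O2 ns x' ys') \<in> tree_equiv O1 O2 (sum_list ns)"
proof -
  note equiv = equiv_tree_equiv[of O1 O2 "sum_list ns"]
  have x': "x' \<in> formal_trees O1 O2 (length ns)"
    using x by (auto simp: tree_equiv_def)
  have len: "length ys = length ns" "length ys' = length ns"
    using ys ys' by (auto dest: list_all2_lengthD)
  have "(tree_comp_ext O1 O2 ns x' ys, tree_comp_ext O1 O2 ns x' (take k ys' @ drop k ys))
      \<in> tree_equiv O1 O2 (sum_list ns)" if "k \<le> length ns" for k
    using that
  proof (induction k)
    case 0
    then show ?case
      using x' ys equiv by (auto simp: tree_comp_ext_formal elim: equiv_class_self)
        (simp add: tree_equiv_def tree_comp_ext_formal formal.span_zero)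
  next
    case (Suc k)
    then have k: "k < length ns" by simp
    have ns: "ns = take k ns @ ns ! k # drop (Suc k) ns"
      using k by (simp add: id_take_nth_drop)
    have "drop k ys = ys ! k # drop (Suc k) ys" "take (Suc k) ys' = take k ys' @ [ys' ! k]"
      using k len by (simp_all add: Cons_nth_drop_Suc take_Suc_conv_app_nth)
    moreover have "formal_forest O1 O2 (take k ns) (take k ys')" "formal_forest O1 O2 (drop (Suc k) ns) (drop (Suc k) ys)"
      using ys ys' by (auto intro: list_all2_takeI list_all2_dropI)
    then have "(tree_comp_ext O1 O2 ns x' (take k ys' @ ys ! k # drop (Suc k) ys),
        tree_comp_ext O1 O2 ns x' (take k ys' @ ys' ! k # drop (Suc k) ys)) \<in> tree_equiv O1 O2 (sum_list ns)"
      using tree_comp_ext_cong_slot[of x' "take k ns" "ns ! k" "drop (Suc k) ns"] eq[OF k] x' ns by metis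
    ultimately show ?case
      using Suc equiv by (auto elim!: equivE dest: transD)
  qed
  from this[of "length ns"] have "(tree_comp_ext O1 O2 ns x' ys, tree_comp_ext O1 O2 ns x' ys') \<in> tree_equiv O1 O2 (sum_list ns)"
    using len by simp
  with tree_comp_ext_cong_left[OF x ys] show ?thesis
    using equiv by (auto elim!: equivE dest: transD)
qed

lemma tree_comp_ext_assoc:
  assumes x: "x \<in> formal_trees O1 O2 (length ns)" and ys: "formal_forest O1 O2 ns ys"
    and pss: "list_all2 (\<lambda>n ps. length ps = n) ns pss" and zss: "list_all2 (formal_forest O1 O2) pss zss"
  shows "tree_comp_ext O1 O2 (concat pss) (tree_comp_ext O1 O2 ns x ys) (concat zss) =
    tree_comp_ext O1 O2 (map sum_list pss) x
      (map (\<lambda>i. tree_comp_ext O1 O2 (pss ! i) (ys ! i) (zss ! i)) [0..<length ns])"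
proof -
  let ?hs = "map (tree_comp O1 O2) pss" and ?ws = "map tensor zss"
  have len: "length ys = length ns" "length pss = length ns" "length zss = length ns"
    using ys pss zss by (auto dest!: list_all2_lengthD)
  have inner: "map (\<lambda>i. tree_comp_ext O1 O2 (pss ! i) (ys ! i) (zss ! i)) [0..<length ns] =
      map2 (\<lambda>(h, y) w. lin (\<lambda>t. lin (\<lambda>us. single_tree (h t us)) w) y) (zip ?hs ys) ?ws"
    by (rule nth_equalityI) (simp_all add: len tree_comp_ext_lin)
  have trees: "tree_comp O1 O2 (concat pss) (tree_comp O1 O2 ns t ts) (concat uss) =
      tree_comp O1 O2 (map sum_list pss) t (map2 (\<lambda>(h, t) us. h t us) (zip ?hs ts) uss)"
    if t: "t \<in> Poly_Mapping.keys x" and ts: "list_all2 (\<lambda>t y. t \<in> Poly_Mapping.keys y) ts ys"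
      and uss: "list_all2 (\<lambda>us w. us \<in> Poly_Mapping.keys w) uss ?ws" for t ts uss
  proof -
    have len': "length ts = length ns" "length uss = length ns"
      using ts uss len by (auto dest!: list_all2_lengthD)
    have "alt_forest O1 O2 (pss ! i) (uss ! i)" if "i < length ns" for i
    proof -
      have "uss ! i \<in> Poly_Mapping.keys (tensor (zss ! i))"
        using list_all2_nthD2[OF uss, of i] that len by simp
      then have "list_all2 (\<lambda>t y. t \<in> Poly_Mapping.keys y) (uss ! i) (zss ! i)"
        by (rule keys_tensor)
      then show ?thesis
        using zss that len by (auto simp: list_all2_conv_all_nth[of "formal_forest O1 O2"] intro: formal_forestD)
    qed
    then have "list_all2 (alt_forest O1 O2) pss uss"
      using len len' by (simp add: list_all2_conv_all_nth[of "alt_forest O1 O2"])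
    moreover have "map (\<lambda>i. tree_comp O1 O2 (pss ! i) (ts ! i) (uss ! i)) [0..<length ns] =
        map2 (\<lambda>(h, t) us. h t us) (zip ?hs ts) uss"
      by (rule nth_equalityI) (simp_all add: len len')
    ultimately show ?thesis
      using tree_comp_assoc[OF formal_treesD[OF x t] formal_forestD[OF ys ts] pss] by simp
  qed
  have "tree_comp_ext O1 O2 (concat pss) (tree_comp_ext O1 O2 ns x ys) (concat zss) =
      lin (\<lambda>t. lin (\<lambda>ts. lin (\<lambda>uss. single_tree (tree_comp O1 O2 (concat pss) (tree_comp O1 O2 ns t ts) (concat uss)))
        (tensor ?ws)) (tensor ys)) x"
    by (simp add: tree_comp_ext_lin lin_lin lin_tensor_concat)
  also have "\<dots> = lin (\<lambda>t. lin (\<lambda>ts. lin (\<lambda>uss. single_tree (tree_comp O1 O2 (map sum_list pss) t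
        (map2 (\<lambda>(h, t) us. h t us) (zip ?hs ts) uss))) (tensor ?ws)) (tensor ys)) x"
    by (intro lin_cong lin_tensor_cong) (simp add: trees)
  also have "\<dots> = tree_comp_ext O1 O2 (map sum_list pss) x
      (map (\<lambda>i. tree_comp_ext O1 O2 (pss ! i) (ys ! i) (zss ! i)) [0..<length ns])"
    unfolding inner tree_comp_ext_lin[of O1 O2 "map sum_list pss"] by (subst lin_tensor_map3) (simp_all add: len)
  finally show ?thesis .
qed

lemma tree_comp_ext_id_left:
  "tree_comp_ext O1 O2 [n] (single_tree (Leaf 0)) [x] = x"
  by (simp add: tree_comp_ext_lin lin_tensor_Cons tree_comp_id_left lin_ident)

lemma tree_comp_ext_id_right:
  assumes "x \<in> formal_trees O1 O2 n"
  shows "tree_comp_ext O1 O2 (replicate n 1) x (replicate n (single_tree (Leaf 0))) = x"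
proof -
  have "tree_comp_ext O1 O2 (replicate n 1) x (replicate n (single_tree (Leaf 0))) = lin single_tree x"
    unfolding tree_comp_ext_lin tensor_replicate_single lin_single formal.scale_one
    using assms by (intro lin_cong) (simp add: formal_treesD tree_comp_id_right del: One_nat_def)
  then show ?thesis by (simp add: lin_ident)
qed

lemma tree_comp_ext_relabel_left:
  assumes x: "x \<in> formal_trees O1 O2 (length ns)" and ys: "formal_forest O1 O2 ns ys"
    and \<sigma>: "\<sigma> permutes {..<length ns}"
  shows "tree_comp_ext O1 O2 ns (relabel_ext \<sigma> x) ys =
    relabel_ext (block_perm \<sigma> ns) (tree_comp_ext O1 O2 (permute_list \<sigma> ns) x (permute_list \<sigma> ys))"
proof -
  have "length ys = length ns"
    using ys by (auto dest: list_all2_lengthD)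
  then have "lin g (tensor (permute_list \<sigma> ys)) = lin (\<lambda>ts. g (permute_list \<sigma> ts)) (tensor ys)"
    for g :: "_ \<Rightarrow> ('a, 'b) ltree \<Rightarrow>\<^sub>0 'k"
    using \<sigma> by (intro lin_tensor_permute) simp
  then show ?thesis
    unfolding tree_comp_ext_lin relabel_ext_lin lin_lin lin_single formal.scale_one
    using x ys \<sigma> by (auto intro!: lin_cong lin_tensor_cong
        simp: tree_comp_relabel_left formal_treesD formal_forestD)
qed

lemma tree_comp_ext_relabel_right:
  assumes x: "x \<in> formal_trees O1 O2 (length ns)" and ys: "formal_forest O1 O2 ns ys"
    and \<tau>s: "list_all2 (\<lambda>n \<tau>. \<tau> permutes {..<n}) ns \<tau>s"
  shows "tree_comp_ext O1 O2 ns x (map (\<lambda>i. relabel_ext (\<tau>s ! i) (ys ! i)) [0..<length ns]) =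
    relabel_ext (block_sum ns \<tau>s) (tree_comp_ext O1 O2 ns x ys)"
proof -
  have len: "length ys = length ns" "length \<tau>s = length ns"
    using ys \<tau>s by (auto dest: list_all2_lengthD)
  have inner: "map (\<lambda>i. relabel_ext (\<tau>s ! i) (ys ! i)) [0..<length ns] =
      map2 (\<lambda>f y. lin (\<lambda>t. single_tree (f t)) y) (map relabel \<tau>s) ys"
    by (rule nth_equalityI) (simp_all add: len relabel_ext_lin)
  have trees: "tree_comp O1 O2 ns t (map2 (\<lambda>f t. f t) (map relabel \<tau>s) ts) =
      relabel (block_sum ns \<tau>s) (tree_comp O1 O2 ns t ts)"
    if "t \<in> Poly_Mapping.keys x" "list_all2 (\<lambda>t y. t \<in> Poly_Mapping.keys y) ts ys" for t ts
  proof -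
    have "length ts = length ns"
      using that len by (auto dest!: list_all2_lengthD)
    then have "map2 (\<lambda>f t. f t) (map relabel \<tau>s) ts = map (\<lambda>i. relabel (\<tau>s ! i) (ts ! i)) [0..<length ns]"
      by (intro nth_equalityI) (simp_all add: len)
    then show ?thesis
      using tree_comp_relabel_right[OF formal_treesD[OF x that(1)] formal_forestD[OF ys that(2)] \<tau>s] by simp
  qed
  have "tree_comp_ext O1 O2 ns x (map (\<lambda>i. relabel_ext (\<tau>s ! i) (ys ! i)) [0..<length ns]) =
      lin (\<lambda>t. lin (\<lambda>ts. single_tree (tree_comp O1 O2 ns t (map2 (\<lambda>f t. f t) (map relabel \<tau>s) ts))) (tensor ys)) x"
    unfolding inner tree_comp_ext_lin[of O1 O2 ns] by (subst lin_tensor_map2) (simp_all add: len)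
  also have "\<dots> = relabel_ext (block_sum ns \<tau>s) (tree_comp_ext O1 O2 ns x ys)"
    unfolding tree_comp_ext_lin relabel_ext_lin lin_lin lin_single formal.scale_one
    by (intro lin_cong lin_tensor_cong) (simp add: trees)
  finally show ?thesis .
qed

end

section \<open>The operad of classes of trees\<close>

text \<open>
  Used to choose representatives of all classes in a list.
\<close>

lemma list_all2_choice:
  assumes "list_all2 (\<lambda>n B. \<exists>y. Q n y \<and> B = f n y) ns Bs"
  obtains ys where "list_all2 Q ns ys" "Bs = map2 f ns ys"
proof -
  have "\<exists>ys. list_all2 Q ns ys \<and> Bs = map2 f ns ys"
    using assms
  proof (induction rule: list_all2_induct)
    case (Cons n ns B Bs)
    then obtain y ys where "Q n y" "B = f n y" "list_all2 Q ns ys" "Bs = map2 f ns ys"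
      by blast
    then show ?case by (intro exI[of _ "y # ys"]) simp
  qed simp
  then show thesis using that by blast
qed

lemma map2_update:
  "length xs = length ys \<Longrightarrow> (map2 f xs ys)[i := f (xs ! i) y] = map2 f xs (ys[i := y])"
  by (cases "i < length ys") (auto simp: nth_list_update list_update_beyond intro!: nth_equalityI)

lemma concat_map2_map2:
  "list_all2 (\<lambda>xs ys. length xs = length ys) xss yss \<Longrightarrow>
    concat (map2 (map2 f) xss yss) = map2 f (concat xss) (concat yss)"
  by (induction rule: list_all2_induct) simp_all

text \<open>
  The operations on classes are unions over all representatives; they have the intended value once
  all members of the union agree.
\<close>

lemma UN_UN_constant:
  assumes "A \<noteq> {}" "B \<noteq> {}" "\<And>x y. \<lbrakk>x \<in> A; y \<in> B\<rbrakk> \<Longrightarrow> f x y = C"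
  shows "(\<Union>x\<in>A. \<Union>y\<in>B. f x y) = C"
  using assms by (metis (mono_tags, lifting) UN_constant_eq ex_in_conv)

lemma tree_class_eq_iff:
  assumes "x \<in> formal_trees O1 O2 n" "y \<in> formal_trees O1 O2 n"
  shows "tree_class O1 O2 n x = tree_class O1 O2 n y \<longleftrightarrow> (x, y) \<in> tree_equiv O1 O2 n"
  by (rule eq_equiv_class_iff[OF equiv_tree_equiv assms])

lemma tree_carrier_iff:
  "A \<in> op_carrier (tree_operad O1 O2) n \<longleftrightarrow>
    (\<exists>x. x \<in> formal_trees O1 O2 n \<and> A = tree_class O1 O2 n x)"
  by (auto simp: tree_operad_def tree_space_def quotient_def)

lemma tree_class_carrier:
  "x \<in> formal_trees O1 O2 n \<Longrightarrow> tree_class O1 O2 n x \<in> op_carrier (tree_operad O1 O2) n"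
  using tree_carrier_iff by blast

lemma tree_op_args:
  assumes "op_args (tree_operad O1 O2) ns Bs"
  obtains ys where "formal_forest O1 O2 ns ys" "Bs = map2 (tree_class O1 O2) ns ys"
  using assms by (auto simp: op_args_def tree_carrier_iff elim: list_all2_choice)

lemma tree_zero: "\<zero>\<^bsub>op_space (tree_operad O1 O2) n\<^esub> = tree_class O1 O2 n 0"
  by (simp add: tree_operad_def tree_space_def)

lemma tree_id: "op_id (tree_operad O1 O2) = tree_class O1 O2 1 (single_tree (Leaf 0))"
  by (simp add: tree_operad_def)

lemma tree_add:
  assumes "x \<in> formal_trees O1 O2 n" "y \<in> formal_trees O1 O2 n"
  shows "tree_class O1 O2 n x \<oplus>\<^bsub>op_space (tree_operad O1 O2) n\<^esub> tree_class O1 O2 n y =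
    tree_class O1 O2 n (x + y)"
proof -
  have "(x' + y', x + y) \<in> tree_equiv O1 O2 n"
    if "(x, x') \<in> tree_equiv O1 O2 n" "(y, y') \<in> tree_equiv O1 O2 n" for x' y'
  proof -
    have "x' + y' - (x + y) = - ((x - x') + (y - y'))" by simp
    then show ?thesis
      using that formal.span_neg[OF formal.span_add] formal.subspace_add[OF subspace_formal_trees]
      by (simp only: tree_equiv_def mem_Collect_eq prod.case) blast
  qed
  moreover have "x \<in> tree_class O1 O2 n x" "y \<in> tree_class O1 O2 n y"
    using assms equiv_class_self[OF equiv_tree_equiv] by blast+
  ultimately show ?thesis
    unfolding tree_operad_def tree_space_def
    by simp (rule UN_UN_constant; auto intro!: equiv_class_eq[OF equiv_tree_equiv])
qed

lemma tree_smult: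
  assumes "x \<in> formal_trees O1 O2 n"
  shows "c \<odot>\<^bsub>op_space (tree_operad O1 O2) n\<^esub> tree_class O1 O2 n x = tree_class O1 O2 n (scale c x)"
proof -
  have "(scale c x', scale c x) \<in> tree_equiv O1 O2 n" if "(x, x') \<in> tree_equiv O1 O2 n" for x'
  proof -
    have "scale c x' - scale c x = scale (- c) (x - x')"
      by (simp add: formal.scale_right_diff_distrib formal.scale_minus_left)
    then show ?thesis
      using that formal.span_scale formal.subspace_scale[OF subspace_formal_trees]
      by (simp only: tree_equiv_def mem_Collect_eq prod.case) blast
  qed
  moreover have "x \<in> tree_class O1 O2 n x"
    using assms equiv_class_self[OF equiv_tree_equiv] by blast
  ultimately show ?thesis
    unfolding tree_operad_def tree_space_def
    by simp (rule UN_constant_eq; auto intro!: equiv_class_eq[OF equiv_tree_equiv])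
qed

lemma tree_space_module:
  fixes O1 :: "('k::field, 'a) operad" and O2 :: "('k, 'b) operad"
  shows "is_vector_space (op_space (tree_operad O1 O2) n)"
proof -
  let ?M = "op_space (tree_operad O1 O2) n"
  note sub [intro] = formal.subspace_add[OF subspace_formal_trees]
    formal.subspace_scale[OF subspace_formal_trees] formal.subspace_0[OF subspace_formal_trees]
  have rep: "\<exists>x. x \<in> formal_trees O1 O2 n \<and> A = tree_class O1 O2 n x" if "A \<in> carrier ?M" for A
    using that tree_carrier_iff by blast
  note [simp] = tree_add tree_smult tree_zero tree_class_carrier sub
  show ?thesis
  proof (rule moduleI)
    show "abelian_group ?M"
    proof (rule abelian_groupI)
      fix A assume A: "A \<in> carrier ?M"
      then obtain x where x: "x \<in> formal_trees O1 O2 n" "A = tree_class O1 O2 n x"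
        using rep by blast
      then have "tree_class O1 O2 n (scale (- 1) x) \<oplus>\<^bsub>?M\<^esub> A = tree_class O1 O2 n (scale (- 1) x + x)"
        by (simp del: formal.scale_minus_left)
      then have "tree_class O1 O2 n (scale (- 1) x) \<oplus>\<^bsub>?M\<^esub> A = \<zero>\<^bsub>?M\<^esub>"
        by simp
      then show "\<exists>B\<in>carrier ?M. B \<oplus>\<^bsub>?M\<^esub> A = \<zero>\<^bsub>?M\<^esub>"
        using x(1) by (meson sub tree_class_carrier)
    qed (auto dest!: rep simp: ac_simps)
    show "cring (ring_of_type_algebra :: 'k ring)"
      by (rule cring_from_type_algebra)
  qed (auto dest!: rep simp: ring_of_type_algebra_def formal.scale_left_distrib formal.scale_right_distrib)
qed

context operad_pair
begin

lemma tree_act: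
  assumes "\<sigma> permutes {..<n}" "x \<in> formal_trees O1 O2 n"
  shows "op_act (tree_operad O1 O2) n \<sigma> (tree_class O1 O2 n x) = tree_class O1 O2 n (relabel_ext \<sigma> x)"
proof -
  have "x \<in> tree_class O1 O2 n x"
    using assms equiv_class_self[OF equiv_tree_equiv] by blast
  then have "(\<Union>y\<in>tree_class O1 O2 n x. tree_class O1 O2 n (relabel_ext \<sigma> y)) =
      tree_class O1 O2 n (relabel_ext \<sigma> x)"
    using relabel_ext_cong[OF assms(1)] equivE[OF equiv_tree_equiv]
    by (intro UN_constant_eq) (auto intro!: equiv_class_eq[OF equiv_tree_equiv, symmetric])
  then show ?thesis
    by (simp add: tree_operad_def)
qed

lemma tree_operad_comp:
  assumes x: "x \<in> formal_trees O1 O2 (length ns)" and ys: "formal_forest O1 O2 ns ys"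
  shows "op_comp (tree_operad O1 O2) ns (tree_class O1 O2 (length ns) x) (map2 (tree_class O1 O2) ns ys) =
    tree_class O1 O2 (sum_list ns) (tree_comp_ext O1 O2 ns x ys)"
proof -
  have len: "length ys = length ns"
    using ys by (auto dest: list_all2_lengthD)
  have self: "z \<in> tree_class O1 O2 n z" if "z \<in> formal_trees O1 O2 n" for z n
    using that equiv_class_self[OF equiv_tree_equiv] by blast
  have "(\<Union>x'\<in>tree_class O1 O2 (length ns) x. \<Union>ys'\<in>listset (map2 (tree_class O1 O2) ns ys).
      tree_class O1 O2 (sum_list ns) (tree_comp_ext O1 O2 ns x' ys')) =
    tree_class O1 O2 (sum_list ns) (tree_comp_ext O1 O2 ns x ys)"
  proof (rule UN_UN_constant)
    have "ys \<in> listset (map2 (tree_class O1 O2) ns ys)"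
      using ys self by (auto simp: in_listset_iff list_all2_conv_all_nth)
    then show "listset (map2 (tree_class O1 O2) ns ys) \<noteq> {}" by blast
    show "tree_class O1 O2 (length ns) x \<noteq> {}"
      using self[OF x] by blast
    fix x' ys'
    assume x': "x' \<in> tree_class O1 O2 (length ns) x" and ys': "ys' \<in> listset (map2 (tree_class O1 O2) ns ys)"
    have eq: "(ys ! i, ys' ! i) \<in> tree_equiv O1 O2 (ns ! i)" if "i < length ns" for i
      using ys' that by (auto simp: in_listset_iff list_all2_conv_all_nth len)
    have "length ys' = length ns"
      using ys' by (auto simp: in_listset_iff len dest: list_all2_lengthD)
    then have "formal_forest O1 O2 ns ys'"
      using eq by (auto simp: list_all2_conv_all_nth tree_equiv_def)
    from tree_comp_ext_cong[OF _ ys this eq, of x x'] x'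
    show "tree_class O1 O2 (sum_list ns) (tree_comp_ext O1 O2 ns x' ys') =
        tree_class O1 O2 (sum_list ns) (tree_comp_ext O1 O2 ns x ys)"
      by (intro equiv_class_eq[OF equiv_tree_equiv, symmetric]) auto
  qed
  then show ?thesis
    by (simp add: tree_operad_def)
qed

text \<open>
  Every axiom is obtained by choosing representatives and quoting the corresponding law for formal
  combinations.
\<close>

lemma symmetric_operad_tree_operad: "symmetric_operad (tree_operad O1 O2)"
proof (rule symmetric_operad.intro)
  let ?T = "tree_operad O1 O2"
  note sub = formal.subspace_add[OF subspace_formal_trees] formal.subspace_scale[OF subspace_formal_trees]
  have leaf: "single_tree (Leaf 0) \<in> formal_trees O1 O2 1"
    by (rule single_tree_formal) (simp add: alt_trees_def lessThan_Suc)
  show "op_id ?T \<in> op_carrier ?T 1"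
    unfolding tree_id by (rule tree_class_carrier[OF leaf])
  fix n :: nat and \<sigma> :: "nat \<Rightarrow> nat" and U and c :: 'k
  assume n: "1 \<le> n"
  show "is_vector_space (op_space ?T n)"
    by (rule tree_space_module)
  assume U: "U \<in> op_carrier ?T n"
  then obtain x where x: "x \<in> formal_trees O1 O2 n" and U_eq: "U = tree_class O1 O2 n x"
    by (auto simp: tree_carrier_iff)
  show "op_act ?T n id U = U"
    by (simp add: U_eq tree_act[OF permutes_id x] relabel_ext_lin relabel_ident lin_ident)
  show "op_comp ?T [n] (op_id ?T) [U] = U"
    using tree_operad_comp[of "single_tree (Leaf 0)" "[n]" "[x]"] leaf x
    by (simp add: U_eq tree_id tree_comp_ext_id_left)
  have "formal_forest O1 O2 (replicate n 1) (replicate n (single_tree (Leaf 0)))"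
    using leaf by (simp add: list_all2_conv_all_nth)
  then show "op_comp ?T (replicate n 1) U (replicate n (op_id ?T)) = U"
    using tree_operad_comp[of x "replicate n 1" "replicate n (single_tree (Leaf 0))"] x
    by (simp add: U_eq tree_id tree_comp_ext_id_right[OF x, unfolded One_nat_def] sum_list_replicate)
  assume \<sigma>: "\<sigma> permutes {..<n}"
  show "op_act ?T n \<sigma> U \<in> op_carrier ?T n"
    by (simp add: U_eq tree_act \<sigma> x relabel_ext_formal tree_class_carrier)
  show "op_act ?T n \<sigma> (c \<odot>\<^bsub>op_space ?T n\<^esub> U) = c \<odot>\<^bsub>op_space ?T n\<^esub> op_act ?T n \<sigma> U"
    by (simp add: U_eq tree_smult tree_act \<sigma> x sub relabel_ext_formal) (simp add: relabel_ext_lin lin_scale)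
  show "op_act ?T n (\<tau> \<circ> \<sigma>) U = op_act ?T n \<tau> (op_act ?T n \<sigma> U)" if "\<tau> permutes {..<n}" for \<tau>
    using that permutes_compose[OF \<sigma> that]
    by (simp add: U_eq tree_act \<sigma> x relabel_ext_formal)
      (simp add: relabel_ext_lin lin_lin relabel_relabel comp_def)
  show "op_act ?T n \<sigma> (U \<oplus>\<^bsub>op_space ?T n\<^esub> Y) = op_act ?T n \<sigma> U \<oplus>\<^bsub>op_space ?T n\<^esub> op_act ?T n \<sigma> Y"
    if Y: "Y \<in> op_carrier ?T n" for Y
  proof -
    obtain y where "y \<in> formal_trees O1 O2 n" "Y = tree_class O1 O2 n y"
      using Y by (auto simp: tree_carrier_iff)
    then show ?thesis
      by (simp add: U_eq tree_add tree_act \<sigma> x sub relabel_ext_formal) (simp add: relabel_ext_lin lin_add)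
  qed
next
  let ?T = "tree_operad O1 O2"
  note sub = formal.subspace_add[OF subspace_formal_trees] formal.subspace_scale[OF subspace_formal_trees]
  fix ns U Ys
  assume ns: "arity_list ns" and "U \<in> op_carrier ?T (length ns)" and "op_args ?T ns Ys"
  then obtain x ys where x: "x \<in> formal_trees O1 O2 (length ns)" and U: "U = tree_class O1 O2 (length ns) x"
    and ys: "formal_forest O1 O2 ns ys" and Ys: "Ys = map2 (tree_class O1 O2) ns ys"
    by (auto simp: tree_carrier_iff elim: tree_op_args)
  have len: "length ys = length ns"
    using ys by (auto dest: list_all2_lengthD)
  note comp = tree_operad_comp tree_comp_ext_formal
  show "op_comp ?T ns U Ys \<in> op_carrier ?T (sum_list ns)"
    by (simp add: U Ys comp x ys tree_class_carrier)
  show "op_comp ?T ns (c \<odot>\<^bsub>op_space ?T (length ns)\<^esub> U) Ys = c \<odot>\<^bsub>op_space ?T (sum_list ns)\<^esub> op_comp ?T ns U Ys"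
    for c
    by (simp add: U Ys comp x ys tree_smult sub) (simp add: tree_comp_ext_lin lin_scale)
  show "op_comp ?T ns (U \<oplus>\<^bsub>op_space ?T (length ns)\<^esub> U') Ys
      = op_comp ?T ns U Ys \<oplus>\<^bsub>op_space ?T (sum_list ns)\<^esub> op_comp ?T ns U' Ys"
    if Y: "U' \<in> op_carrier ?T (length ns)" for U'
  proof -
    obtain x' where "x' \<in> formal_trees O1 O2 (length ns)" "U' = tree_class O1 O2 (length ns) x'"
      using Y by (auto simp: tree_carrier_iff)
    then show ?thesis
      by (simp add: U Ys comp x ys tree_add sub) (simp add: tree_comp_ext_lin lin_add)
  qed
  have slot: "op_comp ?T ns U (Ys[i := tree_class O1 O2 (ns ! i) y]) =
      tree_class O1 O2 (sum_list ns) (tree_comp_ext O1 O2 ns x (ys[i := y])) \<and>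
      tree_comp_ext O1 O2 ns x (ys[i := y]) \<in> formal_trees O1 O2 (sum_list ns)"
    if "i < length ns" "y \<in> formal_trees O1 O2 (ns ! i)" for i y
  proof -
    have "formal_forest O1 O2 ns (ys[i := y])"
      using ys that by (auto simp: list_all2_conv_all_nth nth_list_update)
    then show ?thesis
      using map2_update[of ns ys "tree_class O1 O2" i y] len by (simp add: U Ys comp x)
  qed
  show "op_comp ?T ns U (Ys[i := c \<odot>\<^bsub>op_space ?T (ns ! i)\<^esub> Y])
      = c \<odot>\<^bsub>op_space ?T (sum_list ns)\<^esub> op_comp ?T ns U (Ys[i := Y])"
    if i: "i < length ns" and Y: "Y \<in> op_carrier ?T (ns ! i)" for i c Y
  proof -
    obtain y where "y \<in> formal_trees O1 O2 (ns ! i)" "Y = tree_class O1 O2 (ns ! i) y"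
      using Y by (auto simp: tree_carrier_iff)
    then show ?thesis
      using i by (simp add: slot tree_smult sub)
        (simp add: upd_conv_take_nth_drop len tree_comp_ext_slot lin_scale)
  qed
  show "op_comp ?T ns U (Ys[i := Y \<oplus>\<^bsub>op_space ?T (ns ! i)\<^esub> Y']) =
      op_comp ?T ns U (Ys[i := Y]) \<oplus>\<^bsub>op_space ?T (sum_list ns)\<^esub> op_comp ?T ns U (Ys[i := Y'])"
    if i: "i < length ns" and Y: "Y \<in> op_carrier ?T (ns ! i)" "Y' \<in> op_carrier ?T (ns ! i)" for i Y Y'
  proof -
    obtain y y' where "y \<in> formal_trees O1 O2 (ns ! i)" "Y = tree_class O1 O2 (ns ! i) y"
      "y' \<in> formal_trees O1 O2 (ns ! i)" "Y' = tree_class O1 O2 (ns ! i) y'"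
      using Y by (auto simp: tree_carrier_iff)
    then show ?thesis
      using i by (simp add: slot tree_add sub)
        (simp add: upd_conv_take_nth_drop len tree_comp_ext_slot lin_add)
  qed
  show "op_comp ?T ns (op_act ?T (length ns) \<sigma> U) Ys = op_act ?T (sum_list ns) (block_perm \<sigma> ns)
      (op_comp ?T (permute_list \<sigma> ns) U (permute_list \<sigma> Ys))"
    if \<sigma>: "\<sigma> permutes {..<length ns}" for \<sigma>
  proof -
    let ?ns = "permute_list \<sigma> ns"
    have sum: "sum_list ?ns = sum_list ns"
      using mset_permute_list[OF \<sigma>] by (metis sum_mset_sum_list)
    have forest: "formal_forest O1 O2 ?ns (permute_list \<sigma> ys)"
      using ys \<sigma> len by (simp add: list_all2_permute_list_iff)
    have "permute_list \<sigma> Ys = map2 (tree_class O1 O2) ?ns (permute_list \<sigma> ys)"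
      using \<sigma> by (simp add: Ys permute_list_map permute_list_zip len)
    moreover have "tree_comp_ext O1 O2 ?ns x (permute_list \<sigma> ys) \<in> formal_trees O1 O2 (sum_list ns)"
      using tree_comp_ext_formal[of x ?ns "permute_list \<sigma> ys"] x forest by (simp add: sum)
    ultimately show ?thesis
      using tree_operad_comp[of x ?ns "permute_list \<sigma> ys"] forest x ys \<sigma>
        tree_act[OF block_perm_permutes[OF \<sigma>]]
      by (simp add: U Ys tree_act relabel_ext_formal tree_operad_comp sum tree_comp_ext_relabel_left)
  qed
  show "op_comp ?T ns U (map (\<lambda>i. op_act ?T (ns ! i) (\<tau>s ! i) (Ys ! i)) [0..<length ns]) =
      op_act ?T (sum_list ns) (block_sum ns \<tau>s) (op_comp ?T ns U Ys)"
    if \<tau>s: "list_all2 (\<lambda>n \<tau>. \<tau> permutes {..<n}) ns \<tau>s" for \<tau>s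
  proof -
    let ?ys = "map (\<lambda>i. relabel_ext (\<tau>s ! i) (ys ! i)) [0..<length ns]"
    have "formal_forest O1 O2 ns ?ys"
      using ys \<tau>s by (auto simp: list_all2_conv_all_nth intro!: relabel_ext_formal)
    moreover have "map (\<lambda>i. op_act ?T (ns ! i) (\<tau>s ! i) (Ys ! i)) [0..<length ns] =
        map2 (tree_class O1 O2) ns ?ys"
      using ys \<tau>s len by (intro nth_equalityI) (auto simp: Ys list_all2_conv_all_nth tree_act)
    ultimately show ?thesis
      using x ys \<tau>s tree_act[OF block_sum_permutes[OF \<tau>s]]
      by (simp add: U Ys tree_operad_comp tree_comp_ext_formal tree_comp_ext_relabel_right)
  qed
  fix pss Zss
  assume pss: "list_all2 (\<lambda>n ps. length ps = n \<and> arity_list ps) ns pss" and "list_all2 (op_args ?T) pss Zss"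
  then have "list_all2 (\<lambda>ps Zs. \<exists>zs. formal_forest O1 O2 ps zs \<and> Zs = map2 (tree_class O1 O2) ps zs) pss Zss"
    by (elim list_all2_mono) (auto elim: tree_op_args)
  then obtain zss where zss: "list_all2 (formal_forest O1 O2) pss zss"
    and Zss: "Zss = map2 (map2 (tree_class O1 O2)) pss zss"
    by (rule list_all2_choice)
  have len': "length pss = length ns" "length zss = length ns"
    using pss zss by (auto dest!: list_all2_lengthD)
  have pss': "list_all2 (\<lambda>n ps. length ps = n) ns pss"
    using pss by (rule list_all2_mono) simp
  have ps: "length (pss ! i) = ns ! i" if "i < length ns" for i
    using pss' that by (simp add: list_all2_conv_all_nth)
  have ns_eq: "ns = map length pss"
    by (rule nth_equalityI) (simp_all add: len' ps)
  have "list_all2 (\<lambda>xs ys. length xs = length ys) pss zss"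
    using zss by (rule list_all2_mono) (auto dest: list_all2_lengthD)
  then have concat: "concat Zss = map2 (tree_class O1 O2) (concat pss) (concat zss)"
    unfolding Zss by (rule concat_map2_map2)
  have forest: "formal_forest O1 O2 (concat pss) (concat zss)"
    using zss by (induction rule: list_all2_induct) (auto intro: list_all2_appendI)
  have sum: "sum_list (concat pss) = sum_list (map sum_list pss)"
    by (induction pss) simp_all
  have length: "length (concat pss) = sum_list ns"
    by (simp add: ns_eq length_concat)
  let ?ws = "map (\<lambda>i. tree_comp_ext O1 O2 (pss ! i) (ys ! i) (zss ! i)) [0..<length ns]"
  have inner: "formal_forest O1 O2 (pss ! i) (zss ! i)" "ys ! i \<in> formal_trees O1 O2 (length (pss ! i))"
    if "i < length ns" for i
    using that list_all2_nthD[OF zss, of i] list_all2_nthD[OF ys, of i] len' by (simp_all add: ps)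
  have "formal_forest O1 O2 (map sum_list pss) ?ws"
    using inner by (auto simp: list_all2_conv_all_nth[of "\<lambda>n y. y \<in> formal_trees O1 O2 n"] len'
        intro!: tree_comp_ext_formal)
  moreover have "map (\<lambda>i. op_comp ?T (pss ! i) (Ys ! i) (Zss ! i)) [0..<length ns] =
      map2 (tree_class O1 O2) (map sum_list pss) ?ws"
    using inner by (intro nth_equalityI) (simp_all add: len len' Ys Zss tree_operad_comp flip: ps)
  ultimately show "op_comp ?T (concat pss) (op_comp ?T ns U Ys) (concat Zss) =
      op_comp ?T (map sum_list pss) U (map (\<lambda>i. op_comp ?T (pss ! i) (Ys ! i) (Zss ! i)) [0..<length ns])"
    using tree_operad_comp[of x "map sum_list pss" ?ws]
      tree_operad_comp[of "tree_comp_ext O1 O2 ns x ys" "concat pss" "concat zss"]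
      tree_comp_ext_assoc[OF x ys pss' zss] tree_operad_comp[OF x ys] tree_comp_ext_formal[OF x ys] x forest
    by (simp add: U Ys concat len' sum length)
qed

end

section \<open>Spanning sets and operations of arity one\<close>

inductive_set linear_span :: "('k::field, 'a) module \<Rightarrow> 'a set \<Rightarrow> 'a set"
  for M :: "('k::field, 'a) module" and G :: "'a set" where
  base: "x \<in> G \<Longrightarrow> x \<in> linear_span M G"
| zero: "\<zero>\<^bsub>M\<^esub> \<in> linear_span M G"
| add: "\<lbrakk>x \<in> linear_span M G; y \<in> linear_span M G\<rbrakk> \<Longrightarrow> x \<oplus>\<^bsub>M\<^esub> y \<in> linear_span M G"
| smult: "x \<in> linear_span M G \<Longrightarrow> c \<odot>\<^bsub>M\<^esub> x \<in> linear_span M G"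

definition linear_map :: "('k::field, 'a) module \<Rightarrow> ('k, 'b) module \<Rightarrow> ('a \<Rightarrow> 'b) \<Rightarrow> bool" where
  "linear_map M N f \<longleftrightarrow>
    (\<forall>x\<in>carrier M. f x \<in> carrier N) \<and>
    (\<forall>x\<in>carrier M. \<forall>y\<in>carrier M. f (x \<oplus>\<^bsub>M\<^esub> y) = f x \<oplus>\<^bsub>N\<^esub> f y) \<and>
    (\<forall>c. \<forall>x\<in>carrier M. f (c \<odot>\<^bsub>M\<^esub> x) = c \<odot>\<^bsub>N\<^esub> f x)"

abbreviation graded_linear ::
    "('k::field, 'a) operad \<Rightarrow> ('k, 'b) operad \<Rightarrow> (nat \<Rightarrow> 'a \<Rightarrow> 'b) \<Rightarrow> bool" where
  "graded_linear P Q f \<equiv> \<forall>n\<ge>1. linear_map (op_space P n) (op_space Q n) (f n)"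

lemma operad_morphism_graded_linear: "operad_morphism P Q f \<Longrightarrow> graded_linear P Q f"
  by (auto simp: operad_morphism_def linear_map_def)

lemma linear_map_zero:
  assumes P: "symmetric_operad P" and Q: "symmetric_operad Q" and n: "1 \<le> n"
    and f: "linear_map (op_space P n) (op_space Q n) f"
  shows "f \<zero>\<^bsub>op_space P n\<^esub> = \<zero>\<^bsub>op_space Q n\<^esub>"
proof -
  interpret P: symmetric_operad P by (rule P)
  interpret Q: symmetric_operad Q by (rule Q)
  have "f (0 \<odot>\<^bsub>op_space P n\<^esub> \<zero>\<^bsub>op_space P n\<^esub>) = 0 \<odot>\<^bsub>op_space Q n\<^esub> f \<zero>\<^bsub>op_space P n\<^esub>"
    using f P.zero_closed[OF n] by (auto simp: linear_map_def)
  moreover have "f \<zero>\<^bsub>op_space P n\<^esub> \<in> op_carrier Q n"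
    using f P.zero_closed[OF n] by (auto simp: linear_map_def)
  ultimately show ?thesis
    using n by (simp add: P.smult_zero Q.smult_0)
qed

lemma linear_map_eq_by_spanning:
  assumes P: "symmetric_operad P" and Q: "symmetric_operad Q" and n: "1 \<le> n"
    and f: "linear_map (op_space P n) (op_space Q n) f" and g: "linear_map (op_space P n) (op_space Q n) g"
    and G: "G \<subseteq> op_carrier P n" "op_carrier P n \<subseteq> linear_span (op_space P n) G"
    and eq: "\<And>x. x \<in> G \<Longrightarrow> f x = g x" and x: "x \<in> op_carrier P n"
  shows "f x = g x"
proof -
  interpret P: symmetric_operad P by (rule P)
  have "x \<in> linear_span (op_space P n) G"
    using G x by blast
  then have "x \<in> op_carrier P n \<and> f x = g x"
  proof induction
    case zero
    then show ?case
      using linear_map_zero[OF P Q n f] linear_map_zero[OF P Q n g] P.zero_closed[OF n] by simp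
  qed (use eq f g G(1) in \<open>auto simp: linear_map_def P.add_closed[OF n] P.smult_closed[OF n]\<close>)
  then show ?thesis ..
qed

context
  fixes P :: "('k::field, 'a) operad" and Q :: "('k, 'b) operad" and f :: "nat \<Rightarrow> 'a \<Rightarrow> 'b"
  assumes P: "symmetric_operad P" and Q: "symmetric_operad Q" and f: "graded_linear P Q f"
begin

interpretation P: symmetric_operad P by (rule P)
interpretation Q: symmetric_operad Q by (rule Q)

lemma op_args_map2:
  assumes "arity_list ns" "op_args P ns ys"
  shows "op_args Q ns (map2 f ns ys)"
  using assms f by (auto simp: op_args_def arity_list_def linear_map_def list_all2_conv_all_nth)

text \<open>
  The sides of \<open>f (x(y\<^sub>1, \<dots>, y\<^sub>m)) = (f x)(f y\<^sub>1, \<dots>, f y\<^sub>m)\<close> are multilinear in \<open>x, y\<^sub>1, \<dots>, y\<^sub>m\<close>, so that it suffices to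
  have the equation on spanning sets.
\<close>

lemma preserves_comp_by_spanning:
  assumes G: "\<And>n. 1 \<le> n \<Longrightarrow> G n \<subseteq> op_carrier P n"
    and span: "\<And>n. 1 \<le> n \<Longrightarrow> op_carrier P n \<subseteq> linear_span (op_space P n) (G n)"
    and base: "\<And>ns x ys. \<lbrakk>arity_list ns; x \<in> G (length ns); list_all2 (\<lambda>n y. y \<in> G n) ns ys\<rbrakk> \<Longrightarrow>
      f (sum_list ns) (op_comp P ns x ys) = op_comp Q ns (f (length ns) x) (map2 f ns ys)"
    and ns: "arity_list ns" and x: "x \<in> op_carrier P (length ns)" and ys: "op_args P ns ys"
  shows "f (sum_list ns) (op_comp P ns x ys) = op_comp Q ns (f (length ns) x) (map2 f ns ys)"
proof -
  have pos: "1 \<le> length ns" "1 \<le> sum_list ns" "\<And>i. i < length ns \<Longrightarrow> 1 \<le> ns ! i"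
  proof -
    show "1 \<le> length ns" "\<And>i. i < length ns \<Longrightarrow> 1 \<le> ns ! i"
      using ns by (auto simp: arity_list_def Suc_le_eq)
    obtain m ms where "ns = m # ms" "1 \<le> m"
      using ns by (cases ns) (auto simp: arity_list_def)
    then show "1 \<le> sum_list ns" by simp
  qed
  have linear: "f n x \<in> op_carrier Q n"
    "y \<in> op_carrier P n \<Longrightarrow> f n (x \<oplus>\<^bsub>op_space P n\<^esub> y) = f n x \<oplus>\<^bsub>op_space Q n\<^esub> f n y"
    "f n (c \<odot>\<^bsub>op_space P n\<^esub> x) = c \<odot>\<^bsub>op_space Q n\<^esub> f n x"
    if "1 \<le> n" "x \<in> op_carrier P n" for n x y c
    using f that by (auto simp: linear_map_def)
  have span_closed: "x \<in> op_carrier P n" if "x \<in> linear_span (op_space P n) (G n)" "1 \<le> n" for x n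
    using that(1)
    by induction (use G that(2) in \<open>auto simp: P.add_closed P.smult_closed P.zero_closed\<close>)
  let ?preserved = "\<lambda>x ys. f (sum_list ns) (op_comp P ns x ys) = op_comp Q ns (f (length ns) x) (map2 f ns ys)"
  have args: "?preserved x ys" if x: "x \<in> G (length ns)" and ys: "op_args P ns ys" for x ys
  proof -
    have xP: "x \<in> op_carrier P (length ns)"
      using x G pos by blast
    note comp_P = P.comp_closed[OF ns xP] P.comp_add_right[OF ns xP] P.comp_smult_right[OF ns xP]
    note comp_Q = Q.comp_add_right[OF ns linear(1)[OF pos(1) xP]]
      Q.comp_smult_right[OF ns linear(1)[OF pos(1) xP]]
    have "?preserved x ys" if "k \<le> length ns" "op_args P ns ys"
      and "\<And>i. \<lbrakk>k \<le> i; i < length ns\<rbrakk> \<Longrightarrow> ys ! i \<in> G (ns ! i)" for k ys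
      using that
    proof (induction k arbitrary: ys)
      case 0
      have "length ys = length ns"
        using 0 by (simp add: op_args_def list_all2_lengthD)
      with 0 show ?case
        by (intro base ns x) (simp add: list_all2_conv_all_nth)
    next
      case (Suc k)
      let ?V = "op_space P (ns ! k)"
      have k: "k < length ns" and len: "length ys = length ns" and yk: "ys ! k \<in> op_carrier P (ns ! k)"
        using Suc.prems(1,2) by (auto simp: op_args_def list_all2_conv_all_nth)
      note pos_k = pos(3)[OF k]
      have upd: "op_args P ns (ys[k := y])" if "y \<in> op_carrier P (ns ! k)" for y
        using Suc.prems(2) that k len by (auto simp: op_args_def list_all2_conv_all_nth nth_list_update)
      have map2: "map2 f ns (ys[k := y]) = (map2 f ns ys)[k := f (ns ! k) y]" for y
        by (rule map2_update[symmetric]) (simp add: len)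
      note argsQ = op_args_map2[OF ns Suc.prems(2)]
      have scaled: "?preserved x (ys[k := c \<odot>\<^bsub>?V\<^esub> y])"
        if "y \<in> op_carrier P (ns ! k)" "?preserved x (ys[k := y])" for y c
        using that Suc.prems(2) comp_P(1)[OF upd]
        by (simp add: comp_P(3)[OF _ k] linear[OF pos(2)] linear[OF pos_k] map2 comp_Q(2)[OF argsQ k])
      \<comment> \<open>the arguments before \<open>k\<close> are arbitrary, the \<open>k\<close>-th one is varied, and the later ones are from \<open>G\<close>\<close>
      have "?preserved x (ys[k := y])" if "y \<in> linear_span ?V (G (ns ! k))" for y
        using that
      proof induction
        case (base y)
        have "y \<in> op_carrier P (ns ! k)"
          using base G[OF pos_k] by blast
        moreover have "ys[k := y] ! i \<in> G (ns ! i)" if "k \<le> i" "i < length ns" for i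
          using that base Suc.prems(3)[of i] len by (cases "i = k") simp_all
        ultimately show ?case
          using Suc.prems by (intro Suc.IH upd) simp_all
      next
        case zero
        \<comment> \<open>the zero vector is treated as \<open>0 \<cdot> g\<close>, to which homogeneity applies\<close>
        define g where "g = \<zero>\<^bsub>?V\<^esub>"
        have g: "g \<in> op_carrier P (ns ! k)" "0 \<odot>\<^bsub>?V\<^esub> g = g"
          using P.zero_closed[OF pos_k] P.smult_zero[OF pos_k] by (simp_all add: g_def)
        have "f (sum_list ns) (op_comp P ns x (ys[k := 0 \<odot>\<^bsub>?V\<^esub> g])) = \<zero>\<^bsub>op_space Q (sum_list ns)\<^esub>"
          using comp_P(3)[OF Suc.prems(2) k g(1), of 0] comp_P(1)[OF upd[OF g(1)]] linear(1)[OF pos(2)]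
          by (simp add: linear(3)[OF pos(2)] Q.smult_0[OF pos(2)])
        moreover have "f (ns ! k) g = 0 \<odot>\<^bsub>op_space Q (ns ! k)\<^esub> f (ns ! k) g"
          using linear(3)[OF pos_k g(1), of 0] g(2) by simp
        then have "op_comp Q ns (f (length ns) x) ((map2 f ns ys)[k := f (ns ! k) g]) =
            \<zero>\<^bsub>op_space Q (sum_list ns)\<^esub>"
          using comp_Q(2)[OF argsQ k linear(1)[OF pos_k g(1)], of 0]
            Q.comp_closed[OF ns linear(1)[OF pos(1) xP] op_args_map2[OF ns upd[OF g(1)]]]
          by (metis map2 Q.smult_0[OF pos(2)])
        ultimately show ?case
          by (simp add: map2 g(2) flip: g_def)
      next
        case (add y z)
        then have "y \<in> op_carrier P (ns ! k)" "z \<in> op_carrier P (ns ! k)"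
          using span_closed pos_k by auto
        with add.IH Suc.prems(2) comp_P(1)[OF upd] show ?case
          by (simp add: comp_P(2)[OF _ k] linear[OF pos(2)] linear[OF pos_k] map2 comp_Q(1)[OF argsQ k])
      next
        case (smult y c)
        then show ?case
          using span_closed[OF _ pos_k] scaled by blast
      qed
      from this[of "ys ! k"] show ?case
        using yk span[OF pos_k] by auto
    qed
    from this[of "length ns" ys] show ?thesis
      using ys by simp
  qed
  have "x \<in> linear_span (op_space P (length ns)) (G (length ns))"
    using x span[OF pos(1)] by blast
  then show ?thesis
  proof induction
    case zero
    \<comment> \<open>again \<open>g = 0 \<cdot> g\<close>\<close>
    define g where "g = \<zero>\<^bsub>op_space P (length ns)\<^esub>"
    have g: "g \<in> op_carrier P (length ns)" "0 \<odot>\<^bsub>op_space P (length ns)\<^esub> g = g"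
      using P.zero_closed[OF pos(1)] P.smult_zero[OF pos(1)] by (simp_all add: g_def)
    have fg: "f (length ns) g = 0 \<odot>\<^bsub>op_space Q (length ns)\<^esub> f (length ns) g"
      using linear(3)[OF pos(1) g(1), of 0] g(2) by simp
    have "f (sum_list ns) (op_comp P ns g ys) = \<zero>\<^bsub>op_space Q (sum_list ns)\<^esub>"
      using P.comp_smult_left[OF ns g(1) ys, of 0] P.comp_closed[OF ns g(1) ys]
        linear[OF pos(2) P.comp_closed[OF ns g(1) ys]] by (metis g(2) Q.smult_0[OF pos(2)])
    moreover have "op_comp Q ns (f (length ns) g) (map2 f ns ys) = \<zero>\<^bsub>op_space Q (sum_list ns)\<^esub>"
      using Q.comp_smult_left[OF ns linear(1)[OF pos(1) g(1)] op_args_map2[OF ns ys], of 0]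
        Q.comp_closed[OF ns linear(1)[OF pos(1) g(1)] op_args_map2[OF ns ys]] fg
      by (simp add: Q.smult_0[OF pos(2)])
    ultimately show ?case
      by (simp flip: g_def)
  next
    case (add x y)
    then have "x \<in> op_carrier P (length ns)" "y \<in> op_carrier P (length ns)"
      using span_closed pos(1) by auto
    with add.IH show ?case
      by (simp add: P.comp_add_left[OF ns] ys P.comp_closed[OF ns] linear[OF pos(2)] linear[OF pos(1)]
          Q.comp_add_left[OF ns] op_args_map2[OF ns])
  next
    case (smult x c)
    then have "x \<in> op_carrier P (length ns)"
      using span_closed pos(1) by auto
    with smult.IH show ?case
      by (simp add: P.comp_smult_left[OF ns] ys P.comp_closed[OF ns] linear[OF pos(2)] linear[OF pos(1)]
          Q.comp_smult_left[OF ns] op_args_map2[OF ns])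
  qed (use args ys in blast)
qed

end

text \<open>
  A composite has arity 1 only if all operations in it have arity 1, and \<open>S\<^sub>1\<close> is trivial; so generators
  of arity 2 contribute nothing to arity 1, where only the identity generates.
\<close>

lemma binary_arity_one_spanned:
  assumes "binary_operad P" "x \<in> op_carrier P 1"
  shows "\<exists>c. x = c \<odot>\<^bsub>op_space P 1\<^esub> op_id P"
proof -
  interpret symmetric_operad P
    using assms(1) by (simp add: binary_operad_def)
  let ?S = "\<lambda>m. if m = 2 then op_carrier P 2 else {}"
  let ?good = "\<lambda>n x. 1 \<le> n \<and> x \<in> op_carrier P n \<and> (n = 1 \<longrightarrow> (\<exists>c. x = c \<odot>\<^bsub>op_space P 1\<^esub> op_id P))"
  note one = order_refl[of "1 :: nat"]
  have good: "?good n x" if "in_suboperad P ?S n x" for n x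
    using that
  proof induction
    case (generator n x)
    then show ?case by (auto split: if_splits)
  next
    case identity
    show ?case
      using id_closed smult_one[OF one id_closed] by (intro conjI impI exI[of _ 1]) simp_all
  next
    case (zero n)
    then show ?case using zero_closed smult_0[OF one id_closed] by metis
  next
    case (add n x y)
    then show ?case
      using add_closed smult_distrib[OF one id_closed] by metis
  next
    case (smult n x c)
    then show ?case
      using smult_closed smult_smult[OF one id_closed] by metis
  next
    case (act n x \<sigma>)
    have "op_act P n \<sigma> x = x" if "n = 1"
      using act that act_id by (simp add: lessThan_Suc)
    then show ?case
      using act act_closed by metis
  next
    case (comp ns x ys)
    then have args: "op_args P ns ys"
      by (auto simp: op_args_def elim: list_all2_mono)
    have "length ns \<le> sum_list ns"
      using comp.hyps(1) by (induction ns) (auto simp: arity_list_def Suc_le_eq, force)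
    moreover have "1 \<le> length ns"
      using comp.hyps(1) by (simp add: arity_list_def Suc_le_eq)
    moreover have "\<exists>c. op_comp P ns x ys = c \<odot>\<^bsub>op_space P 1\<^esub> op_id P" if "sum_list ns = 1"
    proof -
      have "length ns = 1"
        using calculation that by simp
      then have ns: "ns = [1]"
        using that by (auto simp: length_Suc_conv)
      then obtain y where ys: "ys = [y]"
        using args by (auto simp: op_args_def list_all2_Cons1)
      obtain c d where x: "x = c \<odot>\<^bsub>op_space P 1\<^esub> op_id P" and y: "y = d \<odot>\<^bsub>op_space P 1\<^esub> op_id P"
        using comp.IH ns ys by auto
      have "y \<in> op_carrier P 1"
        using smult_closed[OF one id_closed] by (simp add: y)
      then have "op_comp P [1] x [y] = c \<odot>\<^bsub>op_space P 1\<^esub> y"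
        using comp_smult_left[of "[1]" "op_id P" "[y]" c] id_closed comp_id_left[OF one]
        by (simp add: x arity_list_def op_args_def)
      then show ?thesis
        using smult_smult[OF one id_closed] by (auto simp: ns ys y)
    qed
    ultimately show ?case
      using comp comp_closed[OF comp.hyps(1) _ args] by auto
  qed
  have "in_suboperad P ?S 1 x"
    using assms unfolding binary_operad_def by blast
  from good[OF this] show ?thesis by simp
qed

lemma binary_arity_one_unique:
  assumes "binary_operad P" "c \<odot>\<^bsub>op_space P 1\<^esub> op_id P = d \<odot>\<^bsub>op_space P 1\<^esub> op_id P"
  shows "c = d"
proof (rule ccontr)
  interpret symmetric_operad P
    using assms(1) by (simp add: binary_operad_def)
  let ?V = "op_space P 1"
  note one = order_refl[of "1 :: nat"]
  assume "c \<noteq> d"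
  \<comment> \<open>\<open>(c - d) id = 0\<close> with \<open>c \<noteq> d\<close> would give \<open>id = 0\<close>\<close>
  then have "op_id P = (inverse (c - d) * (c + - d)) \<odot>\<^bsub>?V\<^esub> op_id P"
    using smult_one[OF one id_closed] by simp
  also have "\<dots> = inverse (c - d) \<odot>\<^bsub>?V\<^esub> ((c \<odot>\<^bsub>?V\<^esub> op_id P) \<oplus>\<^bsub>?V\<^esub> (- d \<odot>\<^bsub>?V\<^esub> op_id P))"
    by (simp only: smult_smult[OF one id_closed, symmetric] smult_distrib[OF one id_closed])
  also have "(c \<odot>\<^bsub>?V\<^esub> op_id P) \<oplus>\<^bsub>?V\<^esub> (- d \<odot>\<^bsub>?V\<^esub> op_id P) = (d + - d) \<odot>\<^bsub>?V\<^esub> op_id P"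
    by (simp only: assms(2) smult_distrib[OF one id_closed])
  also have "\<dots> = \<zero>\<^bsub>?V\<^esub>"
    using smult_0[OF one id_closed] by simp
  finally show False
    using assms(1) smult_zero[OF one] by (simp add: binary_operad_def)
qed

section \<open>The canonical maps from the factors\<close>

lemma tree_comp_ext_single:
  fixes O1 :: "('k::field, 'a) operad" and O2 :: "('k, 'b) operad"
  shows "tree_comp_ext O1 O2 ns (single_tree t) (map single_tree ts) = single_tree (tree_comp O1 O2 ns t ts)"
proof -
  have "tensor (map single_tree ts) = Poly_Mapping.single ts (1 :: 'k)" for ts :: "('a, 'b) ltree list"
    by (induction ts) (simp_all add: tensor.simps(2))
  then show ?thesis by (simp add: tree_comp_ext_lin)
qed

lemma (in operad_pair) tree_operad_comp_single:
  assumes "t \<in> alt_trees O1 O2 (length ns)" "alt_forest O1 O2 ns ts"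
  shows "op_comp (tree_operad O1 O2) ns (tree_class O1 O2 (length ns) (single_tree t))
      (map2 (\<lambda>n t. tree_class O1 O2 n (single_tree t)) ns ts) =
    tree_class O1 O2 (sum_list ns) (single_tree (tree_comp O1 O2 ns t ts))"
proof -
  have "map2 (\<lambda>n t. tree_class O1 O2 n (single_tree t)) ns ts = map2 (tree_class O1 O2) ns (map single_tree ts)"
    by (simp add: zip_map2 case_prod_beta)
  moreover have "formal_forest O1 O2 ns (map single_tree ts)"
    using assms(2) by (auto simp: list_all2_map2 intro!: single_tree_formal elim: list_all2_mono)
  ultimately show ?thesis
    using tree_operad_comp[OF single_tree_formal[OF assms(1)]] by (simp add: tree_comp_ext_single)
qed

lemma tree_class_eqI:
  assumes "x - y \<in> formal.span (tree_relators O1 O2 n)" "x \<in> formal_trees O1 O2 n" "y \<in> formal_trees O1 O2 n"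
  shows "tree_class O1 O2 n x = tree_class O1 O2 n y"
  using assms by (subst tree_class_eq_iff) (auto simp: tree_equiv_def)

lemma tree_class_linear:
  assumes "vertex_linear O1 O2 c d t u v" "{t, u, v} \<subseteq> alt_trees O1 O2 n"
  shows "tree_class O1 O2 n (single_tree v) =
    tree_class O1 O2 n (scale c (single_tree t) + scale d (single_tree u))"
proof (rule tree_class_eqI)
  show "single_tree v - (scale c (single_tree t) + scale d (single_tree u)) \<in> formal.span (tree_relators O1 O2 n)"
    using assms unfolding tree_relators_def by (intro formal.span_base) blast
qed (use assms in \<open>auto intro!: single_tree_formal formal.subspace_add[OF subspace_formal_trees]
  formal.subspace_scale[OF subspace_formal_trees]\<close>)

lemma tree_class_reorder:
  assumes "vertex_reorder O1 O2 t u" "{t, u} \<subseteq> alt_trees O1 O2 n"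
  shows "tree_class O1 O2 n (single_tree t) = tree_class O1 O2 n (single_tree u)"
proof (rule tree_class_eqI)
  show "single_tree t - single_tree u \<in> formal.span (tree_relators O1 O2 n)"
    using assms unfolding tree_relators_def by (intro formal.span_base) blast
qed (use assms in \<open>auto intro!: single_tree_formal\<close>)

lemma Leaf_alt_trees: "Leaf 0 \<in> alt_trees O1 O2 1"
  by (simp add: alt_trees_def lessThan_Suc)

locale binary_colour = operad_pair O1 O2 + vertex_colour P O1 O2 V is_V label inputs vertex
  for P :: "('k::field, 'c) operad"
    and O1 :: "('k, 'a) operad" and O2 :: "('k, 'b) operad"
    and V :: "'c \<Rightarrow> ('a, 'b) ltree list \<Rightarrow> ('a, 'b) ltree"
    and is_V :: "('a, 'b) ltree \<Rightarrow> bool"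
    and label :: "('a, 'b) ltree \<Rightarrow> 'c"
    and inputs :: "('a, 'b) ltree \<Rightarrow> ('a, 'b) ltree list"
    and vertex :: "'c \<Rightarrow> ('a, 'b) ltree list \<Rightarrow> ('a, 'b) ltree" +
  assumes binary: "binary_operad P"
begin

text \<open>
  The tree of an operation; in arity 1 this is right for \<open>id\<close> only.
\<close>

definition corolla :: "nat \<Rightarrow> 'c \<Rightarrow> ('a, 'b) ltree" where
  "corolla n a = (if n = 1 then Leaf 0 else V a (map Leaf [0..<n]))"

definition incl :: "nat \<Rightarrow> 'c \<Rightarrow> (('a, 'b) ltree \<Rightarrow>\<^sub>0 'k) set" where
  "incl n a = tree_class O1 O2 n
    (if n = 1 then scale (THE c. a = c \<odot>\<^bsub>op_space P 1\<^esub> op_id P) (single_tree (Leaf 0))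
     else single_tree (V a (map Leaf [0..<n])))"

text \<open>
  A spanning set on which the canonical map is given by \<open>corolla\<close>.
\<close>

definition corolla_labels :: "nat \<Rightarrow> 'c set" where
  "corolla_labels n = (if n = 1 then {op_id P} else op_carrier P n)"

lemma arity_one:
  assumes "a \<in> op_carrier P 1"
  obtains c where "a = c \<odot>\<^bsub>op_space P 1\<^esub> op_id P"
    "incl 1 a = tree_class O1 O2 1 (scale c (single_tree (Leaf 0)))"
proof -
  obtain c where c: "a = c \<odot>\<^bsub>op_space P 1\<^esub> op_id P"
    using binary_arity_one_spanned[OF binary assms] by blast
  then have "(THE c. a = c \<odot>\<^bsub>op_space P 1\<^esub> op_id P) = c"
    using binary_arity_one_unique[OF binary] by (intro the_equality) blast+
  with c show thesis
    by (intro that[of c]) (simp_all add: incl_def)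
qed

lemma corolla_alt_trees:
  assumes "1 \<le> n" "a \<in> op_carrier P n"
  shows "corolla n a \<in> alt_trees O1 O2 n"
  using assms Leaf_alt_trees
  by (auto simp: corolla_def alt_trees_iff_mset alternating_V comp_def)

lemma incl_corolla:
  assumes "a \<in> corolla_labels n"
  shows "incl n a = tree_class O1 O2 n (single_tree (corolla n a))"
proof (cases "n = 1")
  case True
  have "op_id P = 1 \<odot>\<^bsub>op_space P 1\<^esub> op_id P"
    using smult_one[OF order_refl id_closed] by simp
  moreover obtain c where "op_id P = c \<odot>\<^bsub>op_space P 1\<^esub> op_id P"
    "incl 1 (op_id P) = tree_class O1 O2 1 (scale c (single_tree (Leaf 0)))"
    using arity_one[OF id_closed] .
  moreover have "c = 1"
    using binary_arity_one_unique[OF binary] calculation by metis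
  ultimately show ?thesis
    using True assms by (simp add: corolla_labels_def corolla_def)
qed (simp add: incl_def corolla_def)

lemma corolla_labels_closed: "corolla_labels n \<subseteq> op_carrier P n"
  using id_closed by (auto simp: corolla_labels_def)

lemma incl_linear:
  assumes n: "1 \<le> n" and a: "a \<in> op_carrier P n" "b \<in> op_carrier P n"
  shows "incl n ((c \<odot>\<^bsub>op_space P n\<^esub> a) \<oplus>\<^bsub>op_space P n\<^esub> (d \<odot>\<^bsub>op_space P n\<^esub> b)) =
    (c \<odot>\<^bsub>op_space (tree_operad O1 O2) n\<^esub> incl n a) \<oplus>\<^bsub>op_space (tree_operad O1 O2) n\<^esub>
      (d \<odot>\<^bsub>op_space (tree_operad O1 O2) n\<^esub> incl n b)"
proof -
  note sub = formal.subspace_add[OF subspace_formal_trees] formal.subspace_scale[OF subspace_formal_trees]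
  let ?v = "(c \<odot>\<^bsub>op_space P n\<^esub> a) \<oplus>\<^bsub>op_space P n\<^esub> (d \<odot>\<^bsub>op_space P n\<^esub> b)"
  have v: "?v \<in> op_carrier P n"
    using n a by (simp add: add_closed smult_closed)
  show ?thesis
  proof (cases "n = 1")
    case True
    obtain e where e: "a = e \<odot>\<^bsub>op_space P 1\<^esub> op_id P"
      "incl 1 a = tree_class O1 O2 1 (scale e (single_tree (Leaf 0)))"
      using arity_one[of a] a True by auto
    obtain f where f: "b = f \<odot>\<^bsub>op_space P 1\<^esub> op_id P"
      "incl 1 b = tree_class O1 O2 1 (scale f (single_tree (Leaf 0)))"
      using arity_one[of b] a True by auto
    obtain g where g: "?v = g \<odot>\<^bsub>op_space P 1\<^esub> op_id P"
      "incl 1 ?v = tree_class O1 O2 1 (scale g (single_tree (Leaf 0)))"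
      using arity_one[of ?v] v True by auto
    have "?v = (c * e + d * f) \<odot>\<^bsub>op_space P 1\<^esub> op_id P"
      using True by (simp add: e(1) f(1) smult_smult[OF order_refl id_closed, unfolded One_nat_def]
          smult_distrib[OF order_refl id_closed, unfolded One_nat_def])
    with g(1) have "g = c * e + d * f"
      using binary_arity_one_unique[OF binary] by metis
    then show ?thesis
      using True e(2) f(2) g(2) single_tree_formal[OF Leaf_alt_trees, of O1 O2]
      by (simp add: tree_smult tree_add sub formal.scale_left_distrib)
  next
    case False
    have "corolla n a \<in> alt_trees O1 O2 n" "corolla n b \<in> alt_trees O1 O2 n" "corolla n ?v \<in> alt_trees O1 O2 n"
      using n a v by (simp_all only: corolla_alt_trees)
    moreover have "vertex_linear O1 O2 c d (corolla n a) (corolla n b) (corolla n ?v)"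
      using False linear_V[of c d a "map Leaf [0..<n]" b] by (simp add: corolla_def)
    ultimately have "tree_class O1 O2 n (single_tree (corolla n ?v)) =
        tree_class O1 O2 n (scale c (single_tree (corolla n a)) + scale d (single_tree (corolla n b)))"
      by (intro tree_class_linear) auto
    moreover have "a \<in> corolla_labels n" "b \<in> corolla_labels n" "?v \<in> corolla_labels n"
      using False a v by (simp_all add: corolla_labels_def)
    ultimately show ?thesis
      using corolla_alt_trees[OF n] a
      by (simp add: incl_corolla tree_smult tree_add sub single_tree_formal)
  qed
qed

lemma incl_closed:
  assumes "1 \<le> n" "a \<in> op_carrier P n"
  shows "incl n a \<in> op_carrier (tree_operad O1 O2) n"
proof (cases "n = 1")
  case True
  then show ?thesis
    using arity_one[of a] assms single_tree_formal[OF Leaf_alt_trees, of O1 O2]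
    by (metis formal.subspace_scale subspace_formal_trees tree_class_carrier)
next
  case False
  then have "a \<in> corolla_labels n"
    using assms by (simp add: corolla_labels_def)
  then show ?thesis
    using assms by (simp add: incl_corolla tree_class_carrier single_tree_formal corolla_alt_trees)
qed

lemma incl_graded_linear: "graded_linear P (tree_operad O1 O2) incl"
proof -
  interpret T: symmetric_operad "tree_operad O1 O2"
    by (rule symmetric_operad_tree_operad)
  have "incl n (a \<oplus>\<^bsub>op_space P n\<^esub> b) = incl n a \<oplus>\<^bsub>op_space (tree_operad O1 O2) n\<^esub> incl n b"
    if "1 \<le> n" "a \<in> op_carrier P n" "b \<in> op_carrier P n" for n a b
    using incl_linear[OF that, of 1 1] that by (simp add: smult_one T.smult_one incl_closed)
  moreover have "incl n (c \<odot>\<^bsub>op_space P n\<^esub> a) = c \<odot>\<^bsub>op_space (tree_operad O1 O2) n\<^esub> incl n a"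
    if "1 \<le> n" "a \<in> op_carrier P n" for n a c
    \<comment> \<open>\<open>c a\<close> is read as \<open>c a + 0 a\<close>\<close>
    using incl_linear[OF that(1) that(2) that(2), of c 0] that
    by (simp add: smult_0 add_0 smult_closed T.smult_0 T.add_0 T.smult_closed incl_closed)
  ultimately show ?thesis
    using incl_closed by (simp add: linear_map_def)
qed

lemma spanned_by_corolla_labels:
  assumes "1 \<le> n"
  shows "op_carrier P n \<subseteq> linear_span (op_space P n) (corolla_labels n)"
proof
  fix a assume a: "a \<in> op_carrier P n"
  show "a \<in> linear_span (op_space P n) (corolla_labels n)"
  proof (cases "n = 1")
    case True
    then obtain c where "a = c \<odot>\<^bsub>op_space P 1\<^esub> op_id P"
      using a arity_one[of a] by auto
    with True show ?thesis
      by (simp add: corolla_labels_def linear_span.smult linear_span.base)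
  qed (use a in \<open>auto simp: corolla_labels_def intro: linear_span.base\<close>)
qed

text \<open>
  Grafting corollas on a corolla contracts everything to one vertex. Arguments of arity 1 are
  identities; in their place trivial trees are grafted, for which contraction inserts an identity too.
\<close>

lemma tree_comp_corollas:
  assumes ns: "arity_list ns" "2 \<le> length ns" and a: "a \<in> op_carrier P (length ns)"
    and bs: "list_all2 (\<lambda>n b. b \<in> corolla_labels n) ns bs"
  shows "tree_comp O1 O2 ns (corolla (length ns) a) (map2 corolla ns bs) =
    corolla (sum_list ns) (op_comp P ns a bs)"
proof -
  let ?u = "\<lambda>i. relabel (\<lambda>j. block_start ns i + j) (corolla (ns ! i) (bs ! i))"
  have len: "length bs = length ns"
    using bs by (simp add: list_all2_lengthD)
  have u: "label (?u i) = bs ! i \<and> inputs (?u i) = map (\<lambda>j. Leaf (block_start ns i + j)) [0..<ns ! i]"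
    if "i < length ns" for i
    using list_all2_nthD[OF bs that]
    by (auto simp: corolla_def corolla_labels_def label_other inputs_other relabel_V comp_def)
  have "length ns \<le> sum_list ns"
    using ns(1) by (induction ns) (auto simp: arity_list_def Suc_le_eq, force)
  then have sum: "sum_list ns \<noteq> 1" "length ns \<noteq> 1"
    using ns(2) by simp_all
  have "tree_comp O1 O2 ns (corolla (length ns) a) (map2 corolla ns bs) = vertex a (map ?u [0..<length ns])"
    using sum(2) by (auto simp: tree_comp_def corolla_def graft_V comp_def len intro!: arg_cong[of _ _ "vertex a"])
  also have "\<dots> = V (op_comp P ns a bs) (map Leaf [0..<sum_list ns])"
  proof -
    have "map (length \<circ> inputs) (map ?u [0..<length ns]) = ns" "map label (map ?u [0..<length ns]) = bs"
      by (auto intro!: nth_equalityI simp: u len)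
    moreover have "concat (map inputs (map ?u [0..<length ns])) = map Leaf [0..<sum_list ns]"
      unfolding map_upt_blocks by (auto intro!: arg_cong[of _ _ concat] simp: u)
    ultimately show ?thesis
      unfolding vertex_eq by (simp only:)
  qed
  finally show ?thesis
    using sum(1) by (simp add: corolla_def)
qed

text \<open>
  By multilinearity, composition has to be compared only for labels of arity at least 2 and for
  identities.
\<close>

lemma incl_morphism: "operad_morphism P (tree_operad O1 O2) incl"
proof -
  let ?T = "tree_operad O1 O2"
  interpret T: symmetric_operad ?T
    by (rule symmetric_operad_tree_operad)
  have id: "incl 1 (op_id P) = op_id ?T"
    using incl_corolla[of "op_id P" 1] by (simp add: corolla_labels_def corolla_def tree_id)
  have act: "incl n (op_act P n \<sigma> a) = op_act ?T n \<sigma> (incl n a)"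
    if n: "1 \<le> n" and a: "a \<in> op_carrier P n" and \<sigma>: "\<sigma> permutes {..<n}" for n a \<sigma>
  proof (cases "n = 1")
    case True
    then have "\<sigma> = id"
      using \<sigma> by (simp add: lessThan_Suc)
    then show ?thesis
      using n a by (simp add: act_id T.act_id incl_closed)
  next
    case False
    let ?L = "map Leaf [0..<n] :: ('a, 'b) ltree list"
    have \<sigma>a: "op_act P n \<sigma> a \<in> op_carrier P n"
      by (rule act_closed[OF n \<sigma> a])
    have "permute_list \<sigma> ?L = map (relabel \<sigma>) ?L"
      using \<sigma> permutes_in_image[OF \<sigma>] by (auto simp: permute_list_def)
    then have "vertex_reorder O1 O2 (corolla n (op_act P n \<sigma> a)) (relabel \<sigma> (corolla n a))"
      using reorder_V[of \<sigma> ?L a] \<sigma> False by (simp add: corolla_def relabel_V)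
    then have "tree_class O1 O2 n (single_tree (corolla n (op_act P n \<sigma> a))) =
        tree_class O1 O2 n (single_tree (relabel \<sigma> (corolla n a)))"
      using corolla_alt_trees[OF n a] corolla_alt_trees[OF n \<sigma>a] \<sigma>
      by (intro tree_class_reorder) (simp_all add: relabel_alt_trees)
    then show ?thesis
      using False n a \<sigma>a \<sigma> corolla_alt_trees[OF n a]
      by (simp add: incl_corolla corolla_labels_def tree_act single_tree_formal relabel_ext_lin)
  qed
  have comp: "incl (sum_list ns) (op_comp P ns a bs) = op_comp ?T ns (incl (length ns) a) (map2 incl ns bs)"
    if ns: "arity_list ns" and a: "a \<in> corolla_labels (length ns)"
      and bs: "list_all2 (\<lambda>n b. b \<in> corolla_labels n) ns bs" for ns a bs
  proof (cases "length ns = 1")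
    case True
    then obtain m where m: "ns = [m]"
      by (auto simp: length_Suc_conv)
    then obtain b where b: "bs = [b]" "b \<in> op_carrier P m"
      using bs corolla_labels_closed by (auto simp: list_all2_Cons1)
    have "1 \<le> m"
      using ns m by (simp add: arity_list_def)
    then show ?thesis
      using a id b m by (simp add: corolla_labels_def comp_id_left T.comp_id_left incl_closed)
  next
    case False
    have len: "length bs = length ns"
      using bs by (simp add: list_all2_lengthD)
    have two: "2 \<le> length ns"
      using False ns by (cases ns; cases "tl ns") (auto simp: arity_list_def)
    have aP: "a \<in> op_carrier P (length ns)"
      using a False by (simp add: corolla_labels_def)
    have bsP: "op_args P ns bs"
      using bs corolla_labels_closed by (auto simp: op_args_def elim!: list_all2_mono)
    have forest: "alt_forest O1 O2 ns (map2 corolla ns bs)"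
      using ns bsP by (auto simp: list_all2_conv_all_nth op_args_def arity_list_def intro!: corolla_alt_trees)
    have "length ns \<le> sum_list ns"
      using ns by (induction ns) (auto simp: arity_list_def Suc_le_eq, force)
    then have "op_comp P ns a bs \<in> corolla_labels (sum_list ns)"
      using two comp_closed[OF ns aP bsP] by (simp add: corolla_labels_def)
    moreover have "map2 incl ns bs =
        map2 (\<lambda>n t. tree_class O1 O2 n (single_tree t)) ns (map2 corolla ns bs)"
      using bs by (intro nth_equalityI) (auto simp: list_all2_conv_all_nth incl_corolla)
    moreover have "corolla (length ns) a \<in> alt_trees O1 O2 (length ns)"
      using two aP by (intro corolla_alt_trees) simp_all
    ultimately show ?thesis
      using tree_operad_comp_single[OF _ forest, of "corolla (length ns) a"] incl_corolla[OF a]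
      by (simp add: incl_corolla tree_comp_corollas[OF ns two aP bs])
  qed
  have "incl (sum_list ns) (op_comp P ns a bs) = op_comp ?T ns (incl (length ns) a) (map2 incl ns bs)"
    if "arity_list ns" "a \<in> op_carrier P (length ns)" "op_args P ns bs" for ns a bs
    by (rule preserves_comp_by_spanning[OF symmetric_operad_axioms symmetric_operad_tree_operad
          incl_graded_linear corolla_labels_closed spanned_by_corolla_labels comp that])
  then show ?thesis
    using incl_graded_linear act id unfolding operad_morphism_def linear_map_def by blast
qed

end

section \<open>Evaluation of trees in an operad\<close>

text \<open>
  The value of a tree as an operation in the planar order of its leaves; their numbers are ignored
  here.
\<close>

fun eval_tree :: "('k, 'q) operad \<Rightarrow> (nat \<Rightarrow> 'a \<Rightarrow> 'q) \<Rightarrow> (nat \<Rightarrow> 'b \<Rightarrow> 'q) \<Rightarrow> ('a, 'b) ltree \<Rightarrow> 'q" where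
  "eval_tree Q \<psi>1 \<psi>2 (Leaf i) = op_id Q"
| "eval_tree Q \<psi>1 \<psi>2 (Black a ts) =
    op_comp Q (map (length \<circ> leaves) ts) (\<psi>1 (length ts) a) (map (eval_tree Q \<psi>1 \<psi>2) ts)"
| "eval_tree Q \<psi>1 \<psi>2 (White b ts) =
    op_comp Q (map (length \<circ> leaves) ts) (\<psi>2 (length ts) b) (map (eval_tree Q \<psi>1 \<psi>2) ts)"

text \<open>
  Evaluation at the vertices of one colour, with \<open>\<psi>\<close> the morphism that is applied to their labels.
\<close>

locale tree_evaluation = vertex_colour P O1 O2 V is_V label inputs vertex + Q: symmetric_operad Q
  for P :: "('k::field, 'c) operad"
    and O1 :: "('k, 'a) operad" and O2 :: "('k, 'b) operad"
    and V :: "'c \<Rightarrow> ('a, 'b) ltree list \<Rightarrow> ('a, 'b) ltree"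
    and is_V :: "('a, 'b) ltree \<Rightarrow> bool"
    and label :: "('a, 'b) ltree \<Rightarrow> 'c"
    and inputs :: "('a, 'b) ltree \<Rightarrow> ('a, 'b) ltree list"
    and vertex :: "'c \<Rightarrow> ('a, 'b) ltree list \<Rightarrow> ('a, 'b) ltree"
    and Q :: "('k, 'q) operad" +
  fixes \<psi> :: "nat \<Rightarrow> 'c \<Rightarrow> 'q" and ev :: "('a, 'b) ltree \<Rightarrow> 'q"
  assumes \<psi>: "operad_morphism P Q \<psi>"
    and ev_Leaf: "ev (Leaf i) = op_id Q"
    and ev_V: "ev (V a ts) = op_comp Q (map (length \<circ> leaves) ts) (\<psi> (length ts) a) (map ev ts)"
begin

abbreviation evaluable :: "('a, 'b) ltree \<Rightarrow> bool" where
  "evaluable t \<equiv> 1 \<le> length (leaves t) \<and> ev t \<in> op_carrier Q (length (leaves t))"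

lemma \<psi>_closed: "\<lbrakk>1 \<le> n; a \<in> op_carrier P n\<rbrakk> \<Longrightarrow> \<psi> n a \<in> op_carrier Q n"
  and \<psi>_act: "\<lbrakk>1 \<le> n; a \<in> op_carrier P n; \<sigma> permutes {..<n}\<rbrakk> \<Longrightarrow>
    \<psi> n (op_act P n \<sigma> a) = op_act Q n \<sigma> (\<psi> n a)"
  and \<psi>_comp: "\<lbrakk>arity_list ns; a \<in> op_carrier P (length ns); op_args P ns bs\<rbrakk> \<Longrightarrow>
    \<psi> (sum_list ns) (op_comp P ns a bs) = op_comp Q ns (\<psi> (length ns) a) (map2 \<psi> ns bs)"
  and \<psi>_id: "\<psi> 1 (op_id P) = op_id Q"
  and \<psi>_linear: "\<lbrakk>1 \<le> n; a \<in> op_carrier P n; b \<in> op_carrier P n\<rbrakk> \<Longrightarrow>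
    \<psi> n ((c \<odot>\<^bsub>op_space P n\<^esub> a) \<oplus>\<^bsub>op_space P n\<^esub> (d \<odot>\<^bsub>op_space P n\<^esub> b)) =
      (c \<odot>\<^bsub>op_space Q n\<^esub> \<psi> n a) \<oplus>\<^bsub>op_space Q n\<^esub> (d \<odot>\<^bsub>op_space Q n\<^esub> \<psi> n b)"
  using \<psi> by (auto simp: operad_morphism_def smult_closed)

lemma evaluable_args:
  assumes "us \<noteq> []" "\<And>u. u \<in> set us \<Longrightarrow> evaluable u"
  shows "arity_list (map (length \<circ> leaves) us)" "op_args Q (map (length \<circ> leaves) us) (map ev us)"
  using assms by (auto simp: arity_list_def op_args_def list_all2_map1 list_all2_map2 list_all2_same)

lemma evaluable_V:
  assumes "ts \<noteq> []" "a \<in> op_carrier P (length ts)" "\<And>t. t \<in> set ts \<Longrightarrow> evaluable t"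
  shows "evaluable (V a ts)"
proof -
  have "1 \<le> length ts"
    using assms(1) by (simp add: Suc_le_eq)
  moreover have "1 \<le> sum_list (map (length \<circ> leaves) ts)"
    using assms(1,3) by (cases ts) (auto simp: Suc_le_eq)
  ultimately show ?thesis
    using Q.comp_closed[of "map (length \<circ> leaves) ts" "\<psi> (length ts) a" "map ev ts"]
      evaluable_args[of ts] assms
    by (simp add: ev_V length_concat \<psi>_closed)
qed

text \<open>
  Contracting an edge does not change the value because \<open>\<psi>\<close> preserves compositions and the identity.
\<close>

lemma ev_vertex:
  assumes "us \<noteq> []" "a \<in> op_carrier P (length us)"
    and us: "\<And>u. u \<in> set us \<Longrightarrow> alternating O1 O2 u \<and> evaluable u \<and> (\<forall>v\<in>set (inputs u). evaluable v)"
  shows "ev (vertex a us) = op_comp Q (map (length \<circ> leaves) us) (\<psi> (length us) a) (map ev us)"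
proof -
  let ?n = "length \<circ> inputs" and ?p = "\<lambda>u. map (length \<circ> leaves) (inputs u)"
    and ?y = "\<lambda>u. \<psi> (length (inputs u)) (label u)" and ?z = "\<lambda>u. map ev (inputs u)"
  have alt: "\<And>u. u \<in> set us \<Longrightarrow> alternating O1 O2 u"
    using us by blast
  have one: "1 \<le> length us"
    using assms(1) by (simp add: Suc_le_eq)
  have contract: "sum_list (?p u) = (length \<circ> leaves) u \<and> op_comp Q (?p u) (?y u) (?z u) = ev u"
    if u: "u \<in> set us" for u
  proof (cases "is_V u")
    case True
    then obtain b ts where "u = V b ts"
      using is_V_iff by blast
    then show ?thesis
      by (simp add: ev_V length_concat)
  next
    case False
    then show ?thesis
      using us[OF u] Q.comp_id_left[of "length (leaves u)" "ev u"] \<psi>_id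
      by (simp add: label_other inputs_other)
  qed
  have "map2 \<psi> (map ?n us) (map label us) = map ?y us"
    by (rule nth_equalityI) simp_all
  then have "\<psi> (length (concat (map inputs us))) (op_comp P (map ?n us) a (map label us)) =
      op_comp Q (map ?n us) (\<psi> (length us) a) (map ?y us)"
    using \<psi>_comp[of "map ?n us" a "map label us"] arity_list_inputs[OF assms(1) alt]
      op_args_labels[OF alt] assms(2)
    by (simp add: length_concat_inputs)
  then have "ev (vertex a us) =
      op_comp Q (concat (map ?p us)) (op_comp Q (map ?n us) (\<psi> (length us) a) (map ?y us)) (concat (map ?z us))"
    by (simp add: vertex_eq ev_V map_concat comp_def)
  also have "\<dots> = op_comp Q (map (\<lambda>u. sum_list (?p u)) us) (\<psi> (length us) a)
      (map (\<lambda>u. op_comp Q (?p u) (?y u) (?z u)) us)"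
  proof (rule Q.comp_assoc_map)
    fix u assume u: "u \<in> set us"
    have "inputs u \<noteq> []"
      using length_inputs[OF alt[OF u]] by auto
    from evaluable_args[OF this] us[OF u]
    show "?y u \<in> op_carrier Q (?n u) \<and> length (?p u) = ?n u \<and> arity_list (?p u) \<and> op_args Q (?p u) (?z u)"
      using length_inputs[of u] label_closed[of u] \<psi>_closed[of "length (inputs u)" "label u"] by auto
  qed (use assms one \<psi>_closed in auto)
  also have "\<dots> = op_comp Q (map (length \<circ> leaves) us) (\<psi> (length us) a) (map ev us)"
    using contract by (simp cong: map_cong)
  finally show ?thesis .
qed

text \<open>
  The step at a vertex in the proof that grafting becomes composition of values. Here \<open>g\<close> stands for
  grafting into the inputs \<open>ts\<close> of the vertex, where the claim is assumed.
\<close>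

lemma ev_graft_V:
  assumes "ts \<noteq> []" "a \<in> op_carrier P (length ts)"
    and ts: "\<And>t. t \<in> set ts \<Longrightarrow> evaluable t \<and> alternating O1 O2 (g t) \<and> evaluable (g t) \<and>
      (\<forall>v\<in>set (inputs (g t)). evaluable v) \<and>
      leaves (g t) = concat (map (\<lambda>i. leaves (s i)) (leaves t)) \<and>
      ev (g t) = op_comp Q (map (\<lambda>i. length (leaves (s i))) (leaves t)) (ev t) (map (\<lambda>i. ev (s i)) (leaves t))"
    and s: "\<And>i. i \<in> set (leaves (V a ts)) \<Longrightarrow> evaluable (s i)"
  shows "ev (vertex a (map g ts)) =
    op_comp Q (map (\<lambda>i. length (leaves (s i))) (leaves (V a ts))) (ev (V a ts)) (map (\<lambda>i. ev (s i)) (leaves (V a ts)))"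
proof -
  let ?p = "\<lambda>t. map (\<lambda>i. length (leaves (s i))) (leaves t)" and ?z = "\<lambda>t. map (\<lambda>i. ev (s i)) (leaves t)"
  have "1 \<le> length ts"
    using assms(1) by (simp add: Suc_le_eq)
  then have \<psi>a: "\<psi> (length ts) a \<in> op_carrier Q (length ts)"
    using assms(2) by (rule \<psi>_closed)
  have "ev (vertex a (map g ts)) =
      op_comp Q (map (length \<circ> leaves) (map g ts)) (\<psi> (length (map g ts)) a) (map ev (map g ts))"
    using assms(1,2) ts by (intro ev_vertex) auto
  also have "map (length \<circ> leaves) (map g ts) = map (\<lambda>t. sum_list (?p t)) ts"
    using ts by (simp add: length_concat comp_def)
  also have "map ev (map g ts) = map (\<lambda>t. op_comp Q (?p t) (ev t) (?z t)) ts"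
    using ts by simp
  also have "op_comp Q (map (\<lambda>t. sum_list (?p t)) ts) (\<psi> (length (map g ts)) a)
        (map (\<lambda>t. op_comp Q (?p t) (ev t) (?z t)) ts) =
      op_comp Q (concat (map ?p ts)) (op_comp Q (map (length \<circ> leaves) ts) (\<psi> (length ts) a) (map ev ts))
        (concat (map ?z ts))"
    unfolding length_map
  proof (rule Q.comp_assoc_map[OF assms(1) \<psi>a, symmetric])
    fix t assume t: "t \<in> set ts"
    have "arity_list (?p t)" "op_args Q (?p t) (?z t)"
      using t ts[OF t] s by (auto simp: arity_list_def op_args_def list_all2_map1 list_all2_map2 list_all2_same)
    then show "ev t \<in> op_carrier Q ((length \<circ> leaves) t) \<and> length (?p t) = (length \<circ> leaves) t \<and>
        arity_list (?p t) \<and> op_args Q (?p t) (?z t)"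
      using ts[OF t] by simp
  qed
  finally show ?thesis
    by (simp add: ev_V map_concat comp_def)
qed

lemma ev_linear_V:
  assumes "ts \<noteq> []" "a \<in> op_carrier P (length ts)" "b \<in> op_carrier P (length ts)"
    and "\<And>t. t \<in> set ts \<Longrightarrow> evaluable t"
  shows "ev (V ((c \<odot>\<^bsub>op_space P (length ts)\<^esub> a) \<oplus>\<^bsub>op_space P (length ts)\<^esub> (d \<odot>\<^bsub>op_space P (length ts)\<^esub> b)) ts) =
    (c \<odot>\<^bsub>op_space Q (length (leaves (V a ts)))\<^esub> ev (V a ts)) \<oplus>\<^bsub>op_space Q (length (leaves (V a ts)))\<^esub>
      (d \<odot>\<^bsub>op_space Q (length (leaves (V a ts)))\<^esub> ev (V b ts))"
proof -
  have one: "1 \<le> length ts"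
    using assms(1) by (simp add: Suc_le_eq)
  show ?thesis
    using Q.comp_linear_left[OF evaluable_args(1), of ts "\<psi> (length ts) a" "\<psi> (length ts) b" "map ev ts" c d]
      assms evaluable_args(2)[of ts] one
    by (simp add: ev_V \<psi>_linear \<psi>_closed length_concat)
qed

lemma ev_linear_below:
  assumes "a \<in> op_carrier P (length (ls @ t # rs))"
    and "\<And>w. w \<in> {t, u, v} \<union> set ls \<union> set rs \<Longrightarrow> evaluable w"
    and "leaves u = leaves t" "leaves v = leaves t"
    and "ev v = (c \<odot>\<^bsub>op_space Q (length (leaves t))\<^esub> ev t) \<oplus>\<^bsub>op_space Q (length (leaves t))\<^esub>
      (d \<odot>\<^bsub>op_space Q (length (leaves t))\<^esub> ev u)"
  shows "ev (V a (ls @ v # rs)) =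
    (c \<odot>\<^bsub>op_space Q (length (leaves (V a (ls @ t # rs))))\<^esub> ev (V a (ls @ t # rs)))
      \<oplus>\<^bsub>op_space Q (length (leaves (V a (ls @ t # rs))))\<^esub>
    (d \<odot>\<^bsub>op_space Q (length (leaves (V a (ls @ t # rs))))\<^esub> ev (V a (ls @ u # rs)))"
proof -
  let ?n = "map (length \<circ> leaves)"
  have "arity_list (?n (ls @ t # rs))"
    using assms(2) by (intro evaluable_args) auto
  moreover have "op_args Q (?n ls) (map ev ls)" "op_args Q (?n rs) (map ev rs)"
    using assms(2) by (auto simp: op_args_def list_all2_map1 list_all2_map2 list_all2_same)
  moreover have "\<psi> (length (ls @ t # rs)) a \<in> op_carrier Q (length (ls @ t # rs))"
    using assms(1) by (intro \<psi>_closed) simp_all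
  ultimately show ?thesis
    using Q.comp_linear_right[of "?n ls" "length (leaves t)" "?n rs" "\<psi> (length (ls @ t # rs)) a"
        "map ev ls" "map ev rs" "ev t" "ev u" c d] assms(1,3-5) assms(2)[of t] assms(2)[of u]
    by (simp add: ev_V length_concat)
qed

text \<open>
  Reordering inputs changes the planar order of the leaves by a permutation \<open>\<rho>\<close>, and the value by the
  action of the same \<open>\<rho>\<close>. The two changes cancel in the value of a numbered tree.
\<close>

lemma ev_reorder_V:
  assumes "ts \<noteq> []" "a \<in> op_carrier P (length ts)" and \<sigma>: "\<sigma> permutes {..<length ts}"
    and ts: "\<And>t. t \<in> set ts \<Longrightarrow> evaluable t"
  shows "\<exists>\<rho>. \<rho> permutes {..<length (leaves (V (op_act P (length ts) \<sigma> a) ts))} \<and>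
    leaves (V a (permute_list \<sigma> ts)) = permute_list \<rho> (leaves (V (op_act P (length ts) \<sigma> a) ts)) \<and>
    ev (V (op_act P (length ts) \<sigma> a) ts) =
      op_act Q (length (leaves (V (op_act P (length ts) \<sigma> a) ts))) \<rho> (ev (V a (permute_list \<sigma> ts)))"
proof (intro exI conjI)
  let ?n = "map (length \<circ> leaves) ts"
  have one: "1 \<le> length ts"
    using assms(1) by (simp add: Suc_le_eq)
  have len: "length (leaves (V b ts)) = sum_list ?n" for b
    by (simp add: length_concat)
  show "block_perm \<sigma> ?n permutes {..<length (leaves (V (op_act P (length ts) \<sigma> a) ts))}"
    unfolding len using \<sigma> by (intro block_perm_permutes) simp
  show "leaves (V a (permute_list \<sigma> ts)) =
      permute_list (block_perm \<sigma> ?n) (leaves (V (op_act P (length ts) \<sigma> a) ts))"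
    using permute_list_block_perm[of \<sigma> "map leaves ts"] \<sigma> by (simp add: permute_list_map)
  show "ev (V (op_act P (length ts) \<sigma> a) ts) =
      op_act Q (length (leaves (V (op_act P (length ts) \<sigma> a) ts))) (block_perm \<sigma> ?n) (ev (V a (permute_list \<sigma> ts)))"
    using Q.comp_equivariant_left[of ?n "\<psi> (length ts) a" "map ev ts" \<sigma>] evaluable_args[OF assms(1) ts]
      assms(2) \<sigma> one unfolding len
    by (simp add: ev_V \<psi>_act \<psi>_closed permute_list_map)
qed

lemma ev_reorder_below:
  assumes "a \<in> op_carrier P (length (ls @ t # rs))"
    and "\<And>w. w \<in> {t, u} \<union> set ls \<union> set rs \<Longrightarrow> evaluable w"
    and \<rho>: "\<rho> permutes {..<length (leaves t)}" "leaves u = permute_list \<rho> (leaves t)"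
      "ev t = op_act Q (length (leaves t)) \<rho> (ev u)"
  shows "\<exists>\<rho>. \<rho> permutes {..<length (leaves (V a (ls @ t # rs)))} \<and>
    leaves (V a (ls @ u # rs)) = permute_list \<rho> (leaves (V a (ls @ t # rs))) \<and>
    ev (V a (ls @ t # rs)) =
      op_act Q (length (leaves (V a (ls @ t # rs)))) \<rho> (ev (V a (ls @ u # rs)))"
proof (intro exI conjI)
  let ?n = "map (length \<circ> leaves)"
  let ?\<rho> = "block_sum (?n ls @ length (leaves t) # ?n rs)
    (replicate (length ls) id @ \<rho> # replicate (length rs) id)"
  have len: "length (leaves (V a (ls @ t # rs))) = sum_list (?n ls @ length (leaves t) # ?n rs)"
    by (simp add: length_concat)
  show "?\<rho> permutes {..<length (leaves (V a (ls @ t # rs)))}"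
    unfolding len using block_sum_single_permutes[OF \<rho>(1), of "?n ls" "?n rs"] by simp
  show "leaves (V a (ls @ u # rs)) = permute_list ?\<rho> (leaves (V a (ls @ t # rs)))"
    using permute_list_block_sum_single[OF \<rho>(1), of "map leaves ls" "map leaves rs"] by (simp add: \<rho>(2))
  have "arity_list (?n (ls @ t # rs))"
    using assms(2) by (intro evaluable_args) auto
  moreover have "op_args Q (?n ls) (map ev ls)" "op_args Q (?n rs) (map ev rs)"
    using assms(2) by (auto simp: op_args_def list_all2_map1 list_all2_map2 list_all2_same)
  moreover have "\<psi> (length (ls @ t # rs)) a \<in> op_carrier Q (length (ls @ t # rs))"
    using assms(1) by (intro \<psi>_closed) simp_all
  moreover have "length (leaves u) = length (leaves t)"
    using \<rho>(2) by simp
  ultimately show "ev (V a (ls @ t # rs)) =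
      op_act Q (length (leaves (V a (ls @ t # rs)))) ?\<rho> (ev (V a (ls @ u # rs)))"
    unfolding len using assms(2)[of u] \<rho>(1,3)
      Q.comp_act_right[of "?n ls" "length (leaves t)" "?n rs" "\<psi> (length (ls @ t # rs)) a"
        "map ev ls" "map ev rs" "ev u" \<rho>]
    by (simp add: ev_V)
qed

lemma ev_relabel_V:
  assumes "\<And>t. t \<in> set ts \<Longrightarrow> ev (relabel \<sigma> t) = ev t"
  shows "ev (relabel \<sigma> (V a ts)) = ev (V a ts)"
proof -
  have "map ev (map (relabel \<sigma>) ts) = map ev ts"
    using assms by simp
  moreover have "map (length \<circ> leaves) (map (relabel \<sigma>) ts) = map (length \<circ> leaves) ts"
    by (simp add: leaves_relabel)
  ultimately show ?thesis
    unfolding relabel_V ev_V by (simp only: length_map)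
qed

lemma ev_corolla:
  assumes "1 \<le> n" "a \<in> op_carrier P n"
  shows "ev (V a (map Leaf [0..<n])) = \<psi> n a"
  using Q.comp_id_right[OF assms(1) \<psi>_closed[OF assms]]
  by (simp add: ev_V ev_Leaf comp_def map_replicate_const)

end

locale pair_evaluation = operad_pair O1 O2 + Q: symmetric_operad Q
  for O1 :: "('k::field, 'a) operad" and O2 :: "('k, 'b) operad" and Q :: "('k, 'q) operad" +
  fixes \<psi>1 :: "nat \<Rightarrow> 'a \<Rightarrow> 'q" and \<psi>2 :: "nat \<Rightarrow> 'b \<Rightarrow> 'q"
  assumes \<psi>1: "operad_morphism O1 Q \<psi>1" and \<psi>2: "operad_morphism O2 Q \<psi>2"

sublocale pair_evaluation \<subseteq> black_eval: tree_evaluation O1 O1 O2 Black is_Black "black_label O1"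
  black_inputs "black_vertex O1" Q \<psi>1 "eval_tree Q \<psi>1 \<psi>2"
  by unfold_locales (auto simp: \<psi>1)

sublocale pair_evaluation \<subseteq> white_eval: tree_evaluation O2 O1 O2 White is_White "white_label O2"
  white_inputs "white_vertex O2" Q \<psi>2 "eval_tree Q \<psi>1 \<psi>2"
  by unfold_locales (auto simp: \<psi>2)

section \<open>Values of numbered trees\<close>

text \<open>
  The counterpart of \<open>lin\<close> for values in a vector space whose carrier is a set.
\<close>

definition extend_linearly :: "('k::field, 'q) module \<Rightarrow> ('t \<Rightarrow> 'q) \<Rightarrow> ('t \<Rightarrow>\<^sub>0 'k) \<Rightarrow> 'q" where
  "extend_linearly M f x = (\<Oplus>\<^bsub>M\<^esub>t\<in>Poly_Mapping.keys x. Poly_Mapping.lookup x t \<odot>\<^bsub>M\<^esub> f t)"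

lemma
  fixes M :: "('k::field, 'q) module"
  assumes M: "is_vector_space M" and f: "f \<in> A \<rightarrow> carrier M" and x: "Poly_Mapping.keys x \<subseteq> A"
  shows extend_linearly_closed: "extend_linearly M f x \<in> carrier M"
    and extend_linearly_add: "Poly_Mapping.keys y \<subseteq> A \<Longrightarrow>
      extend_linearly M f (x + y) = extend_linearly M f x \<oplus>\<^bsub>M\<^esub> extend_linearly M f y"
    and extend_linearly_scale: "extend_linearly M f (scale c x) = c \<odot>\<^bsub>M\<^esub> extend_linearly M f x"
    and extend_linearly_single: "t \<in> A \<Longrightarrow> extend_linearly M f (Poly_Mapping.single t 1) = f t"
proof -
  interpret M: Module.module "ring_of_type_algebra :: 'k ring" M by (rule M)
  have R: "c \<in> carrier (ring_of_type_algebra :: 'k ring)" for c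
    by (simp add: ring_of_type_algebra_def)
  have terms: "c \<odot>\<^bsub>M\<^esub> f t \<in> carrier M" if "t \<in> A" for c t
    using f that R by (intro M.smult_closed) auto
  have zero: "0 \<odot>\<^bsub>M\<^esub> f t = \<zero>\<^bsub>M\<^esub>" if "t \<in> A" for t
    using M.smult_l_null[of "f t"] f that by (auto simp: ring_of_type_algebra_def)
  have superset: "extend_linearly M f z = (\<Oplus>\<^bsub>M\<^esub>t\<in>B. Poly_Mapping.lookup z t \<odot>\<^bsub>M\<^esub> f t)"
    if "finite B" "Poly_Mapping.keys z \<subseteq> B" "B \<subseteq> A" for z B
    unfolding extend_linearly_def
  proof (rule M.add.finprod_mono_neutral_cong_left[OF that(1,2)])
    show "Poly_Mapping.lookup z t \<odot>\<^bsub>M\<^esub> f t = \<zero>\<^bsub>M\<^esub>" if "t \<in> B - Poly_Mapping.keys z" for t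
      using that \<open>B \<subseteq> A\<close> zero by (auto simp: in_keys_iff)
  qed (use that terms in auto)
  show "extend_linearly M f x \<in> carrier M"
    unfolding extend_linearly_def using x terms by (intro M.finsum_closed) auto
  show "extend_linearly M f (x + y) = extend_linearly M f x \<oplus>\<^bsub>M\<^esub> extend_linearly M f y"
    if y: "Poly_Mapping.keys y \<subseteq> A"
  proof -
    let ?B = "Poly_Mapping.keys x \<union> Poly_Mapping.keys y"
    have B: "finite ?B" "?B \<subseteq> A"
      using x y by auto
    have "extend_linearly M f (x + y) =
        (\<Oplus>\<^bsub>M\<^esub>t\<in>?B. (Poly_Mapping.lookup x t \<odot>\<^bsub>M\<^esub> f t) \<oplus>\<^bsub>M\<^esub> (Poly_Mapping.lookup y t \<odot>\<^bsub>M\<^esub> f t))"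
    proof (subst superset[OF B(1) _ B(2)])
      show "Poly_Mapping.keys (x + y) \<subseteq> ?B"
        by (rule Poly_Mapping.keys_add)
      have "(c + d) \<odot>\<^bsub>M\<^esub> f t = (c \<odot>\<^bsub>M\<^esub> f t) \<oplus>\<^bsub>M\<^esub> (d \<odot>\<^bsub>M\<^esub> f t)" if "t \<in> A" for c d t
        using M.smult_l_distr[of c d "f t"] f that by (auto simp: ring_of_type_algebra_def)
      then show "(\<Oplus>\<^bsub>M\<^esub>t\<in>?B. Poly_Mapping.lookup (x + y) t \<odot>\<^bsub>M\<^esub> f t) =
          (\<Oplus>\<^bsub>M\<^esub>t\<in>?B. (Poly_Mapping.lookup x t \<odot>\<^bsub>M\<^esub> f t) \<oplus>\<^bsub>M\<^esub> (Poly_Mapping.lookup y t \<odot>\<^bsub>M\<^esub> f t))"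
        using B(2) terms by (intro M.finsum_cong') (auto simp: lookup_add)
    qed
    also have "\<dots> = extend_linearly M f x \<oplus>\<^bsub>M\<^esub> extend_linearly M f y"
      using B terms by (subst M.finsum_addf) (auto simp: superset[of ?B])
    finally show ?thesis .
  qed
  show "extend_linearly M f (scale c x) = c \<odot>\<^bsub>M\<^esub> extend_linearly M f x"
  proof -
    have "extend_linearly M f (scale c x) = (\<Oplus>\<^bsub>M\<^esub>t\<in>Poly_Mapping.keys x. c \<odot>\<^bsub>M\<^esub> (Poly_Mapping.lookup x t \<odot>\<^bsub>M\<^esub> f t))"
    proof (subst superset[of "Poly_Mapping.keys x"])
      show "Poly_Mapping.keys (scale c x) \<subseteq> Poly_Mapping.keys x"
        by (auto simp: in_keys_iff lookup_scale)
      have "(c * d) \<odot>\<^bsub>M\<^esub> f t = c \<odot>\<^bsub>M\<^esub> (d \<odot>\<^bsub>M\<^esub> f t)" if "t \<in> A" for d t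
        using M.smult_assoc1[of c d "f t"] f that by (auto simp: ring_of_type_algebra_def)
      then show "(\<Oplus>\<^bsub>M\<^esub>t\<in>Poly_Mapping.keys x. Poly_Mapping.lookup (scale c x) t \<odot>\<^bsub>M\<^esub> f t) =
          (\<Oplus>\<^bsub>M\<^esub>t\<in>Poly_Mapping.keys x. c \<odot>\<^bsub>M\<^esub> (Poly_Mapping.lookup x t \<odot>\<^bsub>M\<^esub> f t))"
        using x terms R by (intro M.finsum_cong') (auto simp: lookup_scale)
    qed (use x in auto)
    then show ?thesis
      unfolding extend_linearly_def using x terms by (subst M.finsum_smult_ldistr) (auto simp: R)
  qed
  show "extend_linearly M f (Poly_Mapping.single t 1) = f t" if "t \<in> A"
  proof -
    have "f t \<in> carrier M" "1 \<odot>\<^bsub>M\<^esub> f t = f t"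
      using M.smult_one[of "f t"] f that by (auto simp: ring_of_type_algebra_def)
    then show ?thesis
      using that by (simp add: extend_linearly_def)
  qed
qed

lemma block_of_concat_upt:
  assumes "concat xss = [k..<m]" "i < length xss"
  shows "xss ! i = [k + block_start (map length xss) i..<k + block_start (map length xss) i + length (xss ! i)]"
proof (rule nth_equalityI)
  fix j assume "j < length (xss ! i)"
  moreover from this have "block_start (map length xss) i + j < length [k..<m]"
    using block_element_less[of i "map length xss" j] assms by (simp add: length_concat flip: assms(1))
  ultimately show "xss ! i ! j =
      [k + block_start (map length xss) i..<k + block_start (map length xss) i + length (xss ! i)] ! j"
    using nth_concat_block[of i xss j] assms by simp
qed simp

text \<open>
  The permutation \<open>j \<mapsto> xs ! j\<close>, for a list \<open>xs\<close> that enumerates \<open>{..<length xs}\<close>; it is the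
  identity beyond, as \<open>permutes\<close> requires.
\<close>

definition leaf_perm :: "nat list \<Rightarrow> nat \<Rightarrow> nat" where
  "leaf_perm xs j = (if j < length xs then xs ! j else j)"

lemma map_leaf_perm: "map (leaf_perm xs) [0..<length xs] = xs"
  by (rule nth_equalityI) (simp_all add: leaf_perm_def)

lemma leaf_perm_permutes:
  assumes "mset xs = mset [0..<n]"
  shows "leaf_perm xs permutes {..<n}"
proof -
  have "length xs = n"
    using mset_eq_length[OF assms] by simp
  then show ?thesis
    using assms map_leaf_perm[of xs] by (intro permutes_if_mset_map) (simp_all add: leaf_perm_def)
qed

lemma leaf_perm_eqI:
  assumes "f permutes {..<n}" "map f [0..<n] = xs"
  shows "leaf_perm xs = f"
proof
  fix j
  show "leaf_perm xs j = f j"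
    using assms permutes_not_in[OF assms(1), of j] by (auto simp: leaf_perm_def)
qed

lemma leaf_perm_permute_list:
  assumes "\<rho> permutes {..<length xs}"
  shows "leaf_perm (permute_list \<rho> xs) = leaf_perm xs \<circ> \<rho>"
proof
  fix j
  show "leaf_perm (permute_list \<rho> xs) j = (leaf_perm xs \<circ> \<rho>) j"
    using assms permutes_in_image[OF assms, of j] permutes_not_in[OF assms, of j]
    by (auto simp: leaf_perm_def permute_list_nth)
qed

lemma leaf_perm_map:
  assumes "\<sigma> permutes {..<length xs}"
  shows "leaf_perm (map \<sigma> xs) = \<sigma> \<circ> leaf_perm xs"
proof
  fix j
  show "leaf_perm (map \<sigma> xs) j = (\<sigma> \<circ> leaf_perm xs) j"
    using permutes_not_in[OF assms, of j] by (auto simp: leaf_perm_def)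
qed

lemma tree_classes_span:
  fixes O1 :: "('k::field, 'a) operad" and O2 :: "('k, 'b) operad"
  shows "op_carrier (tree_operad O1 O2) n \<subseteq> linear_span (op_space (tree_operad O1 O2) n)
    ((\<lambda>t. tree_class O1 O2 n (single_tree t)) ` alt_trees O1 O2 n)"
proof
  let ?S = "linear_span (op_space (tree_operad O1 O2) n)
    ((\<lambda>t. tree_class O1 O2 n (single_tree t)) ` alt_trees O1 O2 n)"
  let ?X = "{x \<in> formal_trees O1 O2 n. tree_class O1 O2 n x \<in> ?S}"
  note sub = formal.subspace_add[OF subspace_formal_trees] formal.subspace_scale[OF subspace_formal_trees]
    formal.subspace_0[OF subspace_formal_trees]
  fix A assume "A \<in> op_carrier (tree_operad O1 O2) n"
  then obtain x where x: "x \<in> formal_trees O1 O2 n" "A = tree_class O1 O2 n x"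
    using tree_carrier_iff by blast
  have "formal.subspace ?X"
    unfolding formal.subspace_def
  proof (intro conjI ballI allI)
    show "0 \<in> ?X"
      using linear_span.zero[of "op_space (tree_operad O1 O2) n"] by (simp add: sub tree_zero)
    show "y + z \<in> ?X" if "y \<in> ?X" "z \<in> ?X" for y z
      using that linear_span.add[of "tree_class O1 O2 n y" "op_space (tree_operad O1 O2) n" _ "tree_class O1 O2 n z"]
      by (simp add: sub tree_add)
    show "scale c y \<in> ?X" if "y \<in> ?X" for c y
      using that linear_span.smult[of "tree_class O1 O2 n y" "op_space (tree_operad O1 O2) n" _ c]
      by (simp add: sub tree_smult)
  qed
  moreover have "single_tree t \<in> ?X" if "t \<in> Poly_Mapping.keys x" for t
    using formal_treesD[OF x(1) that] by (auto intro: single_tree_formal linear_span.base)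
  ultimately have "lin single_tree x \<in> ?X"
    by (rule lin_in_subspace)
  then show "A \<in> ?S"
    by (simp add: lin_ident x)
qed

context pair_evaluation
begin

abbreviation ev :: "('a, 'b) ltree \<Rightarrow> 'q" where
  "ev \<equiv> eval_tree Q \<psi>1 \<psi>2"

lemma alternating_evaluable: "alternating O1 O2 t \<Longrightarrow> black_eval.evaluable t"
proof (induction t)
  case (Leaf i)
  then show ?case using Q.id_closed by simp
next
  case (Black a ts)
  then show ?case by (intro black_eval.evaluable_V) auto
next
  case (White b ts)
  then show ?case by (intro white_eval.evaluable_V) auto
qed

lemma eval_relabel: "ev (relabel \<sigma> t) = ev t"
proof (induction t)
  case (Black a ts)
  then show ?case by (intro black_eval.ev_relabel_V)
next
  case (White b ts)
  then show ?case by (intro white_eval.ev_relabel_V)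
qed simp

lemma eval_graft:
  "\<lbrakk>alternating O1 O2 t; \<forall>i\<in>set (leaves t). alternating O1 O2 (s i)\<rbrakk> \<Longrightarrow>
    ev (graft O1 O2 s t) =
      op_comp Q (map (\<lambda>i. length (leaves (s i))) (leaves t)) (ev t) (map (\<lambda>i. ev (s i)) (leaves t))"
proof (induction t)
  case (Leaf i)
  then show ?case
    using alternating_evaluable[of "s i"] by (simp add: Q.comp_id_left)
next
  case (Black a ts)
  show ?case
    unfolding graft.simps
  proof (rule black_eval.ev_graft_V)
    fix t assume t: "t \<in> set ts"
    have g: "alternating O1 O2 (graft O1 O2 s t)"
      using Black.prems t by (intro alternating_graft) auto
    have alt: "alternating O1 O2 t" "\<forall>i\<in>set (leaves t). alternating O1 O2 (s i)"
      using Black.prems t by auto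
    have v: "\<forall>v\<in>set (black_inputs (graft O1 O2 s t)). black_eval.evaluable v"
      using black.inputs_alternating[OF g] alternating_evaluable by blast
    show "black_eval.evaluable t \<and> alternating O1 O2 (graft O1 O2 s t) \<and>
        black_eval.evaluable (graft O1 O2 s t) \<and> (\<forall>v\<in>set (black_inputs (graft O1 O2 s t)). black_eval.evaluable v) \<and>
        leaves (graft O1 O2 s t) = concat (map (\<lambda>i. leaves (s i)) (leaves t)) \<and>
        ev (graft O1 O2 s t) =
          op_comp Q (map (\<lambda>i. length (leaves (s i))) (leaves t)) (ev t) (map (\<lambda>i. ev (s i)) (leaves t))"
      using alternating_evaluable[OF alt(1)] g alternating_evaluable[OF g] v leaves_graft[of s t]
        Black.IH[OF t alt] by blast
  next
    fix i assume "i \<in> set (leaves (Black a ts))"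
    then show "black_eval.evaluable (s i)"
      using Black.prems(2) alternating_evaluable by blast
  qed (use Black.prems in auto)
next
  case (White b ts)
  show ?case
    unfolding graft.simps
  proof (rule white_eval.ev_graft_V)
    fix t assume t: "t \<in> set ts"
    have g: "alternating O1 O2 (graft O1 O2 s t)"
      using White.prems t by (intro alternating_graft) auto
    have alt: "alternating O1 O2 t" "\<forall>i\<in>set (leaves t). alternating O1 O2 (s i)"
      using White.prems t by auto
    have v: "\<forall>v\<in>set (white_inputs (graft O1 O2 s t)). white_eval.evaluable v"
      using white.inputs_alternating[OF g] alternating_evaluable by blast
    show "white_eval.evaluable t \<and> alternating O1 O2 (graft O1 O2 s t) \<and>
        white_eval.evaluable (graft O1 O2 s t) \<and> (\<forall>v\<in>set (white_inputs (graft O1 O2 s t)). white_eval.evaluable v) \<and>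
        leaves (graft O1 O2 s t) = concat (map (\<lambda>i. leaves (s i)) (leaves t)) \<and>
        ev (graft O1 O2 s t) =
          op_comp Q (map (\<lambda>i. length (leaves (s i))) (leaves t)) (ev t) (map (\<lambda>i. ev (s i)) (leaves t))"
      using alternating_evaluable[OF alt(1)] g alternating_evaluable[OF g] v leaves_graft[of s t]
        White.IH[OF t alt] by blast
  next
    fix i assume "i \<in> set (leaves (White b ts))"
    then show "white_eval.evaluable (s i)"
      using White.prems(2) alternating_evaluable by blast
  qed (use White.prems in auto)
qed

lemma eval_linear:
  "\<lbrakk>vertex_linear O1 O2 c d t u v; \<forall>w\<in>{t, u, v}. alternating O1 O2 w\<rbrakk> \<Longrightarrow>
    leaves u = leaves t \<and> leaves v = leaves t \<and>
    ev v = (c \<odot>\<^bsub>op_space Q (length (leaves t))\<^esub> ev t) \<oplus>\<^bsub>op_space Q (length (leaves t))\<^esub>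
      (d \<odot>\<^bsub>op_space Q (length (leaves t))\<^esub> ev u)"
proof (induction rule: vertex_linear.induct)
  case (black V ts a b)
  then show ?case
    using black_eval.ev_linear_V[of ts a b c d] alternating_evaluable by force
next
  case (white V ts a b)
  then show ?case
    using white_eval.ev_linear_V[of ts a b c d] alternating_evaluable by force
next
  case (below_black t u v e ls rs)
  have "black_eval.evaluable w" if "w \<in> {t, u, v} \<union> set ls \<union> set rs" for w
    using that below_black.prems by (intro alternating_evaluable) auto
  then show ?case
    using below_black black_eval.ev_linear_below[of e ls t rs u v c d] by simp
next
  case (below_white t u v e ls rs)
  have "white_eval.evaluable w" if "w \<in> {t, u, v} \<union> set ls \<union> set rs" for w
    using that below_white.prems by (intro alternating_evaluable) auto
  then show ?case
    using below_white white_eval.ev_linear_below[of e ls t rs u v c d] by simp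
qed

lemma eval_reorder:
  "\<lbrakk>vertex_reorder O1 O2 t u; \<forall>w\<in>{t, u}. alternating O1 O2 w\<rbrakk> \<Longrightarrow>
    \<exists>\<rho>. \<rho> permutes {..<length (leaves t)} \<and> leaves u = permute_list \<rho> (leaves t) \<and>
      ev t = op_act Q (length (leaves t)) \<rho> (ev u)"
proof (induction rule: vertex_reorder.induct)
  case (black \<sigma> ts a)
  then show ?case
    using alternating_evaluable by (intro black_eval.ev_reorder_V) auto
next
  case (white \<sigma> ts b)
  then show ?case
    using alternating_evaluable by (intro white_eval.ev_reorder_V) auto
next
  case (below_black t u e ls rs)
  have "black_eval.evaluable w" if "w \<in> {t, u} \<union> set ls \<union> set rs" for w
    using that below_black.prems by (intro alternating_evaluable) auto
  with below_black show ?case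
    using black_eval.ev_reorder_below[of e ls t rs u] by auto
next
  case (below_white t u e ls rs)
  have "white_eval.evaluable w" if "w \<in> {t, u} \<union> set ls \<union> set rs" for w
    using that below_white.prems by (intro alternating_evaluable) auto
  with below_white show ?case
    using white_eval.ev_reorder_below[of e ls t rs u] by auto
qed

text \<open>
  With the convention that \<open>(\<sigma> x)(v\<^sub>0, \<dots>, v\<^bsub>n-1\<^esub>) = x(v\<^bsub>\<sigma>(0)\<^esub>, \<dots>, v\<^bsub>\<sigma>(n-1)\<^esub>)\<close>, the \<open>j\<close>-th leaf in planar order has to
  receive the variable whose index is the number of that leaf.
\<close>

definition tree_value :: "nat \<Rightarrow> ('a, 'b) ltree \<Rightarrow> 'q" where
  "tree_value n t = op_act Q n (leaf_perm (leaves t)) (ev t)"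

lemma alt_trees_leaf_perm: "t \<in> alt_trees O1 O2 n \<Longrightarrow> leaf_perm (leaves t) permutes {..<n}"
  by (intro leaf_perm_permutes) (simp add: alt_trees_iff_mset)

lemma alt_trees_eval:
  assumes "t \<in> alt_trees O1 O2 n"
  shows "1 \<le> n" "ev t \<in> op_carrier Q n"
  using alternating_evaluable[OF alt_trees_alternating[OF assms]] alt_trees_length_leaves[OF assms] by auto

lemma tree_value_closed: "t \<in> alt_trees O1 O2 n \<Longrightarrow> tree_value n t \<in> op_carrier Q n"
  unfolding tree_value_def using alt_trees_eval by (intro Q.act_closed alt_trees_leaf_perm) auto

lemma tree_value_linear:
  assumes "vertex_linear O1 O2 c d t u v" "{t, u, v} \<subseteq> alt_trees O1 O2 n"
  shows "tree_value n v =
    (c \<odot>\<^bsub>op_space Q n\<^esub> tree_value n t) \<oplus>\<^bsub>op_space Q n\<^esub> (d \<odot>\<^bsub>op_space Q n\<^esub> tree_value n u)"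
proof -
  have t: "t \<in> alt_trees O1 O2 n" and u: "u \<in> alt_trees O1 O2 n"
    using assms(2) by auto
  have "leaves u = leaves t \<and> leaves v = leaves t \<and>
      ev v = (c \<odot>\<^bsub>op_space Q n\<^esub> ev t) \<oplus>\<^bsub>op_space Q n\<^esub> (d \<odot>\<^bsub>op_space Q n\<^esub> ev u)"
    using eval_linear[OF assms(1)] assms(2) alt_trees_alternating[of _ O1 O2 n]
    by (simp add: alt_trees_length_leaves[OF t])
  then show ?thesis
    using alt_trees_eval[OF t] alt_trees_eval(2)[OF u] alt_trees_leaf_perm[OF t]
    by (simp add: tree_value_def Q.act_add Q.act_smult Q.smult_closed)
qed

lemma tree_value_reorder:
  assumes "vertex_reorder O1 O2 t u" "{t, u} \<subseteq> alt_trees O1 O2 n"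
  shows "tree_value n t = tree_value n u"
proof -
  have t: "t \<in> alt_trees O1 O2 n" and u: "u \<in> alt_trees O1 O2 n"
    using assms(2) by auto
  obtain \<rho> where "\<rho> permutes {..<n}" "leaves u = permute_list \<rho> (leaves t)" "ev t = op_act Q n \<rho> (ev u)"
    using eval_reorder[OF assms(1)] assms(2) by (auto simp: alt_trees_alternating alt_trees_length_leaves[OF t])
  then show ?thesis
    using alt_trees_eval[OF u] alt_trees_leaf_perm[OF t] alt_trees_length_leaves[OF t]
    by (simp add: tree_value_def leaf_perm_permute_list Q.act_compose)
qed

lemma tree_value_relabel:
  assumes "t \<in> alt_trees O1 O2 n" "\<sigma> permutes {..<n}"
  shows "tree_value n (relabel \<sigma> t) = op_act Q n \<sigma> (tree_value n t)"
  using assms alt_trees_eval[OF assms(1)] alt_trees_leaf_perm[OF assms(1)] alt_trees_length_leaves[OF assms(1)]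
  by (simp add: tree_value_def leaves_relabel eval_relabel leaf_perm_map Q.act_compose)

text \<open>
  The order of the leaves of a composite: the trees \<open>ts\<close> are visited in the order of the leaves of \<open>t\<close>, and
  the leaves of each of them in its own order.
\<close>

lemma leaf_perm_tree_comp:
  assumes t: "t \<in> alt_trees O1 O2 (length ns)" and ts: "alt_forest O1 O2 ns ts"
  shows "leaf_perm (leaves (tree_comp O1 O2 ns t ts)) =
    block_sum ns (map (leaf_perm \<circ> leaves) ts) \<circ> block_perm (leaf_perm (leaves t)) ns"
proof (rule leaf_perm_eqI[where n = "sum_list ns"])
  let ?\<pi> = "leaf_perm (leaves t)" and ?\<tau>s = "map (leaf_perm \<circ> leaves) ts"
  note \<pi> = alt_trees_leaf_perm[OF t]
  have \<pi>_less: "?\<pi> i < length ns" if "i < length ns" for i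
    using permutes_in_image[OF \<pi>] that by simp
  have len: "length ts = length ns"
    using ts by (simp add: list_all2_lengthD)
  have leaves_i: "length (leaves (ts ! i)) = ns ! i" if "i < length ns" for i
    using list_all2_nthD[OF ts that] by (rule alt_trees_length_leaves)
  have \<tau>s: "list_all2 (\<lambda>n \<tau>. \<tau> permutes {..<n}) ns ?\<tau>s"
    using ts by (auto simp: list_all2_conv_all_nth alt_trees_leaf_perm)
  show "block_sum ns ?\<tau>s \<circ> block_perm ?\<pi> ns permutes {..<sum_list ns}"
    by (intro permutes_compose block_perm_permutes block_sum_permutes \<pi> \<tau>s)
  have "map (block_sum ns ?\<tau>s \<circ> block_perm ?\<pi> ns) [0..<sum_list ns] =
      concat (map (\<lambda>i. map (\<lambda>k. block_sum ns ?\<tau>s (block_start ns (?\<pi> i) + k)) [0..<ns ! ?\<pi> i]) [0..<length ns])"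
    using map_block_perm[OF \<pi>, of "block_sum ns ?\<tau>s"] by (simp add: comp_def)
  also have "\<dots> = concat (map (\<lambda>i. map (\<lambda>j. block_start ns (?\<pi> i) + j) (leaves (ts ! ?\<pi> i))) [0..<length ns])"
  proof (rule arg_cong[of _ _ concat], rule map_cong[OF refl])
    fix i assume "i \<in> set [0..<length ns]"
    then have i: "?\<pi> i < length ns"
      using \<pi>_less by simp
    have "block_sum ns ?\<tau>s (block_start ns (?\<pi> i) + k) = block_start ns (?\<pi> i) + leaves (ts ! ?\<pi> i) ! k"
      if "k < ns ! ?\<pi> i" for k
      using i that by (simp add: block_sum_element len leaf_perm_def[of "leaves (ts ! _)"] leaves_i)
    then show "map (\<lambda>k. block_sum ns ?\<tau>s (block_start ns (?\<pi> i) + k)) [0..<ns ! ?\<pi> i] =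
        map (\<lambda>j. block_start ns (?\<pi> i) + j) (leaves (ts ! ?\<pi> i))"
      by (intro nth_equalityI) (simp_all add: leaves_i[OF i])
  qed
  also have "\<dots> = concat (map (\<lambda>i. map (\<lambda>j. block_start ns i + j) (leaves (ts ! i))) (map ?\<pi> [0..<length ns]))"
    by (simp add: comp_def)
  also have "map ?\<pi> [0..<length ns] = leaves t"
    using map_leaf_perm[of "leaves t"] by (simp add: alt_trees_length_leaves[OF t])
  finally show "map (block_sum ns ?\<tau>s \<circ> block_perm ?\<pi> ns) [0..<sum_list ns] = leaves (tree_comp O1 O2 ns t ts)"
    by (simp only: tree_comp_def leaves_graft leaves_relabel)
qed

text \<open>
  The permutations produced by the two equivariance laws of \<open>Q\<close> combine to that of
  \<open>leaf_perm_tree_comp\<close>.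
\<close>

lemma tree_value_tree_comp:
  assumes ns: "arity_list ns" and t: "t \<in> alt_trees O1 O2 (length ns)" and ts: "alt_forest O1 O2 ns ts"
  shows "tree_value (sum_list ns) (tree_comp O1 O2 ns t ts) =
    op_comp Q ns (tree_value (length ns) t) (map2 tree_value ns ts)"
proof -
  let ?\<pi> = "leaf_perm (leaves t)" and ?\<tau>s = "map (leaf_perm \<circ> leaves) ts"
  note \<pi> = alt_trees_leaf_perm[OF t] and t_eval = alt_trees_eval[OF t]
  have len: "length ts = length ns"
    using ts by (simp add: list_all2_lengthD)
  have leaves_t: "leaves t = map ?\<pi> [0..<length ns]"
    using map_leaf_perm[of "leaves t"] by (simp add: alt_trees_length_leaves[OF t])
  have \<pi>_less: "?\<pi> i < length ns" if "i < length ns" for i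
    using permutes_in_image[OF \<pi>] that by simp
  have leaves_i: "length (leaves (ts ! i)) = ns ! i" if "i < length ns" for i
    using list_all2_nthD[OF ts that] by (rule alt_trees_length_leaves)
  have \<tau>s: "list_all2 (\<lambda>n \<tau>. \<tau> permutes {..<n}) ns ?\<tau>s"
    using ts by (auto simp: list_all2_conv_all_nth alt_trees_leaf_perm)
  have args: "op_args Q ns (map ev ts)"
    using ts by (auto simp: op_args_def list_all2_map2 elim!: list_all2_mono intro: alt_trees_eval)
  have sum: "1 \<le> sum_list ns"
    using tree_comp_alt_trees[OF t ts] by (rule alt_trees_eval)
  have args': "op_args Q (permute_list ?\<pi> ns) (permute_list ?\<pi> (map ev ts))"
    using args \<pi> by (simp add: op_args_def list_all2_permute_list_iff len)
  have sum': "sum_list (permute_list ?\<pi> ns) = sum_list ns"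
    using mset_permute_list[OF \<pi>] by (metis sum_mset_sum_list)
  have closed: "op_comp Q (permute_list ?\<pi> ns) (ev t) (permute_list ?\<pi> (map ev ts)) \<in> op_carrier Q (sum_list ns)"
    using Q.comp_closed[OF _ _ args', of "ev t"] ns t_eval \<pi> by (simp add: sum' arity_list_def) (simp flip: length_greater_0_conv)
  have "ev (tree_comp O1 O2 ns t ts) =
      op_comp Q (map (\<lambda>i. length (leaves (ts ! i))) (leaves t)) (ev t) (map (\<lambda>i. ev (ts ! i)) (leaves t))"
    unfolding tree_comp_def using t slot_alternating[OF ts] alt_trees_set_leaves[OF t]
    by (subst eval_graft) (auto simp: alt_trees_alternating leaves_relabel eval_relabel)
  also have "map (\<lambda>i. length (leaves (ts ! i))) (leaves t) = permute_list ?\<pi> ns"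
    unfolding leaves_t[THEN arg_cong, of "map _"] by (simp add: permute_list_def \<pi>_less leaves_i)
  also have "map (\<lambda>i. ev (ts ! i)) (leaves t) = permute_list ?\<pi> (map ev ts)"
    unfolding leaves_t[THEN arg_cong, of "map _"] by (simp add: permute_list_def \<pi>_less len)
  finally have "tree_value (sum_list ns) (tree_comp O1 O2 ns t ts) =
      op_act Q (sum_list ns) (block_sum ns ?\<tau>s \<circ> block_perm ?\<pi> ns)
        (op_comp Q (permute_list ?\<pi> ns) (ev t) (permute_list ?\<pi> (map ev ts)))"
    by (simp add: tree_value_def leaf_perm_tree_comp[OF t ts])
  also have "\<dots> = op_act Q (sum_list ns) (block_sum ns ?\<tau>s)
      (op_comp Q ns (op_act Q (length ns) ?\<pi> (ev t)) (map ev ts))"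
    using Q.comp_equivariant_left[OF ns t_eval(2) args \<pi>]
      Q.act_compose[OF sum block_perm_permutes[OF \<pi>] block_sum_permutes[OF \<tau>s] closed] by simp
  also have "\<dots> = op_comp Q ns (tree_value (length ns) t)
      (map (\<lambda>i. op_act Q (ns ! i) (?\<tau>s ! i) (map ev ts ! i)) [0..<length ns])"
    using Q.comp_equivariant_right[OF ns Q.act_closed[OF t_eval(1) \<pi> t_eval(2)] args \<tau>s]
    by (simp add: tree_value_def)
  also have "map (\<lambda>i. op_act Q (ns ! i) (?\<tau>s ! i) (map ev ts ! i)) [0..<length ns] = map2 tree_value ns ts"
    by (rule nth_equalityI) (simp_all add: len tree_value_def)
  finally show ?thesis .
qed

end

section \<open>The induced morphism\<close>

context pair_evaluation
begin

definition formal_value :: "nat \<Rightarrow> (('a, 'b) ltree \<Rightarrow>\<^sub>0 'k) \<Rightarrow> 'q" where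
  "formal_value n x = extend_linearly (op_space Q n) (tree_value n) x"

lemma
  assumes n: "1 \<le> n" and x: "x \<in> formal_trees O1 O2 n"
  shows formal_value_closed: "formal_value n x \<in> op_carrier Q n"
    and formal_value_add: "y \<in> formal_trees O1 O2 n \<Longrightarrow>
      formal_value n (x + y) = formal_value n x \<oplus>\<^bsub>op_space Q n\<^esub> formal_value n y"
    and formal_value_scale: "formal_value n (scale c x) = c \<odot>\<^bsub>op_space Q n\<^esub> formal_value n x"
proof -
  have f: "tree_value n \<in> alt_trees O1 O2 n \<rightarrow> op_carrier Q n"
    by (simp add: tree_value_closed)
  show "formal_value n x \<in> op_carrier Q n"
    "y \<in> formal_trees O1 O2 n \<Longrightarrow> formal_value n (x + y) = formal_value n x \<oplus>\<^bsub>op_space Q n\<^esub> formal_value n y"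
    "formal_value n (scale c x) = c \<odot>\<^bsub>op_space Q n\<^esub> formal_value n x"
    using x extend_linearly_closed[OF Q.space[OF n] f] extend_linearly_add[OF Q.space[OF n] f]
      extend_linearly_scale[OF Q.space[OF n] f]
    by (simp_all add: formal_value_def formal_trees_def)
qed

lemma formal_value_single:
  assumes "t \<in> alt_trees O1 O2 n"
  shows "formal_value n (single_tree t) = tree_value n t"
proof -
  have "tree_value n \<in> alt_trees O1 O2 n \<rightarrow> op_carrier Q n"
    by (simp add: tree_value_closed)
  from extend_linearly_single[OF Q.space this _ assms, of 0] show ?thesis
    using alt_trees_eval(1)[OF assms] by (simp add: formal_value_def)
qed

lemma formal_value_diff_zero_iff:
  assumes n: "1 \<le> n" and x: "x \<in> formal_trees O1 O2 n" and y: "y \<in> formal_trees O1 O2 n"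
  shows "formal_value n (x - y) = \<zero>\<^bsub>op_space Q n\<^esub> \<longleftrightarrow> formal_value n x = formal_value n y"
proof -
  note sub = formal.subspace_diff[OF subspace_formal_trees] formal.subspace_scale[OF subspace_formal_trees]
  note closed = formal_value_closed[OF n]
  interpret M: Module.module "ring_of_type_algebra :: 'k ring" "op_space Q n"
    by (rule Q.space[OF n])
  have "formal_value n x = formal_value n (x - y) \<oplus>\<^bsub>op_space Q n\<^esub> formal_value n y"
    using formal_value_add[OF n sub(1)[OF x y] y] by simp
  moreover have "a \<oplus>\<^bsub>op_space Q n\<^esub> b = b \<longleftrightarrow> a = \<zero>\<^bsub>op_space Q n\<^esub>"
    if "a \<in> op_carrier Q n" "b \<in> op_carrier Q n" for a b
    using that by (metis M.M.add.r_cancel_one)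
  ultimately show ?thesis
    using closed[OF sub(1)[OF x y]] closed[OF y] by metis
qed

text \<open>
  Formal combinations of value 0 form a subspace; it contains the relators.
\<close>

lemma formal_value_cong:
  assumes n: "1 \<le> n" and xy: "(x, y) \<in> tree_equiv O1 O2 n"
  shows "formal_value n x = formal_value n y"
proof -
  note sub = formal.subspace_add[OF subspace_formal_trees] formal.subspace_scale[OF subspace_formal_trees]
    formal.subspace_0[OF subspace_formal_trees]
  let ?K = "{z \<in> formal_trees O1 O2 n. formal_value n z = \<zero>\<^bsub>op_space Q n\<^esub>}"
  have "formal_value n (scale 0 0) = \<zero>\<^bsub>op_space Q n\<^esub>"
    using formal_value_scale[OF n, of 0 0] formal_value_closed[OF n, of 0] sub(3) Q.smult_0[OF n] by metis
  then have "formal.subspace ?K"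
    using sub Q.smult_zero[OF n] Q.add_0[OF n Q.zero_closed[OF n]]
    by (auto simp: formal.subspace_def formal_value_add[OF n] formal_value_scale[OF n])
  moreover have "r \<in> ?K" if r: "r \<in> tree_relators O1 O2 n" for r
  proof -
    have closed: "r \<in> formal_trees O1 O2 n"
      using formal.span_base[OF r] span_tree_relators_formal by blast
    consider c d t u v where "r = single_tree v - (scale c (single_tree t) + scale d (single_tree u))"
        "vertex_linear O1 O2 c d t u v" "{t, u, v} \<subseteq> alt_trees O1 O2 n"
      | t u where "r = single_tree t - single_tree u" "vertex_reorder O1 O2 t u" "{t, u} \<subseteq> alt_trees O1 O2 n"
      using r unfolding tree_relators_def by blast
    then have "formal_value n r = \<zero>\<^bsub>op_space Q n\<^esub>"
    proof cases
      case (1 c d t u v)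
      then have formal: "single_tree t \<in> formal_trees O1 O2 n" "single_tree u \<in> formal_trees O1 O2 n"
        "single_tree v \<in> formal_trees O1 O2 n"
        by (auto intro: single_tree_formal)
      have "formal_value n (scale c (single_tree t) + scale d (single_tree u)) = formal_value n (single_tree v)"
        using 1 formal tree_value_linear[OF 1(2,3)]
        by (simp add: formal_value_add[OF n] formal_value_scale[OF n] sub formal_value_single)
      then show ?thesis
        unfolding 1(1) formal_value_diff_zero_iff[OF n formal(3) sub(1)[OF sub(2)[OF formal(1)] sub(2)[OF formal(2)]]]
        by (rule sym)
    next
      case (2 t u)
      then show ?thesis
        using tree_value_reorder[OF 2(2,3)] formal_value_diff_zero_iff[OF n, of "single_tree t" "single_tree u"]
        by (simp add: single_tree_formal formal_value_single)
    qed
    with closed show ?thesis by simp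
  qed
  then have "tree_relators O1 O2 n \<subseteq> ?K" by blast
  ultimately have "formal.span (tree_relators O1 O2 n) \<subseteq> ?K"
    by (intro formal.span_minimal)
  then show ?thesis
    using xy formal_value_diff_zero_iff[OF n] by (auto simp: tree_equiv_def)
qed

text \<open>
  All representatives of a class have the same value.
\<close>

definition induced :: "nat \<Rightarrow> (('a, 'b) ltree \<Rightarrow>\<^sub>0 'k) set \<Rightarrow> 'q" where
  "induced n A = the_elem (formal_value n ` A)"

lemma induced_class:
  assumes "1 \<le> n" "x \<in> formal_trees O1 O2 n"
  shows "induced n (tree_class O1 O2 n x) = formal_value n x"
proof -
  have "formal_value n ` tree_class O1 O2 n x = (\<lambda>_. formal_value n x) ` tree_class O1 O2 n x"
  proof (rule image_cong[OF refl])
    fix y assume "y \<in> tree_class O1 O2 n x"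
    then show "formal_value n y = formal_value n x"
      by (intro formal_value_cong[OF assms(1), symmetric]) simp
  qed
  also have "\<dots> = {formal_value n x}"
    by (rule image_constant[OF equiv_class_self[OF equiv_tree_equiv assms(2)]])
  finally show ?thesis
    by (simp add: induced_def)
qed

lemma induced_single:
  assumes "t \<in> alt_trees O1 O2 n"
  shows "induced n (tree_class O1 O2 n (single_tree t)) = tree_value n t"
  using assms alt_trees_eval(1)[OF assms] by (simp add: induced_class single_tree_formal formal_value_single)

lemma induced_linear: "graded_linear (tree_operad O1 O2) Q induced"
proof (intro allI impI)
  note sub = formal.subspace_add[OF subspace_formal_trees] formal.subspace_scale[OF subspace_formal_trees]
  fix n :: nat assume n: "1 \<le> n"
  have rep: "\<exists>x. x \<in> formal_trees O1 O2 n \<and> A = tree_class O1 O2 n x"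
    if "A \<in> op_carrier (tree_operad O1 O2) n" for A
    using that tree_carrier_iff by blast
  show "linear_map (op_space (tree_operad O1 O2) n) (op_space Q n) (induced n)"
    unfolding linear_map_def
    by (auto dest!: rep simp: tree_add tree_smult sub induced_class[OF n] formal_value_add[OF n]
        formal_value_scale[OF n] formal_value_closed[OF n])
qed

lemma induced_morphism: "operad_morphism (tree_operad O1 O2) Q induced"
proof -
  let ?T = "tree_operad O1 O2"
  interpret T: symmetric_operad ?T
    by (rule symmetric_operad_tree_operad)
  let ?G = "\<lambda>n. (\<lambda>t. tree_class O1 O2 n (single_tree t)) ` alt_trees O1 O2 n"
  have G: "?G n \<subseteq> op_carrier ?T n" for n
    by (auto intro: tree_class_carrier single_tree_formal)
  have act: "induced n (op_act ?T n \<sigma> A) = op_act Q n \<sigma> (induced n A)"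
    if n: "1 \<le> n" and \<sigma>: "\<sigma> permutes {..<n}" and A: "A \<in> op_carrier ?T n" for n \<sigma> A
  proof (rule linear_map_eq_by_spanning[OF T.symmetric_operad_axioms Q.symmetric_operad_axioms n _ _ G tree_classes_span _ A])
    have lin: "linear_map (op_space ?T n) (op_space Q n) (induced n)"
      using induced_linear n by blast
    then show "linear_map (op_space ?T n) (op_space Q n) (\<lambda>A. induced n (op_act ?T n \<sigma> A))"
      and "linear_map (op_space ?T n) (op_space Q n) (\<lambda>A. op_act Q n \<sigma> (induced n A))"
      by (simp_all add: linear_map_def T.act_closed[OF n \<sigma>] T.act_add[OF n \<sigma>] T.act_smult[OF n \<sigma>]
          Q.act_closed[OF n \<sigma>] Q.act_add[OF n \<sigma>] Q.act_smult[OF n \<sigma>])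
    fix B assume "B \<in> ?G n"
    then obtain t where "t \<in> alt_trees O1 O2 n" "B = tree_class O1 O2 n (single_tree t)" by blast
    then show "induced n (op_act ?T n \<sigma> B) = op_act Q n \<sigma> (induced n B)"
      using \<sigma> by (simp add: tree_act single_tree_formal relabel_ext_lin induced_single relabel_alt_trees tree_value_relabel)
  qed
  have comp: "induced (sum_list ns) (op_comp ?T ns A Bs) = op_comp Q ns (induced (length ns) A) (map2 induced ns Bs)"
    if ns: "arity_list ns" and A: "A \<in> ?G (length ns)" and Bs: "list_all2 (\<lambda>n B. B \<in> ?G n) ns Bs" for ns A Bs
  proof -
    obtain t where t: "t \<in> alt_trees O1 O2 (length ns)" "A = tree_class O1 O2 (length ns) (single_tree t)"
      using A by blast
    have "list_all2 (\<lambda>n B. \<exists>t. t \<in> alt_trees O1 O2 n \<and> B = tree_class O1 O2 n (single_tree t)) ns Bs"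
      using Bs by (rule list_all2_mono) blast
    then obtain ts where ts: "alt_forest O1 O2 ns ts" "Bs = map2 (\<lambda>n t. tree_class O1 O2 n (single_tree t)) ns ts"
      by (rule list_all2_choice)
    have "map2 induced ns Bs = map2 tree_value ns ts"
      using ts(1) unfolding ts(2)
      by (intro nth_equalityI) (auto simp: list_all2_conv_all_nth induced_single)
    then show ?thesis
      using t ts(1) tree_comp_alt_trees[OF t(1) ts(1)] tree_value_tree_comp[OF ns t(1) ts(1)]
      by (simp add: t(2) ts(2) tree_operad_comp_single induced_single)
  qed
  have "induced (sum_list ns) (op_comp ?T ns A Bs) = op_comp Q ns (induced (length ns) A) (map2 induced ns Bs)"
    if "arity_list ns" "A \<in> op_carrier ?T (length ns)" "op_args ?T ns Bs" for ns A Bs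
    by (rule preserves_comp_by_spanning[OF T.symmetric_operad_axioms Q.symmetric_operad_axioms
          induced_linear G tree_classes_span comp that])
  moreover have "induced 1 (op_id ?T) = op_id Q"
  proof -
    have "leaf_perm [0] = id"
      using leaf_perm_eqI[OF permutes_id, of 1 "[0]"] by simp
    then show ?thesis
      using induced_single[OF Leaf_alt_trees] Q.act_id[OF order_refl Q.id_closed]
      by (simp add: tree_id tree_value_def)
  qed
  ultimately show ?thesis
    using induced_linear act unfolding operad_morphism_def linear_map_def by blast
qed

end

section \<open>Trees rebuilt from their corollas, and uniqueness\<close>

lemma (in operad_pair)
  shows binary_colour_black: "binary_operad O1 \<Longrightarrow>
      binary_colour O1 O1 O2 Black is_Black (black_label O1) black_inputs (black_vertex O1)"
    and binary_colour_white: "binary_operad O2 \<Longrightarrow>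
      binary_colour O2 O1 O2 White is_White (white_label O2) white_inputs (white_vertex O2)"
  by (auto intro!: binary_colour.intro binary_colour_axioms.intro
      black.vertex_colour_axioms white.vertex_colour_axioms operad_pair_axioms)

text \<open>
  If the leaves are numbered in planar order, starting with \<open>k\<close>, then composing a corolla with the trees
  that are its inputs, each renumbered from 0, gives the whole tree renumbered from 0.
\<close>

lemma (in binary_colour) incl_comp_planar:
  assumes alt: "alternating O1 O2 (V a ts)" and planar: "concat (map leaves ts) = [k..<k + n]"
  defines "ns \<equiv> map (length \<circ> leaves) ts"
  shows "op_comp (tree_operad O1 O2) ns (incl (length ts) a)
      (map (\<lambda>i. tree_class O1 O2 (ns ! i)
        (single_tree (relabel (\<lambda>j. j - (k + block_start ns i)) (ts ! i)))) [0..<length ts]) =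
    tree_class O1 O2 n (single_tree (relabel (\<lambda>j. j - k) (V a ts)))"
proof -
  let ?us = "map (\<lambda>i. relabel (\<lambda>j. j - (k + block_start ns i)) (ts ! i)) [0..<length ts]"
  have two: "2 \<le> length ts" and a: "a \<in> op_carrier P (length ts)"
    and ts: "\<And>t. t \<in> set ts \<Longrightarrow> \<not> is_V t \<and> alternating O1 O2 t"
    using alt by (auto simp: alternating_V)
  have len: "length ns = length ts"
    by (simp add: ns_def)
  have leaves_i: "leaves (ts ! i) = [k + block_start ns i..<k + block_start ns i + ns ! i]" if "i < length ts" for i
    using block_of_concat_upt[OF planar, of i] that by (simp add: ns_def comp_def)
  have "length (concat (map leaves ts)) = n"
    by (simp add: planar)
  then have sum: "sum_list ns = n"
    by (simp add: ns_def length_concat)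
  have "relabel (\<lambda>j. j - (k + block_start ns i)) (ts ! i) \<in> alt_trees O1 O2 (ns ! i)" if i: "i < length ts" for i
  proof -
    have "map (\<lambda>j. j - (k + block_start ns i)) [k + block_start ns i..<k + block_start ns i + ns ! i] = [0..<ns ! i]"
      by (rule nth_equalityI) simp_all
    then show ?thesis
      using ts[of "ts ! i"] i by (simp add: alt_trees_iff_mset alternating_relabel leaves_relabel leaves_i)
  qed
  then have forest: "alt_forest O1 O2 ns ?us"
    by (simp add: list_all2_conv_all_nth len)
  have corolla: "corolla (length ns) a \<in> alt_trees O1 O2 (length ns)"
    using a two by (intro corolla_alt_trees) (simp_all add: len)
  have "incl (length ts) a = tree_class O1 O2 (length ns) (single_tree (corolla (length ns) a))"
    using a two by (subst incl_corolla) (simp_all add: corolla_labels_def len)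
  moreover have "map (\<lambda>i. tree_class O1 O2 (ns ! i)
        (single_tree (relabel (\<lambda>j. j - (k + block_start ns i)) (ts ! i)))) [0..<length ts] =
      map2 (\<lambda>n t. tree_class O1 O2 n (single_tree t)) ns ?us"
    by (rule nth_equalityI) (simp_all add: len)
  moreover have "tree_comp O1 O2 ns (corolla (length ns) a) ?us = relabel (\<lambda>j. j - k) (V a ts)"
  proof -
    have "tree_comp O1 O2 ns (corolla (length ns) a) ?us =
        vertex a (map (\<lambda>i. relabel (\<lambda>j. block_start ns i + j) (?us ! i)) [0..<length ts])"
      using two by (simp add: tree_comp_def corolla_def graft_V comp_def len)
    also have "map (\<lambda>i. relabel (\<lambda>j. block_start ns i + j) (?us ! i)) [0..<length ts] =
        map (relabel (\<lambda>j. j - k)) ts"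
      by (rule nth_equalityI) (auto simp: relabel_relabel leaves_i intro!: relabel_cong)
    also have "vertex a (map (relabel (\<lambda>j. j - k)) ts) = V a (map (relabel (\<lambda>j. j - k)) ts)"
      using two a ts by (intro vertex_uncontracted) (auto simp: is_V_relabel)
    finally show ?thesis
      by (simp add: relabel_V)
  qed
  ultimately show ?thesis
    using tree_operad_comp_single[OF corolla forest] by (simp add: sum)
qed

locale binary_pair = operad_pair O1 O2
  for O1 :: "('k::field, 'a) operad" and O2 :: "('k, 'b) operad" +
  assumes binary1: "binary_operad O1" and binary2: "binary_operad O2"
begin

interpretation b: binary_colour O1 O1 O2 Black is_Black "black_label O1" black_inputs "black_vertex O1"
  by (rule binary_colour_black[OF binary1])

interpretation w: binary_colour O2 O1 O2 White is_White "white_label O2" white_inputs "white_vertex O2"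
  by (rule binary_colour_white[OF binary2])

lemma incl_eq: "b.incl = incl1 O1 O2" "w.incl = incl2 O1 O2"
  by (intro ext; simp only: b.incl_def w.incl_def incl1_def incl2_def)+

lemma incl_morphisms:
  "operad_morphism O1 (tree_operad O1 O2) (incl1 O1 O2)" "operad_morphism O2 (tree_operad O1 O2) (incl2 O1 O2)"
  using b.incl_morphism w.incl_morphism by (simp_all only: incl_eq)

interpretation T: pair_evaluation O1 O2 "tree_operad O1 O2" "incl1 O1 O2" "incl2 O1 O2"
  by (intro pair_evaluation.intro pair_evaluation_axioms.intro operad_pair_axioms
      symmetric_operad_tree_operad incl_morphisms)

text \<open>
  Evaluation in \<open>T\<close> along the canonical maps rebuilds a tree from its corollas. The offset \<open>k\<close> is
  there for the induction, as inputs of a vertex are not numbered from 0.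
\<close>

lemma eval_in_trees_planar:
  "\<lbrakk>alternating O1 O2 t; leaves t = [k..<k + n]\<rbrakk> \<Longrightarrow>
    T.ev t = tree_class O1 O2 n (single_tree (relabel (\<lambda>j. j - k) t))"
proof (induction t arbitrary: k n)
  case (Leaf i)
  have "length [k..<k + n] = 1"
    by (simp flip: Leaf.prems(2))
  then have "n = 1" by simp
  with Leaf show ?case by (simp add: tree_id)
next
  case (Black a ts)
  let ?ns = "map (length \<circ> leaves) ts"
  have planar: "concat (map leaves ts) = [k..<k + n]"
    using Black.prems by simp
  have "T.ev (ts ! i) = tree_class O1 O2 (?ns ! i)
      (single_tree (relabel (\<lambda>j. j - (k + block_start ?ns i)) (ts ! i)))" if "i < length ts" for i
    using that Black.prems(1) block_of_concat_upt[OF planar, of i] by (intro Black.IH) (auto simp: comp_def)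
  then have "map T.ev ts = map (\<lambda>i. tree_class O1 O2 (?ns ! i)
      (single_tree (relabel (\<lambda>j. j - (k + block_start ?ns i)) (ts ! i)))) [0..<length ts]"
    by (intro nth_equalityI) simp_all
  then show ?case
    using b.incl_comp_planar[OF Black.prems(1) planar] by (simp only: eval_tree.simps incl_eq)
next
  case (White a ts)
  let ?ns = "map (length \<circ> leaves) ts"
  have planar: "concat (map leaves ts) = [k..<k + n]"
    using White.prems by simp
  have "T.ev (ts ! i) = tree_class O1 O2 (?ns ! i)
      (single_tree (relabel (\<lambda>j. j - (k + block_start ?ns i)) (ts ! i)))" if "i < length ts" for i
    using that White.prems(1) block_of_concat_upt[OF planar, of i] by (intro White.IH) (auto simp: comp_def)
  then have "map T.ev ts = map (\<lambda>i. tree_class O1 O2 (?ns ! i)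
      (single_tree (relabel (\<lambda>j. j - (k + block_start ?ns i)) (ts ! i)))) [0..<length ts]"
    by (intro nth_equalityI) simp_all
  then show ?case
    using w.incl_comp_planar[OF White.prems(1) planar] by (simp only: eval_tree.simps incl_eq)
qed

text \<open>
  Trees with arbitrary numbers are renumbered into planar order and back.
\<close>

lemma tree_value_in_trees:
  assumes t: "t \<in> alt_trees O1 O2 n"
  shows "T.tree_value n t = tree_class O1 O2 n (single_tree t)"
proof -
  let ?\<pi> = "leaf_perm (leaves t)"
  \<comment> \<open>\<open>t0\<close> is \<open>t\<close> with its leaves numbered in planar order\<close>
  define t0 where "t0 = relabel (inv_into UNIV ?\<pi>) t"
  note \<pi> = T.alt_trees_leaf_perm[OF t]
  have t0: "t0 \<in> alt_trees O1 O2 n"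
    unfolding t0_def using t permutes_inv[OF \<pi>] by (rule relabel_alt_trees)
  have "leaves t = map ?\<pi> [0..<n]"
    using map_leaf_perm[of "leaves t"] by (simp add: alt_trees_length_leaves[OF t])
  then have "leaves t0 = map (inv_into UNIV ?\<pi>) (map ?\<pi> [0..<n])"
    by (simp add: t0_def leaves_relabel)
  then have leaves_t0: "leaves t0 = [0..<n]"
    using permutes_inverses(2)[OF \<pi>] by (simp add: comp_def)
  have "T.ev t = T.ev t0"
    by (simp add: t0_def T.eval_relabel)
  also have "\<dots> = tree_class O1 O2 n (single_tree t0)"
    using eval_in_trees_planar[of t0 0 n] alt_trees_alternating[OF t0] leaves_t0 by (simp add: relabel_ident)
  finally have "T.tree_value n t = tree_class O1 O2 n (single_tree (relabel ?\<pi> t0))"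
    using tree_act[OF \<pi> single_tree_formal[OF t0]] by (simp add: T.tree_value_def relabel_ext_lin)
  also have "relabel ?\<pi> t0 = t"
    using permutes_inverses(1)[OF \<pi>] by (simp add: t0_def relabel_relabel relabel_ident)
  finally show ?thesis .
qed

context
  fixes Q :: "('k, 'q) operad" and \<psi>1 \<psi>2
  assumes Q: "symmetric_operad Q" "operad_morphism O1 Q \<psi>1" "operad_morphism O2 Q \<psi>2"
begin

interpretation E: pair_evaluation O1 O2 Q \<psi>1 \<psi>2
  by (intro pair_evaluation.intro pair_evaluation_axioms.intro operad_pair_axioms Q)

lemma induced_incl:
  assumes n: "1 \<le> n"
  shows "a \<in> op_carrier O1 n \<Longrightarrow> E.induced n (incl1 O1 O2 n a) = \<psi>1 n a"
    and "b \<in> op_carrier O2 n \<Longrightarrow> E.induced n (incl2 O1 O2 n b) = \<psi>2 n b"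
proof -
  have perm: "leaf_perm [0..<n] = id"
    using leaf_perm_eqI[OF permutes_id, of n "[0..<n]"] by simp
  have linear: "linear_map (op_space R n) (op_space Q n) (\<lambda>a. E.induced n (incl n a))"
    if "operad_morphism R (tree_operad O1 O2) incl" for R :: "('k, 'c) operad" and incl
    using E.induced_linear operad_morphism_graded_linear[OF that] n by (auto simp: linear_map_def)
  have one: "leaf_perm [0] = id"
    using leaf_perm_eqI[OF permutes_id, of 1 "[0]"] by simp
  show "E.induced n (incl1 O1 O2 n a) = \<psi>1 n a" if "a \<in> op_carrier O1 n"
  proof (rule linear_map_eq_by_spanning[OF O1.symmetric_operad_axioms Q(1) n linear[OF incl_morphisms(1)] _
        b.corolla_labels_closed b.spanned_by_corolla_labels[OF n] _ that])
    show "linear_map (op_space O1 n) (op_space Q n) (\<psi>1 n)"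
      using operad_morphism_graded_linear[OF Q(2)] n by blast
    fix a assume a: "a \<in> b.corolla_labels n"
    then have aP: "a \<in> op_carrier O1 n"
      using b.corolla_labels_closed by blast
    have "E.induced n (incl1 O1 O2 n a) = E.tree_value n (b.corolla n a)"
      using b.incl_corolla[OF a] E.induced_single[OF b.corolla_alt_trees[OF n aP]] by (simp only: incl_eq)
    also have "\<dots> = \<psi>1 n a"
      using a n E.black_eval.\<psi>_id E.black_eval.ev_corolla[OF n aP] E.Q.act_id[OF n E.black_eval.\<psi>_closed[OF n aP]]
      by (auto simp: E.tree_value_def b.corolla_def b.corolla_labels_def one perm comp_def split: if_splits)
    finally show "E.induced n (incl1 O1 O2 n a) = \<psi>1 n a" .
  qed
  show "E.induced n (incl2 O1 O2 n b) = \<psi>2 n b" if "b \<in> op_carrier O2 n"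
  proof (rule linear_map_eq_by_spanning[OF O2.symmetric_operad_axioms Q(1) n linear[OF incl_morphisms(2)] _
        w.corolla_labels_closed w.spanned_by_corolla_labels[OF n] _ that])
    show "linear_map (op_space O2 n) (op_space Q n) (\<psi>2 n)"
      using operad_morphism_graded_linear[OF Q(3)] n by blast
    fix a assume a: "a \<in> w.corolla_labels n"
    then have aP: "a \<in> op_carrier O2 n"
      using w.corolla_labels_closed by blast
    have "E.induced n (incl2 O1 O2 n a) = E.tree_value n (w.corolla n a)"
      using w.incl_corolla[OF a] E.induced_single[OF w.corolla_alt_trees[OF n aP]] by (simp only: incl_eq)
    also have "\<dots> = \<psi>2 n a"
      using a n E.white_eval.\<psi>_id E.white_eval.ev_corolla[OF n aP] E.Q.act_id[OF n E.white_eval.\<psi>_closed[OF n aP]]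
      by (auto simp: E.tree_value_def w.corolla_def w.corolla_labels_def one perm comp_def split: if_splits)
    finally show "E.induced n (incl2 O1 O2 n a) = \<psi>2 n a" .
  qed
qed

text \<open>
  A morphism commutes with evaluation, and every class of a tree is a value in \<open>T\<close>.
\<close>

lemma factorization_unique:
  assumes \<phi>: "operad_morphism (tree_operad O1 O2) Q \<phi>"
    and \<phi>1: "\<And>n a. \<lbrakk>1 \<le> n; a \<in> op_carrier O1 n\<rbrakk> \<Longrightarrow> \<phi> n (incl1 O1 O2 n a) = \<psi>1 n a"
    and \<phi>2: "\<And>n b. \<lbrakk>1 \<le> n; b \<in> op_carrier O2 n\<rbrakk> \<Longrightarrow> \<phi> n (incl2 O1 O2 n b) = \<psi>2 n b"
    and n: "1 \<le> n" and A: "A \<in> op_carrier (tree_operad O1 O2) n"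
  shows "\<phi> n A = E.induced n A"
proof -
  let ?T = "tree_operad O1 O2"
  have \<phi>_comp: "\<phi> (sum_list ns) (op_comp ?T ns x ys) = op_comp Q ns (\<phi> (length ns) x) (map2 \<phi> ns ys)"
    if "arity_list ns" "x \<in> op_carrier ?T (length ns)" "op_args ?T ns ys" for ns x ys
    using \<phi> that by (simp add: operad_morphism_def)
  have eval: "\<phi> (length (leaves t)) (T.ev t) = E.ev t" if "alternating O1 O2 t" for t
    using that
  proof (induction t)
    case (Leaf i)
    then show ?case
      using \<phi> by (simp add: operad_morphism_def)
  next
    case (Black a ts)
    have ts: "ts \<noteq> []" "1 \<le> length ts" "a \<in> op_carrier O1 (length ts)"
      "\<And>t. t \<in> set ts \<Longrightarrow> T.black_eval.evaluable t"
      using Black.prems T.alternating_evaluable by auto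
    have "map2 \<phi> (map (length \<circ> leaves) ts) (map T.ev ts) = map E.ev ts"
      using Black by (intro nth_equalityI) auto
    then show ?case
      using \<phi>_comp[OF T.black_eval.evaluable_args(1)[OF ts(1,4)] _ T.black_eval.evaluable_args(2)[OF ts(1,4)],
          of "incl1 O1 O2 (length ts) a"] T.black_eval.\<psi>_closed[OF ts(2,3)] \<phi>1[OF ts(2,3)]
      by (simp add: length_concat)
  next
    case (White b ts)
    have ts: "ts \<noteq> []" "1 \<le> length ts" "b \<in> op_carrier O2 (length ts)"
      "\<And>t. t \<in> set ts \<Longrightarrow> T.white_eval.evaluable t"
      using White.prems T.alternating_evaluable by auto
    have "map2 \<phi> (map (length \<circ> leaves) ts) (map T.ev ts) = map E.ev ts"
      using White by (intro nth_equalityI) auto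
    then show ?case
      using \<phi>_comp[OF T.white_eval.evaluable_args(1)[OF ts(1,4)] _ T.white_eval.evaluable_args(2)[OF ts(1,4)],
          of "incl2 O1 O2 (length ts) b"] T.white_eval.\<psi>_closed[OF ts(2,3)] \<phi>2[OF ts(2,3)]
      by (simp add: length_concat)
  qed
  let ?G = "(\<lambda>t. tree_class O1 O2 n (single_tree t)) ` alt_trees O1 O2 n"
  have G: "?G \<subseteq> op_carrier ?T n"
    by (auto intro: tree_class_carrier single_tree_formal)
  show ?thesis
  proof (rule linear_map_eq_by_spanning[OF symmetric_operad_tree_operad Q(1) n _ _ G tree_classes_span _ A])
    show "linear_map (op_space ?T n) (op_space Q n) (\<phi> n)"
      using operad_morphism_graded_linear[OF \<phi>] n by blast
    show "linear_map (op_space ?T n) (op_space Q n) (E.induced n)"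
      using E.induced_linear n by blast
    fix B assume "B \<in> ?G"
    then obtain t where t: "t \<in> alt_trees O1 O2 n" and B: "B = tree_class O1 O2 n (single_tree t)"
      by blast
    have "\<phi> n B = op_act Q n (leaf_perm (leaves t)) (\<phi> n (T.ev t))"
      using \<phi> n T.alt_trees_eval(2)[OF t] T.alt_trees_leaf_perm[OF t]
      by (simp add: B T.tree_value_def operad_morphism_def flip: tree_value_in_trees[OF t])
    also have "\<dots> = E.tree_value n t"
      using eval[OF alt_trees_alternating[OF t]] by (simp add: E.tree_value_def alt_trees_length_leaves[OF t])
    finally show "\<phi> n B = E.induced n B"
      by (simp add: B E.induced_single[OF t])
  qed
qed

lemma factorization:
  "\<exists>\<psi>. operad_morphism (tree_operad O1 O2) Q \<psi> \<and>
    (\<forall>n\<ge>1. \<forall>a\<in>op_carrier O1 n. \<psi> n (incl1 O1 O2 n a) = \<psi>1 n a) \<and>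
    (\<forall>n\<ge>1. \<forall>b\<in>op_carrier O2 n. \<psi> n (incl2 O1 O2 n b) = \<psi>2 n b)"
  using E.induced_morphism induced_incl by blast

end

lemma free_product_tree_operad:
  "free_product TYPE('p) O1 O2 (tree_operad O1 O2) (incl1 O1 O2) (incl2 O1 O2)"
  unfolding free_product_def Let_def
proof (intro conjI allI impI)
  fix P :: "('k, 'p) operad" and \<psi>1 \<psi>2 \<psi> \<psi>' and n :: nat
  assume "symmetric_operad P \<and> operad_morphism O1 P \<psi>1 \<and> operad_morphism O2 P \<psi>2"
  then have P: "symmetric_operad P" "operad_morphism O1 P \<psi>1" "operad_morphism O2 P \<psi>2" by auto
  show "\<exists>\<psi>. operad_morphism (tree_operad O1 O2) P \<psi> \<and>
    (\<forall>n\<ge>1. \<forall>a\<in>op_carrier O1 n. \<psi> n (incl1 O1 O2 n a) = \<psi>1 n a) \<and>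
    (\<forall>n\<ge>1. \<forall>b\<in>op_carrier O2 n. \<psi> n (incl2 O1 O2 n b) = \<psi>2 n b)"
    by (rule factorization[OF P])
  let ?factors = "\<lambda>\<psi>. operad_morphism (tree_operad O1 O2) P \<psi> \<and>
    (\<forall>n\<ge>1. \<forall>a\<in>op_carrier O1 n. \<psi> n (incl1 O1 O2 n a) = \<psi>1 n a) \<and>
    (\<forall>n\<ge>1. \<forall>b\<in>op_carrier O2 n. \<psi> n (incl2 O1 O2 n b) = \<psi>2 n b)"
  assume "?factors \<psi> \<and> ?factors \<psi>'" and n: "1 \<le> n"
  then show "\<forall>A\<in>op_carrier (tree_operad O1 O2) n. \<psi> n A = \<psi>' n A"
    using factorization_unique[OF P, of \<psi> n] factorization_unique[OF P, of \<psi>' n] by auto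
qed (simp_all add: symmetric_operad_tree_operad incl_morphisms)

end

section \<open>Comparison of free products\<close>

lemma operad_morphism_compose:
  assumes f: "operad_morphism P Q f" and g: "operad_morphism Q R g"
  shows "operad_morphism P R (\<lambda>n x. g n (f n x))"
proof -
  have "op_args Q ns (map2 f ns ys)" if "arity_list ns" "op_args P ns ys" for ns ys
    using that f by (auto simp: operad_morphism_def op_args_def arity_list_def list_all2_conv_all_nth)
  moreover have "map2 g ns (map2 f ns ys) = map2 (\<lambda>n x. g n (f n x)) ns ys" for ns ys
    by (rule nth_equalityI) simp_all
  moreover have "1 \<le> length ns" if "arity_list ns" for ns
    using that by (simp add: arity_list_def Suc_le_eq)
  ultimately show ?thesis
    using f g unfolding operad_morphism_def by simp
qed

lemma operad_morphism_ident:
  fixes P :: "('k::field, 'a) operad"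
  shows "operad_morphism P P (\<lambda>n x. x)"
proof -
  have "map2 (\<lambda>n x. x) ns ys = ys" if "op_args P ns ys" for ns and ys :: "'a list"
    using that by (intro nth_equalityI) (auto simp: op_args_def list_all2_conv_all_nth)
  then show ?thesis
    by (simp add: operad_morphism_def)
qed

text \<open>
  The two universal properties give morphisms both ways, whose composites are the identity by
  uniqueness. This takes each property for test operads over the element types of both \<open>T\<close> and \<open>Q\<close>.
\<close>

lemma free_products_isomorphic:
  fixes T :: "('k::field, 't) operad" and Q :: "('k, 'q) operad"
  assumes T: "free_product TYPE('t) O1 O2 T \<iota>1 \<iota>2" "free_product TYPE('q) O1 O2 T \<iota>1 \<iota>2"
    and Q: "free_product TYPE('t) O1 O2 Q \<pi>1 \<pi>2" "free_product TYPE('q) O1 O2 Q \<pi>1 \<pi>2"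
  shows "operad_isomorphic T Q"
proof -
  have TQ: "symmetric_operad T" "operad_morphism O1 T \<iota>1" "operad_morphism O2 T \<iota>2"
    "symmetric_operad Q" "operad_morphism O1 Q \<pi>1" "operad_morphism O2 Q \<pi>2"
    using T(1) Q(1) by (simp_all add: free_product_def)
  obtain f where f: "operad_morphism T Q f"
    "\<forall>n\<ge>1. \<forall>x\<in>op_carrier O1 n. f n (\<iota>1 n x) = \<pi>1 n x" "\<forall>n\<ge>1. \<forall>x\<in>op_carrier O2 n. f n (\<iota>2 n x) = \<pi>2 n x"
    using T(2) TQ unfolding free_product_def Let_def by blast
  obtain g where g: "operad_morphism Q T g"
    "\<forall>n\<ge>1. \<forall>x\<in>op_carrier O1 n. g n (\<pi>1 n x) = \<iota>1 n x" "\<forall>n\<ge>1. \<forall>x\<in>op_carrier O2 n. g n (\<pi>2 n x) = \<iota>2 n x"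
    using Q(1) TQ unfolding free_product_def Let_def by blast
  have gf: "g n (f n x) = x" if "1 \<le> n" "x \<in> op_carrier T n" for n x
  proof -
    have "\<forall>\<psi> \<psi>'. (operad_morphism T T \<psi> \<and> (\<forall>n\<ge>1. \<forall>x\<in>op_carrier O1 n. \<psi> n (\<iota>1 n x) = \<iota>1 n x) \<and>
          (\<forall>n\<ge>1. \<forall>x\<in>op_carrier O2 n. \<psi> n (\<iota>2 n x) = \<iota>2 n x)) \<and>
        operad_morphism T T \<psi>' \<and> (\<forall>n\<ge>1. \<forall>x\<in>op_carrier O1 n. \<psi>' n (\<iota>1 n x) = \<iota>1 n x) \<and>
          (\<forall>n\<ge>1. \<forall>x\<in>op_carrier O2 n. \<psi>' n (\<iota>2 n x) = \<iota>2 n x) \<longrightarrow>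
        (\<forall>n\<ge>1. \<forall>x\<in>op_carrier T n. \<psi> n x = \<psi>' n x)"
      using T(1) TQ unfolding free_product_def Let_def by blast
    from this[rule_format, of "\<lambda>n x. g n (f n x)" "\<lambda>n x. x" n x]
    show ?thesis
      using operad_morphism_compose[OF f(1) g(1)] operad_morphism_ident[of T] f g that by auto
  qed
  have fg: "f n (g n x) = x" if "1 \<le> n" "x \<in> op_carrier Q n" for n x
  proof -
    have "\<forall>\<psi> \<psi>'. (operad_morphism Q Q \<psi> \<and> (\<forall>n\<ge>1. \<forall>x\<in>op_carrier O1 n. \<psi> n (\<pi>1 n x) = \<pi>1 n x) \<and>
          (\<forall>n\<ge>1. \<forall>x\<in>op_carrier O2 n. \<psi> n (\<pi>2 n x) = \<pi>2 n x)) \<and>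
        operad_morphism Q Q \<psi>' \<and> (\<forall>n\<ge>1. \<forall>x\<in>op_carrier O1 n. \<psi>' n (\<pi>1 n x) = \<pi>1 n x) \<and>
          (\<forall>n\<ge>1. \<forall>x\<in>op_carrier O2 n. \<psi>' n (\<pi>2 n x) = \<pi>2 n x) \<longrightarrow>
        (\<forall>n\<ge>1. \<forall>x\<in>op_carrier Q n. \<psi> n x = \<psi>' n x)"
      using Q(2) TQ unfolding free_product_def Let_def by blast
    from this[rule_format, of "\<lambda>n x. f n (g n x)" "\<lambda>n x. x" n x]
    show ?thesis
      using operad_morphism_compose[OF g(1) f(1)] operad_morphism_ident[of Q] f g that by auto
  qed
  have "bij_betw (f n) (op_carrier T n) (op_carrier Q n)" if n: "1 \<le> n" for n
    using f(1) g(1) n gf[OF n] fg[OF n] unfolding operad_morphism_def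
    by (intro bij_betw_byWitness[where f' = "g n"]) auto
  with f(1) show ?thesis
    by (auto simp: operad_isomorphic_def)
qed

theorem theorem1:
  fixes O1 :: "('k::field, 'a) operad" and O2 :: "('k, 'b) operad"
  assumes "binary_operad O1" and "binary_operad O2"
  shows "free_product TYPE('p) O1 O2 (tree_operad O1 O2) (incl1 O1 O2) (incl2 O1 O2) \<and>
    (\<forall>(Q :: ('k, 'q) operad) \<pi>1 \<pi>2.
       free_product TYPE((('a, 'b) ltree \<Rightarrow>\<^sub>0 'k) set) O1 O2 Q \<pi>1 \<pi>2 \<and>
       free_product TYPE('q) O1 O2 Q \<pi>1 \<pi>2 \<longrightarrow>
       operad_isomorphic (tree_operad O1 O2) Q)"
proof -
  interpret binary_pair O1 O2
    using assms by (intro binary_pair.intro operad_pair.intro binary_pair_axioms.intro) (simp_all add: binary_operad_def)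
  show ?thesis
    using free_product_tree_operad free_products_isomorphic[OF free_product_tree_operad free_product_tree_operad]
    by blast
qed

end
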